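(* Let $G$ be a finite group with $G\in\mathcal{D}_4$ and $G\not\cong\mathrm{A}_5$. Then $G$ is solvable, and either $G$ has derived length at most $2$ or $G\cong\mathrm{SL}_2(3)$.
   Context: $\mathcal{D}(G)$ denotes the number of conjugacy classes of nontrivial subgroups $H$ of the finite group $G$ with $N_G(H)\neq H$; $\mathcal{D}_n$ is the family of finite groups $G$ with $\mathcal{D}(G)=n$. *)

theory Defs
  imports "HOL-Algebra.Algebra"
begin

definition subgroup_conj_class :: "('a, 'b) monoid_scheme \<Rightarrow> 'a set \<Rightarrow> 'a set set" where
  "subgroup_conj_class G H = {g <#\<^bsub>G\<^esub> H #>\<^bsub>G\<^esub> inv\<^bsub>G\<^esub> g | g. g \<in> carrier G}"

definition D_count :: "('a, 'b) monoid_scheme \<Rightarrow> nat" where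
  "D_count G = card {subgroup_conj_class G H | H.
       subgroup H G \<and> H \<noteq> {\<one>\<^bsub>G\<^esub>} \<and> normalizer G H \<noteq> H}"

text \<open>SL_2(3): 2x2 matrices (a,b;c,d) with entries in {0,1,2} = Z/3Z and determinant 1.\<close>
fun SL23_mult :: "int \<times> int \<times> int \<times> int \<Rightarrow> int \<times> int \<times> int \<times> int \<Rightarrow> int \<times> int \<times> int \<times> int" where
  "SL23_mult (a, b, c, d) (a', b', c', d') =
     ((a * a' + b * c') mod 3, (a * b' + b * d') mod 3,
      (c * a' + d * c') mod 3, (c * b' + d * d') mod 3)"

definition SL23_carrier :: "(int \<times> int \<times> int \<times> int) set" where
  "SL23_carrier = {(a, b, c, d). a \<in> {0..2} \<and> b \<in> {0..2} \<and> c \<in> {0..2} \<and> d \<in> {0..2}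
                          \<and> (a * d - b * c) mod 3 = 1}"

definition SL23 :: "(int \<times> int \<times> int \<times> int) monoid" where
  "SL23 = \<lparr> carrier = SL23_carrier, monoid.mult = SL23_mult, one = (1, 0, 0, 1) \<rparr>"

end

theory Submission
  imports Defs
begin

text \<open>
  Conjugate subgroups have equal order, so a group with at most four classes of non-self-normalizing
  subgroups has at most four orders of such subgroups. These are easy to produce: proper normal subgroups,
  \<open>p\<close>-subgroups that are not Sylow, and, in a simple group, abelian Sylow subgroups (by Burnside's transfer theorem).

  If the group is not solvable, let \<open>R\<close> be the last term of its derived series and \<open>N\<close> a maximal normal
  subgroup of \<open>R\<close>. The simple group \<open>R/N\<close> inherits the bound on orders, which leaves only
  \<open>p\<^sup>2qr\<close>, hence order 60 with a subgroup of index 5, hence \<open>A\<^sub>5\<close>. Its four orders use up all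
  that are allowed, so \<open>N\<close> is trivial and \<open>R\<close> is the whole group.

  If the group is solvable with \<open>G'' \<noteq> 1\<close>, take \<open>M\<close> normal of prime index. Every prime power other than 1
  dividing \<open>|M|\<close> is the order of a non-self-normalizing subgroup, and so is \<open>|M|\<close> itself. Hence \<open>|M|\<close> is \<open>p\<^sup>3\<close>,
  \<open>p\<^sup>4\<close> or \<open>t\<^sup>2q\<close>, and \<open>M\<close> is nonabelian. As each order then belongs to few classes, the complement acts
  transitively on the many maximal subgroups of a noncyclic \<open>p\<close>-group, which forces \<open>|M| = 8\<close> and index 3.
\<close>

hide_const (open) Divisibility.prime

section \<open>Group actions and conjugation\<close>

text \<open>Orders behave better than classes: the order of a non-self-normalizing subgroup survives
  the passage from a subgroup to the whole group and, up to a constant factor, from a quotient,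
  whereas classes may fuse. In a nonabelian simple group every prime divisor is such an order, and
  transfer forces the square of the smallest one, p, to divide the group order, so p^2 is another;
  four orders then allow at most three primes. Two primes are excluded by counting Sylow subgroups
  and their elements. The obstacle is p^3qr: a Sylow p-subgroup may be nonabelian there, so transfer
  is applied modulo a subgroup of it. The constant 60 comes from a fixed point free action on a
  group of order p^2: it gives p = 2, a normalizer of order 12, and a last prime that divides 6 - 1.
  In the solvable half the index s of M is taken prime so that orbits of G on subgroups normalized
  by M have length 1 or s. A nonabelian group of order p^3 has p + 1 maximal subgroups; s = p + 1
  with both numbers prime is the source of 8 and 3.\<close>

definition acts :: "('a,'b) monoid_scheme \<Rightarrow> 'c set \<Rightarrow> ('a \<Rightarrow> 'c \<Rightarrow> 'c) \<Rightarrow> bool" where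
  "acts G E f \<longleftrightarrow> (\<forall>g\<in>carrier G. \<forall>x\<in>E. f g x \<in> E) \<and> (\<forall>x\<in>E. f \<one>\<^bsub>G\<^esub> x = x) \<and>
     (\<forall>g\<in>carrier G. \<forall>h\<in>carrier G. \<forall>x\<in>E. f (g \<otimes>\<^bsub>G\<^esub> h) x = f g (f h x))"

lemma (in group) acts_inv_cancel:
  assumes "acts G E f" "g \<in> carrier G" "x \<in> E"
  shows "f (inv g) (f g x) = x" "f g (f (inv g) x) = x"
  using assms unfolding acts_def by (metis inv_closed l_inv r_inv)+

text \<open>The fibres over the orbit of \<open>x\<close> are left translates of the stabilizer, so
  they all have its size.\<close>

lemma (in group) orbit_stabilizer_count:
  assumes a: "acts G E f" and x: "x \<in> E" and fin: "finite (carrier G)"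
  shows "card ((\<lambda>g. f g x) ` carrier G) * card {g \<in> carrier G. f g x = x} = order G"
proof -
  have fib: "card {g \<in> carrier G. f g x = y} = card {g \<in> carrier G. f g x = x}"
    if y: "y \<in> (\<lambda>g. f g x) ` carrier G" for y
  proof -
    obtain g0 where g0: "g0 \<in> carrier G" "y = f g0 x" using y by auto
    have "bij_betw (\<lambda>h. g0 \<otimes> h) {g \<in> carrier G. f g x = x} {g \<in> carrier G. f g x = y}"
    proof (rule bij_betw_byWitness[where f' = "\<lambda>h. inv g0 \<otimes> h"])
      show "\<forall>h\<in>{g \<in> carrier G. f g x = x}. inv g0 \<otimes> (g0 \<otimes> h) = h"
        using g0 by (auto simp: m_assoc[symmetric])
      show "\<forall>h\<in>{g \<in> carrier G. f g x = y}. g0 \<otimes> (inv g0 \<otimes> h) = h"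
        using g0 by (auto simp: m_assoc[symmetric])
      show "(\<lambda>h. g0 \<otimes> h) ` {g \<in> carrier G. f g x = x} \<subseteq> {g \<in> carrier G. f g x = y}"
      proof clarify
        fix h assume h: "h \<in> carrier G" "f h x = x"
        have "f (g0 \<otimes> h) x = f g0 (f h x)" using g0 a x h(1) unfolding acts_def by blast
        then show "g0 \<otimes> h \<in> carrier G \<and> f (g0 \<otimes> h) x = y" using g0 h by simp
      qed
      have "f (inv g0 \<otimes> h) x = x" if h: "h \<in> carrier G" "f h x = y" for h
      proof -
        have "f (inv g0 \<otimes> h) x = f (inv g0) (f h x)"
          using g0 a x h(1) unfolding acts_def by (meson inv_closed)
        also have "\<dots> = x" unfolding h(2) g0(2) by (rule acts_inv_cancel[OF a g0(1) x])
        finally show ?thesis .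
      qed
      note key = this
      show "(\<lambda>h. inv g0 \<otimes> h) ` {g \<in> carrier G. f g x = y} \<subseteq> {g \<in> carrier G. f g x = x}"
      proof (rule image_subsetI)
        fix h assume h: "h \<in> {g \<in> carrier G. f g x = y}"
        then show "inv g0 \<otimes> h \<in> {g \<in> carrier G. f g x = x}" using key[of h] g0(1) by simp
      qed
    qed
    from bij_betw_same_card[OF this] show ?thesis by (rule sym)
  qed
  have "order G = (\<Sum>g\<in>carrier G. 1)" by (simp add: order_def)
  also have "\<dots> = (\<Sum>y\<in>(\<lambda>g. f g x) ` carrier G. \<Sum>g\<in>{g \<in> carrier G. f g x = y}. 1)"
    by (rule sum.image_gen[OF fin])
  also have "\<dots> = (\<Sum>y\<in>(\<lambda>g. f g x) ` carrier G. card {g \<in> carrier G. f g x = x})"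
    using fib by (intro sum.cong) auto
  finally show ?thesis by simp
qed

text \<open>Moved points fall into orbits whose lengths are powers of \<open>p\<close> other than 1.
  Counting the moved points, not the fixed ones modulo \<open>p\<close>, keeps congruences out of
  the applications.\<close>

lemma (in group) prime_dvd_card_moved:
  assumes a: "acts G E f" and finE: "finite E" and p: "prime p" and o: "order G = p ^ n"
  shows "p dvd card (E - {x\<in>E. \<forall>g\<in>carrier G. f g x = x})"
proof -
  have fin: "finite (carrier G)"
    by (metis o p order_gt_0_iff_finite prime_gt_0_nat zero_less_power)
  define orb where "orb x = (\<lambda>g. f g x) ` carrier G" for x
  let ?F = "{x\<in>E. \<forall>g\<in>carrier G. f g x = x}"
  have orbI: "x \<in> orb x" if "x \<in> E" for x
    using that a unfolding orb_def acts_def by (metis (no_types, lifting) image_eqI one_closed)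
  have orb_eq: "orb y = orb x" if that: "x \<in> E" and y: "y \<in> orb x" for x y
  proof -
    obtain g where g: "g \<in> carrier G" "y = f g x" using y unfolding orb_def by auto
    have "orb y \<subseteq> orb x" using g a that unfolding orb_def acts_def
      by (auto simp: image_iff) (metis m_closed)
    moreover have "orb x \<subseteq> orb y"
    proof
      fix z assume "z \<in> orb x"
      then obtain h where h: "h \<in> carrier G" "z = f h x" unfolding orb_def by auto
      have "x = f (inv g) y" using acts_inv_cancel[OF a g(1) that] g by simp
      then have "z = f (h \<otimes> inv g) y" using h g a that unfolding acts_def by auto
      then show "z \<in> orb y" using h g unfolding orb_def by auto
    qed
    ultimately show ?thesis by auto
  qed
  have orbE: "orb x \<subseteq> E" if "x \<in> E" for x using that a unfolding orb_def acts_def by auto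
  have "\<Union>(orb ` (E - ?F)) = E - ?F"
  proof
    show "E - ?F \<subseteq> \<Union>(orb ` (E - ?F))" using orbI by blast
    show "\<Union>(orb ` (E - ?F)) \<subseteq> E - ?F"
    proof
      fix y assume "y \<in> \<Union>(orb ` (E - ?F))"
      then obtain x where x: "x \<in> E" "x \<notin> ?F" "y \<in> orb x" by blast
      have "y \<notin> ?F"
      proof
        assume "y \<in> ?F"
        then have "orb y \<subseteq> {y}" unfolding orb_def by auto
        then have "x = y" using orb_eq[OF x(1,3)] orbI[OF x(1)] by auto
        then show False using x \<open>y \<in> ?F\<close> by auto
      qed
      then show "y \<in> E - ?F" using orbE x by auto
    qed
  qed
  moreover have "p dvd card (\<Union>(orb ` (E - ?F)))"
  proof (rule dvd_partition)
    show "finite (\<Union>(orb ` (E - ?F)))" using \<open>\<Union>(orb ` (E - ?F)) = E - ?F\<close> finE by simp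
    show "\<forall>c\<in>orb ` (E - ?F). p dvd card c"
    proof
      fix c assume "c \<in> orb ` (E - ?F)"
      then obtain x where x: "x \<in> E" "x \<notin> ?F" "c = orb x" by blast
      have "card c dvd p ^ n" using orbit_stabilizer_count[OF a x(1) fin] x(3) o
        unfolding orb_def by (metis dvd_triv_left)
      then obtain k where k: "card c = p ^ k" using p divides_primepow_nat by blast
      have "card c \<noteq> 1"
      proof
        assume "card c = 1"
        then have "c = {x}" using orbI[OF x(1)] x(3) by (metis card_1_singletonE singletonD)
        then show False using x unfolding orb_def by blast
      qed
      then have "k \<noteq> 0" using k by (metis power_0)
      then show "p dvd card c" using k by simp
    qed
    show "\<forall>c1\<in>orb ` (E - ?F). \<forall>c2\<in>orb ` (E - ?F). c1 \<noteq> c2 \<longrightarrow> c1 \<inter> c2 = {}"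
      using orb_eq by blast
  qed
  ultimately show ?thesis by simp
qed

locale fin_group = group +
  assumes fin [simp]: "finite (carrier G)"
begin

definition cj :: "'a \<Rightarrow> 'a \<Rightarrow> 'a" where "cj g x = g \<otimes> x \<otimes> inv g"

definition nzr :: "'a set \<Rightarrow> 'a set" where "nzr H = {g \<in> carrier G. cj g ` H = H}"

definition nsn :: "'a set \<Rightarrow> bool" where "nsn H \<longleftrightarrow> subgroup H G \<and> H \<noteq> {\<one>} \<and> nzr H \<noteq> H"

lemma sub_finite: "subgroup H G \<Longrightarrow> finite H"
  using finite_subset[OF subgroup.subset fin] .

lemma sub_group: "subgroup H G \<Longrightarrow> fin_group (G\<lparr>carrier := H\<rparr>)"
  by (simp add: fin_group_def fin_group_axioms_def subgroup_imp_group sub_finite)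

lemma cj_closed [simp]: "g \<in> carrier G \<Longrightarrow> x \<in> carrier G \<Longrightarrow> cj g x \<in> carrier G"
  by (simp add: cj_def)

lemma cj_one_left [simp]: "x \<in> carrier G \<Longrightarrow> cj \<one> x = x"
  by (simp add: cj_def)

lemma cj_one_right [simp]: "g \<in> carrier G \<Longrightarrow> cj g \<one> = \<one>"
  by (simp add: cj_def)

lemma cj_comp: "g \<in> carrier G \<Longrightarrow> h \<in> carrier G \<Longrightarrow> x \<in> carrier G \<Longrightarrow> cj (g \<otimes> h) x = cj g (cj h x)"
  by (simp add: cj_def m_assoc inv_mult_group)

lemma cj_mult: "g \<in> carrier G \<Longrightarrow> x \<in> carrier G \<Longrightarrow> y \<in> carrier G \<Longrightarrow> cj g (x \<otimes> y) = cj g x \<otimes> cj g y"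
  by (simp add: cj_def m_assoc inv_solve_left)

lemma cj_inv: "g \<in> carrier G \<Longrightarrow> x \<in> carrier G \<Longrightarrow> cj g (inv x) = inv (cj g x)"
  by (simp add: cj_def m_assoc inv_mult_group)

lemma cj_inv_cancel [simp]: "g \<in> carrier G \<Longrightarrow> x \<in> carrier G \<Longrightarrow> cj (inv g) (cj g x) = x"
    "g \<in> carrier G \<Longrightarrow> x \<in> carrier G \<Longrightarrow> cj g (cj (inv g) x) = x"
  using cj_comp[symmetric] by simp_all

lemma cj_eq_iff: "g \<in> carrier G \<Longrightarrow> x \<in> carrier G \<Longrightarrow> cj g x = x \<longleftrightarrow> g \<otimes> x = x \<otimes> g"
  unfolding cj_def by (metis inv_closed inv_solve_right m_closed)

lemma cj_hom: "g \<in> carrier G \<Longrightarrow> group_hom G G (cj g)"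
  by (auto simp: group_hom_def group_hom_axioms_def hom_def cj_mult)

lemma cj_inj: "g \<in> carrier G \<Longrightarrow> inj_on (cj g) (carrier G)"
  by (metis cj_inv_cancel(1) inj_onI)

lemma cjs_subgroup: "g \<in> carrier G \<Longrightarrow> subgroup H G \<Longrightarrow> subgroup (cj g ` H) G"
  using group_hom.subgroup_img_is_subgroup[OF cj_hom] by blast

lemma cjs_card: "g \<in> carrier G \<Longrightarrow> H \<subseteq> carrier G \<Longrightarrow> card (cj g ` H) = card H"
  by (meson card_image cj_inj inj_on_subset)

lemma cjs_comp:
  assumes "g \<in> carrier G" "h \<in> carrier G" "H \<subseteq> carrier G"
  shows "cj (g \<otimes> h) ` H = cj g ` (cj h ` H)"
proof -
  have "cj (g \<otimes> h) x = cj g (cj h x)" if "x \<in> H" for x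
    using assms that by (auto intro: cj_comp)
  then show ?thesis by (simp add: image_image)
qed

lemma cjs_one: "H \<subseteq> carrier G \<Longrightarrow> cj \<one> ` H = H"
  by (auto simp: image_iff subset_iff)

lemma cjs_inv: "g \<in> carrier G \<Longrightarrow> H \<subseteq> carrier G \<Longrightarrow> cj g ` H = K \<Longrightarrow> cj (inv g) ` K = H"
  by (metis cjs_comp cjs_one inv_closed l_inv)

lemma acts_cjs: "K \<subseteq> carrier G \<Longrightarrow> subgroup K G \<Longrightarrow> (\<And>g H. g \<in> K \<Longrightarrow> H \<in> E \<Longrightarrow> cj g ` H \<in> E)
   \<Longrightarrow> (\<And>H. H \<in> E \<Longrightarrow> H \<subseteq> carrier G) \<Longrightarrow> acts (G\<lparr>carrier := K\<rparr>) E (\<lambda>g H. cj g ` H)"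
  unfolding acts_def by (simp add: cjs_one) (meson cjs_comp subsetD)

lemma acts_cj: "subgroup K G \<Longrightarrow> (\<And>g x. g \<in> K \<Longrightarrow> x \<in> E \<Longrightarrow> cj g x \<in> E)
   \<Longrightarrow> E \<subseteq> carrier G \<Longrightarrow> acts (G\<lparr>carrier := K\<rparr>) E cj"
  unfolding acts_def by simp (meson cj_comp cj_one_left subgroup.mem_carrier subsetD)

lemma nzr_subgroup: "H \<subseteq> carrier G \<Longrightarrow> subgroup (nzr H) G"
proof (rule subgroupI)
  assume H: "H \<subseteq> carrier G"
  show "nzr H \<subseteq> carrier G" "nzr H \<noteq> {}" using cjs_one[OF H] unfolding nzr_def by auto
  show "\<And>a. a \<in> nzr H \<Longrightarrow> inv a \<in> nzr H" using cjs_inv[OF _ H] unfolding nzr_def by auto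
  show "\<And>a b. a \<in> nzr H \<Longrightarrow> b \<in> nzr H \<Longrightarrow> a \<otimes> b \<in> nzr H"
    using cjs_comp[OF _ _ H] unfolding nzr_def by auto
qed

lemma cjs_self: "subgroup H G \<Longrightarrow> g \<in> H \<Longrightarrow> cj g ` H = H"
proof (rule card_seteq)
  assume H: "subgroup H G" and g: "g \<in> H"
  show "finite H" using sub_finite[OF H] .
  show "cj g ` H \<subseteq> H" unfolding cj_def using H g by (auto simp: subgroup.m_closed subgroup.m_inv_closed)
  show "card H \<le> card (cj g ` H)" using H g by (simp add: cjs_card subgroup.subset subgroup.mem_carrier)
qed

lemma nzr_ge: "subgroup H G \<Longrightarrow> H \<subseteq> nzr H"
  unfolding nzr_def using cjs_self subgroup.mem_carrier by fastforce

text \<open>Inclusion is enough, because conjugation is injective and \<open>H\<close> is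
  finite.\<close>

lemma nzrI: "subgroup H G \<Longrightarrow> g \<in> carrier G \<Longrightarrow> (\<And>x. x \<in> H \<Longrightarrow> cj g x \<in> H) \<Longrightarrow> g \<in> nzr H"
  unfolding nzr_def
  by (simp, rule card_seteq) (auto simp: sub_finite cjs_card subgroup.subset)

lemma nzrD: "g \<in> nzr H \<Longrightarrow> x \<in> H \<Longrightarrow> cj g x \<in> H"
  unfolding nzr_def by auto

lemma normal_iff_cj: "N \<lhd> G \<longleftrightarrow> subgroup N G \<and> (\<forall>g\<in>carrier G. \<forall>x\<in>N. cj g x \<in> N)"
  unfolding normal_inv_iff cj_def by auto

lemma normal_iff_nzr: "N \<lhd> G \<longleftrightarrow> subgroup N G \<and> nzr N = carrier G"
proof
  show "N \<lhd> G \<Longrightarrow> subgroup N G \<and> nzr N = carrier G"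
    unfolding normal_iff_cj using nzrI nzr_def by auto
  show "subgroup N G \<and> nzr N = carrier G \<Longrightarrow> N \<lhd> G"
    unfolding normal_iff_cj using nzrD by auto
qed

lemma normalizer_eq: "subgroup H G \<Longrightarrow> normalizer G H = nzr H"
  unfolding normalizer_def stabilizer_def nzr_def
  by (auto simp: subgroup.subset l_coset_def r_coset_def cj_def)

lemma conj_class_eq: "subgroup_conj_class G H = (\<lambda>g. cj g ` H) ` carrier G"
proof -
  have "cj g ` H = (g <# H) #> inv g" for g
    by (auto simp: l_coset_def r_coset_def cj_def)
  then show ?thesis unfolding subgroup_conj_class_def by auto
qed

text \<open>Orbit counting for \<open>K\<close> acting on all subsets of the carrier, so that it
  serves Sylow subgroups and maximal subgroups alike.\<close>

lemma card_conjugates: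
  assumes H: "H \<subseteq> carrier G" and K: "subgroup K G"
  shows "card ((\<lambda>g. cj g ` H) ` K) * card (K \<inter> nzr H) = card K"
proof -
  interpret K: fin_group "G\<lparr>carrier := K\<rparr>" by (rule sub_group[OF K])
  have "acts (G\<lparr>carrier := K\<rparr>) {H. H \<subseteq> carrier G} (\<lambda>g H. cj g ` H)"
  proof (rule acts_cjs)
    show "cj g ` H \<in> {H. H \<subseteq> carrier G}" if "g \<in> K" "H \<in> {H. H \<subseteq> carrier G}" for g H
      using that subgroup.mem_carrier[OF K] by auto
  qed (use K subgroup.subset in auto)
  moreover have "H \<in> {H. H \<subseteq> carrier G}" using H by simp
  ultimately have "card ((\<lambda>g. cj g ` H) ` K) * card {g \<in> K. cj g ` H = H} = card K"
    using K.orbit_stabilizer_count[of "{H. H \<subseteq> carrier G}" "\<lambda>g H. cj g ` H" H] K.fin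
    by (simp add: order_def del: mem_Collect_eq)
  moreover have "{g \<in> K. cj g ` H = H} = K \<inter> nzr H"
    using subgroup.mem_carrier[OF K] unfolding nzr_def by blast
  ultimately show ?thesis by simp
qed

lemma order_dvd: "subgroup H G \<Longrightarrow> card H dvd order G"
  using lagrange[of H] by (metis dvd_triv_right)

lemma sub_dvd: "subgroup H G \<Longrightarrow> subgroup K G \<Longrightarrow> H \<subseteq> K \<Longrightarrow> card H dvd card K"
proof -
  assume a: "subgroup H G" "subgroup K G" "H \<subseteq> K"
  interpret K: fin_group "G\<lparr>carrier := K\<rparr>" by (rule sub_group[OF a(2)])
  have "subgroup H (G\<lparr>carrier := K\<rparr>)" using a subgroup_incl by blast
  then show ?thesis using K.order_dvd by (simp add: order_def)
qed

lemma card_pos: "subgroup H G \<Longrightarrow> card H > 0"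
  using subgroup.one_closed[of H G] sub_finite[of H] by (auto simp: card_gt_0_iff)

lemma card_eq_one: "subgroup H G \<Longrightarrow> card H = 1 \<longleftrightarrow> H = {\<one>}"
  using subgroup.one_closed[of H G] by (auto simp: card_1_singleton_iff)

lemma sub_eqI: "subgroup H G \<Longrightarrow> subgroup K G \<Longrightarrow> H \<subseteq> K \<Longrightarrow> card H = card K \<Longrightarrow> H = K"
  by (rule card_subset_eq[OF sub_finite])

end

lemma dvd_card_subset:
  fixes p :: nat
  assumes "p dvd card A" "p dvd card (A - B)" "B \<subseteq> A" "finite A"
  shows "p dvd card B"
proof -
  have "card (A - B) = card A - card B" "card B \<le> card A"
    using assms(3,4) by (simp_all add: card_Diff_subset finite_subset card_mono)
  then show ?thesis using assms(1,2) by (metis dvd_diffD1)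
qed

section \<open>Restriction to subgroups; p-subgroups acting on elements, subgroups and
  cosets\<close>

context fin_group begin

lemma sub_iff: "subgroup K G \<Longrightarrow> subgroup H (G\<lparr>carrier := K\<rparr>) \<longleftrightarrow> subgroup H G \<and> H \<subseteq> K"
  by (metis incl_subgroup subgroup_incl subgroup.subset partial_object.select_convs(1) partial_object.update_convs(1) partial_object.surjective subgroup_def)

lemma sub_cj: "subgroup K G \<Longrightarrow> g \<in> K \<Longrightarrow> fin_group.cj (G\<lparr>carrier := K\<rparr>) g x = cj g x"
  using fin_group.cj_def[OF sub_group, of K] by (simp add: cj_def)

text \<open>Results proved for a whole group are applied to \<open>K\<close> as a group of its own
  and read back in \<open>G\<close>; the normalizer merely gets cut down to
  \<open>K\<close>.\<close>

lemma sub_nzr: "subgroup K G \<Longrightarrow> fin_group.nzr (G\<lparr>carrier := K\<rparr>) H = K \<inter> nzr H"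
  using fin_group.nzr_def[OF sub_group, of K] sub_cj[of K] subgroup.subset[of K G]
  by (auto simp: nzr_def)

lemma sub_order: "order (G\<lparr>carrier := K\<rparr>) = card K"
  by (simp add: order_def)

lemma Int_subgroup: "subgroup H G \<Longrightarrow> subgroup K G \<Longrightarrow> subgroup (H \<inter> K) G"
  by (rule subgroups_Inter_pair)

lemma prime_dvd_moved_points:
  assumes Q: "subgroup Q G" "card Q = p ^ k" "prime p" and N: "N \<subseteq> carrier G"
    and cl: "\<And>g x. g \<in> Q \<Longrightarrow> x \<in> N \<Longrightarrow> cj g x \<in> N"
  shows "p dvd card (N - {x \<in> N. \<forall>g\<in>Q. cj g x = x})"
proof -
  interpret Q: fin_group "G\<lparr>carrier := Q\<rparr>" by (rule sub_group[OF Q(1)])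
  have "finite N" using N finite_subset fin by blast
  from Q.prime_dvd_card_moved[OF acts_cj[OF Q(1) cl N] this Q(3), of k] Q(2)
  show ?thesis by (simp add: order_def)
qed

lemma prime_dvd_moved_sets:
  assumes Q: "subgroup Q G" "card Q = p ^ k" "prime p" and N: "\<And>H. H \<in> E \<Longrightarrow> H \<subseteq> carrier G"
    and cl: "\<And>g H. g \<in> Q \<Longrightarrow> H \<in> E \<Longrightarrow> cj g ` H \<in> E"
  shows "p dvd card (E - {H \<in> E. Q \<subseteq> nzr H})"
proof -
  interpret Q: fin_group "G\<lparr>carrier := Q\<rparr>" by (rule sub_group[OF Q(1)])
  have "E \<subseteq> Pow (carrier G)" using N by blast
  then have "finite E" by (simp add: finite_subset)
  from Q.prime_dvd_card_moved[OF acts_cjs[OF subgroup.subset[OF Q(1)] Q(1) cl N] this Q(3), of k] Q(2)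
  have "p dvd card (E - {H \<in> E. \<forall>g\<in>Q. cj g ` H = H})" by (simp add: order_def)
  moreover have "(\<forall>g\<in>Q. cj g ` H = H) \<longleftrightarrow> Q \<subseteq> nzr H" for H
    using subgroup.mem_carrier[OF Q(1)] unfolding nzr_def by blast
  ultimately show ?thesis by simp
qed

text \<open>The inverse turns right translation into a left action.\<close>

lemma acts_rcosets:
  assumes H: "subgroup H G" and K: "subgroup K G"
  shows "acts (G\<lparr>carrier := K\<rparr>) (rcosets H) (\<lambda>g C. C #> inv g)"
  unfolding acts_def
proof (intro conjI ballI)
  have Kc: "\<And>g. g \<in> K \<Longrightarrow> g \<in> carrier G" using subgroup.mem_carrier[OF K] .
  have Cc: "\<And>C. C \<in> rcosets H \<Longrightarrow> C \<subseteq> carrier G" using subgroup.rcosets_carrier[OF H is_group] .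
  have Hc: "H \<subseteq> carrier G" using subgroup.subset[OF H] .
  show "C #> inv g \<in> rcosets H" if "g \<in> carrier (G\<lparr>carrier := K\<rparr>)" "C \<in> rcosets H" for g C
    using that Kc Hc unfolding RCOSETS_def by (auto simp: coset_mult_assoc)
  show "C #> inv \<one>\<^bsub>G\<lparr>carrier := K\<rparr>\<^esub> = C" if "C \<in> rcosets H" for C
    using that Cc by simp
  show "C #> inv (g \<otimes>\<^bsub>G\<lparr>carrier := K\<rparr>\<^esub> h) = (C #> inv h) #> inv g"
    if "g \<in> carrier (G\<lparr>carrier := K\<rparr>)" "h \<in> carrier (G\<lparr>carrier := K\<rparr>)" "C \<in> rcosets H" for g h C
    using that Cc Kc by (simp add: coset_mult_assoc inv_mult_group)
qed

lemma rcoset_fixed_iff: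
  assumes H: "subgroup H G" and x: "x \<in> carrier G" and g: "g \<in> carrier G"
  shows "(H #> x) #> inv g = H #> x \<longleftrightarrow> cj x g \<in> H"
proof -
  have Hc: "H \<subseteq> carrier G" using subgroup.subset[OF H] .
  have "(H #> x) #> inv g = H #> (x \<otimes> inv g)" using Hc x g by (simp add: coset_mult_assoc)
  also have "\<dots> = H #> x \<longleftrightarrow> H #> (x \<otimes> inv g \<otimes> inv x) = H"
    using Hc x g by (metis coset_mult_assoc coset_mult_inv1 coset_mult_inv2 inv_closed m_closed)
  also have "\<dots> \<longleftrightarrow> x \<otimes> inv g \<otimes> inv x \<in> H"
    using H x g by (meson coset_join1 coset_join2 inv_closed m_closed)
  also have "\<dots> \<longleftrightarrow> inv (cj x g) \<in> H" using x g by (simp add: cj_def inv_mult_group m_assoc)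
  also have "\<dots> \<longleftrightarrow> cj x g \<in> H"
    using x g by (metis H cj_closed inv_inv subgroup.m_inv_closed)
  finally show ?thesis .
qed

lemma card_nzr_rcosets:
  assumes H: "subgroup H G" and L: "subgroup L G" "H \<subseteq> L"
  shows "card ((\<lambda>x. H #> x) ` L) * card H = card L"
proof -
  interpret L: fin_group "G\<lparr>carrier := L\<rparr>" by (rule sub_group[OF L(1)])
  have "subgroup H (G\<lparr>carrier := L\<rparr>)" using sub_iff H L by simp
  from L.lagrange[OF this] have "card (rcosets\<^bsub>G\<lparr>carrier := L\<rparr>\<^esub> H) * card H = card L" by (simp add: order_def)
  moreover have "rcosets\<^bsub>G\<lparr>carrier := L\<rparr>\<^esub> H = (\<lambda>x. H #> x) ` L"
    unfolding RCOSETS_def by (auto simp: r_coset_def)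
  ultimately show ?thesis by simp
qed

lemma fixed_rcosets:
  assumes H: "subgroup H G" and Q: "subgroup Q G"
  shows "{C \<in> rcosets H. \<forall>g\<in>Q. C #> inv g = C} = (\<lambda>x. H #> x) ` {x \<in> carrier G. cj x ` Q \<subseteq> H}"
proof -
  have "rcosets H = (\<lambda>x. H #> x) ` carrier G" unfolding RCOSETS_def by auto
  moreover have "(\<forall>g\<in>Q. (H #> x) #> inv g = H #> x) \<longleftrightarrow> cj x ` Q \<subseteq> H" if "x \<in> carrier G" for x
    using rcoset_fixed_iff[OF H that] subgroup.mem_carrier[OF Q] by auto
  moreover have "{C \<in> f ` A. P C} = f ` {x \<in> A. P (f x)}" for f and A :: "'a set" and P :: "'a set \<Rightarrow> bool"
    by blast
  ultimately show ?thesis by (simp cong: conj_cong)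
qed

lemma prime_dvd_moved_rcosets:
  assumes H: "subgroup H G" and Q: "subgroup Q G" "card Q = p ^ k" "prime p"
  shows "p dvd card (rcosets H - (\<lambda>x. H #> x) ` {x \<in> carrier G. cj x ` Q \<subseteq> H})"
proof -
  interpret Q: fin_group "G\<lparr>carrier := Q\<rparr>" by (rule sub_group[OF Q(1)])
  have "finite (rcosets H)" by (simp add: RCOSETS_def)
  from Q.prime_dvd_card_moved[OF acts_rcosets[OF H Q(1)] this Q(3), of k] Q(2)
  have "p dvd card (rcosets H - {C \<in> rcosets H. \<forall>g\<in>Q. C #> inv g = C})" by (simp add: order_def)
  then show ?thesis using fixed_rcosets[OF H Q(1)] by simp
qed

text \<open>The number of cosets of \<open>H\<close> is prime to \<open>p\<close>, so
  \<open>Q\<close> fixes some coset \<open>H #> x\<close>; being fixed means that \<open>x\<close>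
  conjugates \<open>Q\<close> into \<open>H\<close>.\<close>

lemma p_subgroup_conj_into:
  assumes H: "subgroup H G" and Q: "subgroup Q G" "card Q = p ^ k" "prime p"
    and nd: "\<not> p dvd order G div card H"
  shows "\<exists>x\<in>carrier G. cj x ` Q \<subseteq> H"
proof (rule ccontr)
  assume "\<not> ?thesis"
  then have e: "{x \<in> carrier G. cj x ` Q \<subseteq> H} = {}" by blast
  have "p dvd card (rcosets H)" using prime_dvd_moved_rcosets[OF H Q] unfolding e by simp
  moreover have "order G div card H = card (rcosets H)"
    using lagrange[OF H] card_pos[OF H] by (metis div_mult_self_is_m)
  ultimately show False using nd by simp
qed

text \<open>\<open>H\<close> acts on its own cosets, and the fixed ones are those inside its
  normalizer. As \<open>p\<close> divides the number of all cosets, it divides the number of fixed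
  ones, the index of \<open>H\<close> in \<open>nzr H\<close>.\<close>

lemma dvd_card_nzr_aux:
  assumes H: "subgroup H G" "card H = p ^ k" "prime p" and d: "p ^ Suc k dvd order G"
  shows "p ^ Suc k dvd card (nzr H)"
proof -
  have pp: "p > 0" using H(3) prime_gt_0_nat by auto
  have eq: "{x \<in> carrier G. cj x ` H \<subseteq> H} = nzr H"
  proof (rule Collect_cong[where Q = "\<lambda>g. g \<in> nzr H", simplified])
    fix x show "(x \<in> carrier G \<and> cj x ` H \<subseteq> H) = (x \<in> nzr H)"
      using nzrI[OF H(1), of x] by (auto simp: nzr_def image_subset_iff)
  qed
  have "card (rcosets H) * p ^ k = order G" using lagrange[OF H(1)] H(2) by simp
  then have "p ^ k * p dvd p ^ k * card (rcosets H)" using d by (simp add: mult.commute)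
  then have "p dvd card (rcosets H)" using pp by simp
  moreover have "p dvd card (rcosets H - (\<lambda>x. H #> x) ` nzr H)"
    using prime_dvd_moved_rcosets[OF H(1) H] eq by simp
  moreover have "(\<lambda>x. H #> x) ` nzr H \<subseteq> rcosets H" unfolding RCOSETS_def nzr_def by auto
  moreover have "finite (rcosets H)" by (simp add: RCOSETS_def)
  ultimately have "p dvd card ((\<lambda>x. H #> x) ` nzr H)"
    using dvd_card_subset by blast
  then have "p * card H dvd card ((\<lambda>x. H #> x) ` nzr H) * card H" by (rule mult_dvd_mono[OF _ dvd_refl])
  then have "p * card H dvd card (nzr H)"
    using card_nzr_rcosets[OF H(1) nzr_subgroup[OF subgroup.subset[OF H(1)]] nzr_ge[OF H(1)]] by simp
  then show ?thesis using H(2) by simp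
qed

lemma dvd_card_nzr:
  assumes K: "subgroup K G" and H: "subgroup H G" "H \<subseteq> K" "card H = p ^ k" "prime p"
    and d: "p ^ Suc k dvd card K"
  shows "p ^ Suc k dvd card (K \<inter> nzr H)"
proof -
  interpret K: fin_group "G\<lparr>carrier := K\<rparr>" by (rule sub_group[OF K])
  show ?thesis
    using K.dvd_card_nzr_aux[of H p k] sub_iff[OF K] sub_nzr[OF K] H d by (simp add: order_def)
qed

lemma nzr_ne_of_dvd:
  assumes H: "subgroup H G" "card H = p ^ k" "prime p" and d: "p ^ Suc k dvd order G"
  shows "nzr H \<noteq> H"
proof
  assume "nzr H = H"
  then have "p ^ Suc k dvd p ^ k" using dvd_card_nzr_aux[OF H d] H by simp
  then show False using H(3) by (metis Suc_n_not_le_n power_dvd_imp_le prime_gt_1_nat)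
qed

lemma subgroup_of_prime_power_exists:
  assumes K: "subgroup K G" and p: "prime p" and d: "p ^ i dvd card K"
  shows "\<exists>H. subgroup H G \<and> H \<subseteq> K \<and> card H = p ^ i"
proof -
  interpret K: fin_group "G\<lparr>carrier := K\<rparr>" by (rule sub_group[OF K])
  obtain m where "card K = p ^ i * m" using d by auto
  then have "order (G\<lparr>carrier := K\<rparr>) = p ^ i * m" by (simp add: order_def)
  then have "\<exists>H. subgroup H (G\<lparr>carrier := K\<rparr>) \<and> card H = p ^ i"
    by (rule sylow_thm[OF p K.is_group _ K.fin])
  then show ?thesis using sub_iff[OF K] by blast
qed

section \<open>Sylow subgroups\<close>

text \<open>\<open>K\<close> and \<open>P\<close> are both subsets of the fixed group
  \<open>G\<close>, so the same \<open>P\<close> can be viewed in several subgroups \<open>K\<close>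
  without changing the ambient group.\<close>

definition sylow_in :: "nat \<Rightarrow> 'a set \<Rightarrow> 'a set \<Rightarrow> bool" where
  "sylow_in p K P \<longleftrightarrow> subgroup P G \<and> P \<subseteq> K \<and> card P = p ^ multiplicity p (card K)"

lemma sylow_in_exists: "subgroup K G \<Longrightarrow> prime p \<Longrightarrow> \<exists>P. sylow_in p K P"
  using subgroup_of_prime_power_exists[of K p] multiplicity_dvd unfolding sylow_in_def by blast

lemma sylow_in_mono: "sylow_in p K P \<Longrightarrow> subgroup K G \<Longrightarrow> subgroup L G \<Longrightarrow> L \<subseteq> K \<Longrightarrow> P \<subseteq> L \<Longrightarrow> prime p \<Longrightarrow> sylow_in p L P"
proof -
  assume a: "sylow_in p K P" "subgroup K G" "subgroup L G" "L \<subseteq> K" "P \<subseteq> L" "prime p"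
  have d: "card P dvd card L" "card L dvd card K" using a sub_dvd unfolding sylow_in_def by blast+
  have nz: "card K \<noteq> 0" "card L \<noteq> 0" using card_pos a by fastforce+
  have "multiplicity p (card L) \<le> multiplicity p (card K)"
    using d nz by (simp add: dvd_imp_multiplicity_le)
  moreover have "multiplicity p (card K) \<le> multiplicity p (card L)"
    using d(1) a(1,6) nz unfolding sylow_in_def
    by (metis multiplicity_geI not_prime_unit prime_imp_prime_elem)
  ultimately show ?thesis using a unfolding sylow_in_def by simp
qed

lemma sylow_in_cjs:
  assumes "sylow_in p K P" "subgroup K G" "g \<in> K" shows "sylow_in p K (cj g ` P)"
proof -
  have g: "g \<in> carrier G" using assms subgroup.mem_carrier by metis
  have P: "subgroup P G" "P \<subseteq> K" using assms unfolding sylow_in_def by auto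
  have "cj g ` P \<subseteq> cj g ` K" using P by auto
  then have "cj g ` P \<subseteq> K" using cjs_self[OF assms(2,3)] by simp
  then show ?thesis
    using assms(1) cjs_subgroup[OF g P(1)] cjs_card[OF g subgroup.subset[OF P(1)]]
    unfolding sylow_in_def by simp
qed

lemma sylow_in_conj_into:
  assumes K: "subgroup K G" and P: "sylow_in p K P" and p: "prime p"
    and Q: "subgroup Q G" "Q \<subseteq> K" "card Q = p ^ k"
  shows "\<exists>x\<in>K. cj x ` Q \<subseteq> P"
proof -
  interpret K: fin_group "G\<lparr>carrier := K\<rparr>" by (rule sub_group[OF K])
  have P': "subgroup P (G\<lparr>carrier := K\<rparr>)" "subgroup Q (G\<lparr>carrier := K\<rparr>)"
    using P Q sub_iff[OF K] unfolding sylow_in_def by auto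
  have "card K \<noteq> 0" using card_pos[OF K] by simp
  then have "\<not> p dvd card K div card P"
    using P p unfolding sylow_in_def
    by (metis multiplicity_decompose not_prime_unit)
  then have "\<exists>x\<in>K. K.cj x ` Q \<subseteq> P"
    using K.p_subgroup_conj_into[OF P' Q(3) p] by (simp add: order_def)
  then show ?thesis using sub_cj[OF K] by auto
qed

lemma sylow_in_conj:
  assumes K: "subgroup K G" and P: "sylow_in p K P" and Q: "sylow_in p K Q" and p: "prime p"
  shows "\<exists>x\<in>K. cj x ` Q = P"
proof -
  have Q': "subgroup Q G" "Q \<subseteq> K" "card Q = p ^ multiplicity p (card K)"
    using Q unfolding sylow_in_def by auto
  obtain x where x: "x \<in> K" "cj x ` Q \<subseteq> P" using sylow_in_conj_into[OF K P p Q'] by blast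
  have "card (cj x ` Q) = card P"
    using cjs_card Q' x P K subgroup.subset subgroup.mem_carrier unfolding sylow_in_def by metis
  then have "cj x ` Q = P" using x P sub_finite unfolding sylow_in_def by (meson card_subset_eq)
  then show ?thesis using x by blast
qed

text \<open>Inside \<open>K \<inter> nzr Q\<close> both are Sylow subgroups, hence conjugate there,
  and conjugation by elements of \<open>nzr Q\<close> does not move \<open>Q\<close>.\<close>

lemma sylow_in_nzr_unique:
  assumes K: "subgroup K G" and P: "sylow_in p K P" and Q: "sylow_in p K Q" and p: "prime p"
    and n: "P \<subseteq> nzr Q"
  shows "P = Q"
proof -
  have sQ: "subgroup Q G" and sP: "subgroup P G" using P Q unfolding sylow_in_def by auto
  have sN: "subgroup (nzr Q) G" using nzr_subgroup subgroup.subset[OF sQ] .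
  have L: "subgroup (K \<inter> nzr Q) G" using Int_subgroup K sN by blast
  have "sylow_in p (K \<inter> nzr Q) P" "sylow_in p (K \<inter> nzr Q) Q"
    using sylow_in_mono[OF P K L] sylow_in_mono[OF Q K L] n nzr_ge[OF sQ] p P Q
    unfolding sylow_in_def by auto
  from sylow_in_conj[OF L this(1) this(2) p] obtain x where "x \<in> nzr Q" "cj x ` Q = P" by blast
  then show ?thesis unfolding nzr_def by auto
qed

text \<open>\<open>P\<close> permutes its conjugates and, by the uniqueness just shown, fixes only
  itself.\<close>

lemma sylow_count_mod:
  assumes K: "subgroup K G" and P: "sylow_in p K P" and p: "prime p"
  shows "p dvd card ((\<lambda>g. cj g ` P) ` K) - 1"
proof -
  let ?E = "(\<lambda>g. cj g ` P) ` K"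
  have sP: "subgroup P G" "P \<subseteq> K" "card P = p ^ multiplicity p (card K)" using P unfolding sylow_in_def by auto
  have Kc: "\<And>g. g \<in> K \<Longrightarrow> g \<in> carrier G" using subgroup.mem_carrier[OF K] .
  have Esyl: "sylow_in p K H" if "H \<in> ?E" for H using that sylow_in_cjs[OF P K] by auto
  have "p dvd card (?E - {H \<in> ?E. P \<subseteq> nzr H})"
  proof (rule prime_dvd_moved_sets[OF sP(1,3) p])
    show "\<And>H. H \<in> ?E \<Longrightarrow> H \<subseteq> carrier G" using Esyl subgroup.subset unfolding sylow_in_def by blast
    fix g H assume gH: "g \<in> P" "H \<in> ?E"
    then obtain h where h: "h \<in> K" "H = cj h ` P" by auto
    have "cj g ` H = cj (g \<otimes> h) ` P"
      using h gH sP Kc cjs_comp[of g h P] subgroup.subset[OF sP(1)] by auto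
    moreover have "g \<otimes> h \<in> K" using h gH sP(2) subgroup.m_closed[OF K] by auto
    ultimately show "cj g ` H \<in> ?E" by auto
  qed
  moreover have "{H \<in> ?E. P \<subseteq> nzr H} = {P}"
  proof -
    have "P \<in> ?E" 
    using cjs_one[OF subgroup.subset[OF sP(1)]] subgroup.one_closed[OF K] by (metis imageI)
    moreover have "P \<subseteq> nzr P" using nzr_ge sP(1) by blast
    moreover have "H = P" if "H \<in> ?E" "P \<subseteq> nzr H" for H
      using sylow_in_nzr_unique[OF K P Esyl[OF that(1)] p that(2)] by simp
    ultimately show ?thesis by auto
  qed
  moreover have "P \<in> ?E" 
    using cjs_one[OF subgroup.subset[OF sP(1)]] subgroup.one_closed[OF K] by (metis imageI)
  ultimately show ?thesis by (simp add: card_Diff_singleton)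
qed

text \<open>\<open>P\<close> and its conjugate by \<open>g\<close> are both Sylow in
  \<open>N\<close>, so an element of \<open>N\<close> brings the conjugate back to
  \<open>P\<close>.\<close>

lemma frattini:
  assumes N: "N \<lhd> G" and P: "sylow_in p N P" and p: "prime p" and g: "g \<in> carrier G"
  shows "\<exists>n\<in>N. n \<otimes> g \<in> nzr P"
proof -
  have sN: "subgroup N G" and cl: "\<And>h x. h \<in> carrier G \<Longrightarrow> x \<in> N \<Longrightarrow> cj h x \<in> N"
    using N unfolding normal_iff_cj by auto
  have sP: "subgroup P G" "P \<subseteq> N" using P unfolding sylow_in_def by auto
  have "sylow_in p N (cj g ` P)"
    using P cl[OF g] cjs_subgroup[OF g sP(1)] cjs_card[OF g subgroup.subset[OF sP(1)]] sP(2)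
    unfolding sylow_in_def by auto
  from sylow_in_conj[OF sN P this p] obtain n where n: "n \<in> N" "cj n ` (cj g ` P) = P" by blast
  then have "n \<otimes> g \<in> nzr P"
    using cjs_comp[of n g P] g subgroup.mem_carrier[OF sN] subgroup.subset[OF sP(1)] unfolding nzr_def by auto
  then show ?thesis using n by blast
qed

text \<open>The identity is fixed; were it the only fixed point, \<open>p\<close> would divide both
  \<open>card N\<close> and \<open>card N - 1\<close>.\<close>

lemma p_group_fixes_nontrivial:
  assumes Q: "subgroup Q G" "card Q = p ^ k" "prime p" and N: "subgroup N G" "p dvd card N"
    and nz: "Q \<subseteq> nzr N"
  shows "\<exists>x\<in>N. x \<noteq> \<one> \<and> (\<forall>g\<in>Q. cj g x = x)"
proof (rule ccontr)
  assume c: "\<not> ?thesis"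
  have Nc: "N \<subseteq> carrier G" using N subgroup.subset by blast
  have Qc: "\<And>g. g \<in> Q \<Longrightarrow> g \<in> carrier G" using Q subgroup.mem_carrier by metis
  have "{x \<in> N. \<forall>g\<in>Q. cj g x = x} = {\<one>}" using c subgroup.one_closed[OF N(1)] Qc by auto
  moreover have "p dvd card (N - {x \<in> N. \<forall>g\<in>Q. cj g x = x})"
    by (rule prime_dvd_moved_points[OF Q Nc]) (use nz nzrD in blast)
  ultimately have "p dvd card N - 1"
    using subgroup.one_closed[OF N(1)] by (simp add: card_Diff_singleton)
  then have "p dvd 1" using N(2) card_pos[OF N(1)] by (metis One_nat_def Suc_leI dvd_diffD1)
  then show False using Q(3) by simp
qed

lemma card_fact_union:
  assumes N: "N \<lhd> G" and Y: "subgroup Y (G Mod N)"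
  shows "subgroup (\<Union>Y) G" "card (\<Union>Y) = card Y * card N" "N \<subseteq> \<Union>Y"
proof -
  interpret N: normal N G by (rule N)
  show "subgroup (\<Union>Y) G" using N.factgroup_subgroup_union_subgroup[OF Y] .
  have Yr: "Y \<subseteq> rcosets N" using subgroup.subset[OF Y] by (simp add: FactGroup_def)
  have "card N * card Y = card (\<Union>Y)"
  proof (rule card_partition)
    show "finite Y" using Yr finite_subset[of Y "rcosets N"] by (simp add: RCOSETS_def)
    show "finite (\<Union>Y)" using \<open>subgroup (\<Union>Y) G\<close> sub_finite by blast
    show "card c = card N" if c: "c \<in> Y" for c
    proof -
      have "c \<in> rcosets N" using Yr c by (rule subsetD)
      then show ?thesis using card_rcosets_equal[OF _ N.subset] by simp
    qed
    show "c1 \<inter> c2 = {}" if c: "c1 \<in> Y" "c2 \<in> Y" "c1 \<noteq> c2" for c1 c2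
      using rcos_disjoint[OF N.is_subgroup] subsetD[OF Yr c(1)] subsetD[OF Yr c(2)] c(3)
      by (simp add: pairwise_def disjnt_def)
  qed
  then show "card (\<Union>Y) = card Y * card N" by (simp add: mult.commute)
  show "N \<subseteq> \<Union>Y" using subgroup.one_closed[OF Y] by (auto simp: FactGroup_def)
qed

lemma fact_fin_group: "N \<lhd> G \<Longrightarrow> fin_group (G Mod N)"
proof -
  assume N: "N \<lhd> G"
  have "finite (carrier (G Mod N))" by (simp add: FactGroup_def RCOSETS_def)
  then show ?thesis
    using normal.factorgroup_is_group[OF N] by (simp add: fin_group_def fin_group_axioms_def)
qed

lemma fact_order: "N \<lhd> G \<Longrightarrow> order (G Mod N) * card N = order G"
  using lagrange[of N] normal_imp_subgroup by (auto simp: order_def FactGroup_def)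

lemma subgroup_over_normal:
  assumes N: "N \<lhd> G" and p: "prime p" and d: "p ^ i * card N dvd order G"
  shows "\<exists>L. subgroup L G \<and> N \<subseteq> L \<and> card L = p ^ i * card N"
proof -
  interpret Q: fin_group "G Mod N" by (rule fact_fin_group[OF N])
  have "card N > 0" using N card_pos normal_imp_subgroup by blast
  then have "p ^ i dvd card (carrier (G Mod N))"
    using d fact_order[OF N] by (auto simp: order_def)
  then obtain Y where Y: "subgroup Y (G Mod N)" "card Y = p ^ i"
    using Q.subgroup_of_prime_power_exists[OF Q.subgroup_self p] by blast
  then show ?thesis using card_fact_union[OF N Y(1)] by metis
qed

lemma normal_in_nzr:
  assumes H: "subgroup H G" and K: "subgroup K G" "H \<subseteq> K" "K \<subseteq> nzr H"
  shows "H \<lhd> G\<lparr>carrier := K\<rparr>"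
proof -
  interpret K: fin_group "G\<lparr>carrier := K\<rparr>" by (rule sub_group[OF K(1)])
  show ?thesis using K.normal_iff_cj sub_iff[OF K(1)] sub_cj[OF K(1)] H K nzrD by auto
qed

text \<open>\<open>p\<close> divides the index of \<open>H\<close> in its normalizer within
  \<open>K\<close>, so the quotient has a subgroup of order \<open>p\<close>; its preimage is
  \<open>L\<close>.\<close>

lemma p_subgroup_extend:
  assumes K: "subgroup K G" and H: "subgroup H G" "H \<subseteq> K" "card H = p ^ k" "prime p"
    and d: "p ^ Suc k dvd card K"
  shows "\<exists>L. subgroup L G \<and> H \<subseteq> L \<and> L \<subseteq> K \<inter> nzr H \<and> card L = p ^ Suc k"
proof -
  let ?M = "K \<inter> nzr H"
  have M: "subgroup ?M G" using Int_subgroup[OF K nzr_subgroup[OF subgroup.subset[OF H(1)]]] .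
  interpret M: fin_group "G\<lparr>carrier := ?M\<rparr>" by (rule sub_group[OF M])
  have "H \<lhd> G\<lparr>carrier := ?M\<rparr>" using normal_in_nzr[OF H(1) M] nzr_ge[OF H(1)] H by blast
  moreover have "p ^ 1 * card H dvd order (G\<lparr>carrier := ?M\<rparr>)"
    using dvd_card_nzr[OF K H d] H(3) by (simp add: sub_order)
  ultimately obtain L where "subgroup L (G\<lparr>carrier := ?M\<rparr>)" "H \<subseteq> L" "card L = p ^ 1 * card H"
    using M.subgroup_over_normal[of H p 1] H(4) by blast
  then show ?thesis using sub_iff[OF M] H(3) by auto
qed

lemma card_prime_power_sub:
  assumes "subgroup P G" "card P = p ^ n" "prime p" "subgroup H G" "H \<subseteq> P"
  obtains k where "k \<le> n" "card H = p ^ k"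
  using sub_dvd[OF assms(4,1,5)] assms(2,3) divides_primepow_nat by metis

lemma p_maximal_over:
  assumes P: "subgroup P G" "card P = p ^ Suc n" "prime p" and H: "subgroup H G" "H \<subseteq> P" "H \<noteq> P"
  shows "\<exists>U. subgroup U G \<and> H \<subseteq> U \<and> U \<subseteq> P \<and> card U = p ^ n"
proof -
  have p1: "p > 1" using P(3) prime_gt_1_nat by blast
  have "\<exists>U. subgroup U G \<and> H \<subseteq> U \<and> U \<subseteq> P \<and> card U = p ^ n"
    if "k \<le> n" "subgroup H G" "H \<subseteq> P" "card H = p ^ k" for k H
    using that
  proof (induction "n - k" arbitrary: k H)
    case 0
    then have "k = n" by simp
    then show ?case using 0 by blast
  next
    case (Suc m)
    have "p ^ Suc k dvd card P" 
      using P(2) Suc.prems Suc.hyps(2) by (simp add: le_imp_power_dvd del: power_Suc)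
    from p_subgroup_extend[OF P(1) Suc.prems(2,3,4) P(3) this]
    obtain L where L: "subgroup L G" "H \<subseteq> L" "L \<subseteq> P" "card L = p ^ Suc k" by blast
    have "m = n - Suc k" "Suc k \<le> n" using Suc.hyps by auto
    from Suc.hyps(1)[OF this L(1,3,4)] show ?case using L(2) by blast
  qed
  moreover obtain k where "k \<le> Suc n" "card H = p ^ k" using card_prime_power_sub[OF P H(1,2)] .
  moreover have "k \<noteq> Suc n" using sub_eqI[OF H(1) P(1) H(2)] H(3) P(2) calculation by auto
  ultimately show ?thesis using H by (metis le_SucE)
qed

lemma p_index_p_normalized:
  assumes P: "subgroup P G" "card P = p ^ Suc n" "prime p" and U: "subgroup U G" "U \<subseteq> P" "card U = p ^ n"
  shows "P \<subseteq> nzr U"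
proof -
  have s: "subgroup (P \<inter> nzr U) G" using Int_subgroup[OF P(1) nzr_subgroup[OF subgroup.subset[OF U(1)]]] .
  have "card P dvd card (P \<inter> nzr U)" using dvd_card_nzr[OF P(1) U(1,2,3) P(3)] P(2) by simp
  then have "card P \<le> card (P \<inter> nzr U)" using card_pos[OF s] dvd_imp_le by blast
  then have "P \<inter> nzr U = P" using sub_finite[OF P(1)] by (intro card_seteq) auto
  then show ?thesis by blast
qed

section \<open>Centralizers and maximal subgroups of p-groups\<close>

text \<open>A generator is encoded as an element that lies in no subgroup except those containing \<open>P\<close>.\<close>

definition cyc :: "'a set \<Rightarrow> bool" where
  "cyc P \<longleftrightarrow> (\<exists>x\<in>P. \<forall>H. subgroup H G \<longrightarrow> x \<in> H \<longrightarrow> P \<subseteq> H)"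

definition cent :: "'a set \<Rightarrow> 'a set" where
  "cent S = {g \<in> carrier G. \<forall>x\<in>S. g \<otimes> x = x \<otimes> g}"

lemma cent_subgroup: "S \<subseteq> carrier G \<Longrightarrow> subgroup (cent S) G"
proof (rule subgroupI)
  assume S: "S \<subseteq> carrier G"
  show "cent S \<subseteq> carrier G" unfolding cent_def by auto
  have "\<one> \<in> cent S" unfolding cent_def using S by auto
  then show "cent S \<noteq> {}" by blast
  fix a assume a: "a \<in> cent S"
  then have ac: "a \<in> carrier G" unfolding cent_def by auto
  have "inv a \<otimes> x = x \<otimes> inv a" if "x \<in> S" for x
  proof -
    have "a \<otimes> x = x \<otimes> a" "x \<in> carrier G" using a that S unfolding cent_def by auto
    then show ?thesis using ac by (metis inv_closed inv_solve_left inv_solve_right m_assoc m_closed)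
  qed
  then show "inv a \<in> cent S" unfolding cent_def using ac by auto
  fix b assume b: "b \<in> cent S"
  have "a \<otimes> b \<otimes> x = x \<otimes> (a \<otimes> b)" if "x \<in> S" for x
  proof -
    have "a \<otimes> x = x \<otimes> a" "b \<otimes> x = x \<otimes> b" "x \<in> carrier G" "b \<in> carrier G"
      using a b that S unfolding cent_def by auto
    then show ?thesis using ac by (metis m_assoc)
  qed
  moreover have "a \<otimes> b \<in> carrier G" using a b unfolding cent_def by auto
  ultimately show "a \<otimes> b \<in> cent S" unfolding cent_def by auto
qed

lemma cent_sym: "A \<subseteq> cent B \<Longrightarrow> B \<subseteq> carrier G \<Longrightarrow> B \<subseteq> cent A"
  unfolding cent_def by (auto simp: subset_iff)

lemma cent_mono: "A \<subseteq> B \<Longrightarrow> cent B \<subseteq> cent A"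
  unfolding cent_def by auto

lemma centD: "g \<in> cent S \<Longrightarrow> x \<in> S \<Longrightarrow> g \<otimes> x = x \<otimes> g"
  unfolding cent_def by auto

lemma cent_iff_cj: "S \<subseteq> carrier G \<Longrightarrow> g \<in> cent S \<longleftrightarrow> g \<in> carrier G \<and> (\<forall>x\<in>S. cj g x = x)"
  unfolding cent_def using cj_eq_iff by auto

lemma cent_le_nzr: "subgroup H G \<Longrightarrow> cent H \<subseteq> nzr H"
  using nzrI cent_iff_cj subgroup.subset by (metis subsetI)

lemma cent_image:
  assumes g: "g \<in> carrier G" and S: "S \<subseteq> carrier G" and x: "x \<in> cent S"
  shows "cj g x \<in> cent (cj g ` S)"
proof -
  have xc: "x \<in> carrier G" using x unfolding cent_def by auto
  have "cj g x \<otimes> cj g s = cj g s \<otimes> cj g x" if "s \<in> S" for s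
  proof -
    have "x \<otimes> s = s \<otimes> x" "s \<in> carrier G" using x S that unfolding cent_def by auto
    then show ?thesis using cj_mult g xc by metis
  qed
  then show ?thesis unfolding cent_def using g xc by auto
qed

text \<open>A generator lies in its own centralizer, which therefore contains \<open>P\<close>. So
  the generator is central, and \<open>cent P\<close>, which contains it, contains \<open>P\<close>
  as well.\<close>

lemma cyc_abelian: "subgroup P G \<Longrightarrow> cyc P \<Longrightarrow> P \<subseteq> cent P"
proof -
  assume P: "subgroup P G" and c: "cyc P"
  obtain x where x: "x \<in> P" "\<And>H. subgroup H G \<Longrightarrow> x \<in> H \<Longrightarrow> P \<subseteq> H" using c unfolding cyc_def by blast
  have Pc: "P \<subseteq> carrier G" using subgroup.subset[OF P] .
  have "x \<in> cent {x}" using x Pc unfolding cent_def by auto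
  then have "P \<subseteq> cent {x}" using x(2)[OF cent_subgroup, of "{x}"] x(1) Pc by auto
  then have "{x} \<subseteq> cent P" using cent_sym[of P "{x}"] x Pc by auto
  then show ?thesis using x(2)[OF cent_subgroup[OF Pc]] by blast
qed

text \<open>For a \<open>p\<close>-group these are the maximal subgroups. The product form of the
  index condition mentions no exponent and is visibly invariant under conjugation.\<close>

definition maxes :: "nat \<Rightarrow> 'a set \<Rightarrow> 'a set set" where
  "maxes p P = {U. subgroup U G \<and> U \<subseteq> P \<and> p * card U = card P}"

lemma maxes_iff: "prime p \<Longrightarrow> card P = p ^ Suc n \<Longrightarrow> U \<in> maxes p P \<longleftrightarrow> subgroup U G \<and> U \<subseteq> P \<and> card U = p ^ n"
  unfolding maxes_def using prime_gt_0_nat by auto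

lemma finite_maxes: "subgroup P G \<Longrightarrow> finite (maxes p P)"
  unfolding maxes_def by (rule finite_subset[of _ "Pow P"]) (auto simp: sub_finite)

lemma element_in_maximal:
  assumes P: "subgroup P G" "card P = p ^ Suc n" "prime p" and nc: "\<not> cyc P" and x: "x \<in> P"
  shows "\<exists>U\<in>maxes p P. x \<in> U"
proof -
  obtain H where H: "subgroup H G" "x \<in> H" "\<not> P \<subseteq> H" using nc x unfolding cyc_def by blast
  have "subgroup (P \<inter> H) G" "P \<inter> H \<subseteq> P" "P \<inter> H \<noteq> P" using Int_subgroup P(1) H by auto
  from p_maximal_over[OF P this] show ?thesis using x H(2) maxes_iff[OF P(3,2)] by blast
qed

text \<open>Without a generator every element lies in some member. All members share the identity,
  so \<open>p\<close> of them cover at most \<open>p (p^n - 1)\<close> of the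
  \<open>p^(n+1) - 1\<close> other elements.\<close>

lemma card_maxes_gt:
  assumes P: "subgroup P G" "card P = p ^ Suc n" "prime p" and nc: "\<not> cyc P"
  shows "card (maxes p P) > p"
proof (rule ccontr)
  assume c: "\<not> card (maxes p P) > p"
  have p1: "p > 1" using P(3) prime_gt_1_nat by blast
  have "P - {\<one>} \<subseteq> (\<Union>U\<in>maxes p P. U - {\<one>})"
    using element_in_maximal[OF P nc] by blast
  moreover have fU: "finite (\<Union>U\<in>maxes p P. U - {\<one>})"
    using finite_maxes[OF P(1)] sub_finite unfolding maxes_def by auto
  ultimately have "card (P - {\<one>}) \<le> card (\<Union>U\<in>maxes p P. U - {\<one>})" by (intro card_mono) 
  also have "\<dots> \<le> (\<Sum>U\<in>maxes p P. card (U - {\<one>}))" by (rule card_UN_le[OF finite_maxes[OF P(1)]])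
  also have "\<dots> = (\<Sum>U\<in>maxes p P. p ^ n - 1)"
    by (rule sum.cong) (auto simp: maxes_iff[OF P(3,2)] subgroup.one_closed card_Diff_singleton)
  also have "\<dots> \<le> p * (p ^ n - 1)" using c by simp
  finally have "p ^ Suc n - 1 \<le> p * (p ^ n - 1)"
    using P subgroup.one_closed[OF P(1)] by (simp add: card_Diff_singleton)
  also have "\<dots> = p ^ Suc n - p" by (simp add: algebra_simps diff_mult_distrib2)
  finally have "p ^ Suc n - 1 \<le> p ^ Suc n - p" .
  moreover have "p \<le> p ^ Suc n" using p1 by simp
  ultimately show False using p1 by linarith
qed

section \<open>Commutators relative to a normalized subgroup\<close>

definition comm :: "'a \<Rightarrow> 'a \<Rightarrow> 'a" where "comm x y = x \<otimes> y \<otimes> inv x \<otimes> inv y"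

lemma comm_closed [simp]: "x \<in> carrier G \<Longrightarrow> y \<in> carrier G \<Longrightarrow> comm x y \<in> carrier G"
  by (simp add: comm_def)

lemma comm_one_iff: "x \<in> carrier G \<Longrightarrow> y \<in> carrier G \<Longrightarrow> comm x y = \<one> \<longleftrightarrow> x \<otimes> y = y \<otimes> x"
proof -
  assume a: "x \<in> carrier G" "y \<in> carrier G"
  have "comm x y = x \<otimes> y \<otimes> inv (y \<otimes> x)" using a by (simp add: comm_def inv_mult_group m_assoc)
  then show ?thesis using a by (metis inv_closed inv_inv m_closed inv_equality l_inv r_inv inv_unique')
qed

lemma comm_swap: "x \<in> carrier G \<Longrightarrow> y \<in> carrier G \<Longrightarrow> comm y x = inv (comm x y)"
  by (simp add: comm_def inv_mult_group m_assoc)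

lemma inv_cancel_left [simp]: "a \<in> carrier G \<Longrightarrow> b \<in> carrier G \<Longrightarrow> inv a \<otimes> (a \<otimes> b) = b"
    "a \<in> carrier G \<Longrightarrow> b \<in> carrier G \<Longrightarrow> a \<otimes> (inv a \<otimes> b) = b"
  by (simp_all add: m_assoc[symmetric])

lemma comm_mult_right: "x \<in> carrier G \<Longrightarrow> y \<in> carrier G \<Longrightarrow> z \<in> carrier G \<Longrightarrow>
    comm x (y \<otimes> z) = comm x y \<otimes> cj y (comm x z)"
  by (simp add: comm_def cj_def inv_mult_group m_assoc)

lemma comm_inv_right: "x \<in> carrier G \<Longrightarrow> y \<in> carrier G \<Longrightarrow>
    comm x (inv y) = cj (inv y) (inv (comm x y))"
  by (simp add: comm_def cj_def inv_mult_group m_assoc)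

lemma comm_set_subgroup:
  assumes P: "subgroup P G" and K: "subgroup K G" "P \<subseteq> nzr K" and y: "y \<in> P"
  shows "subgroup {h \<in> P. comm y h \<in> K} G"
proof (rule subgroupI)
  have Pc: "\<And>g. g \<in> P \<Longrightarrow> g \<in> carrier G" using subgroup.mem_carrier[OF P] .
  have n: "cj h k \<in> K" if "h \<in> P" "k \<in> K" for h k using nzrD K(2) that by blast
  show "{h \<in> P. comm y h \<in> K} \<subseteq> carrier G" using Pc by auto
  have "comm y \<one> = \<one>" using y Pc by (simp add: comm_def)
  then have "\<one> \<in> {h \<in> P. comm y h \<in> K}" using subgroup.one_closed[OF P] subgroup.one_closed[OF K(1)] by simp
  then show "{h \<in> P. comm y h \<in> K} \<noteq> {}" by blast
  fix a assume a: "a \<in> {h \<in> P. comm y h \<in> K}"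
  then show "inv a \<in> {h \<in> P. comm y h \<in> K}"
    using y Pc P K n by (auto simp: comm_inv_right subgroup.m_inv_closed)
  fix b assume "b \<in> {h \<in> P. comm y h \<in> K}"
  then show "a \<otimes> b \<in> {h \<in> P. comm y h \<in> K}"
    using a y Pc P K n by (auto simp: comm_mult_right subgroup.m_closed)
qed

text \<open>The elements that commute with \<open>y\<close> modulo \<open>K\<close> form a subgroup
  containing \<open>A\<close> and \<open>y\<close>; if \<open>y\<close> is outside \<open>A\<close>,
  prime index leaves only \<open>P\<close>. This is the relative form of the fact that a cyclic
  quotient by a central subgroup forces commutativity.\<close>

lemma commutators_from_prime_index:
  assumes P: "subgroup P G" and K: "subgroup K G" "P \<subseteq> nzr K"
    and A: "subgroup A G" "A \<subseteq> P" "card P = q * card A" "prime q"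
    and cA: "\<And>a h. a \<in> A \<Longrightarrow> h \<in> P \<Longrightarrow> comm a h \<in> K"
    and y: "y \<in> P" and h: "h \<in> P"
  shows "comm y h \<in> K"
proof (cases "y \<in> A")
  case True then show ?thesis using cA h by blast
next
  case False
  let ?C = "{h \<in> P. comm y h \<in> K}"
  have Pc: "\<And>g. g \<in> P \<Longrightarrow> g \<in> carrier G" using subgroup.mem_carrier[OF P] .
  have C: "subgroup ?C G" using comm_set_subgroup[OF P K y] .
  have AC: "A \<subseteq> ?C"
  proof
    fix a assume a: "a \<in> A"
    then have "comm y a = inv (comm a y)" using A(2) y Pc by (auto intro: comm_swap)
    then show "a \<in> ?C" using cA[OF a y] a A(2) K(1) by (auto simp: subgroup.m_inv_closed)
  qed
  have "comm y y = \<one>" using y Pc comm_one_iff by blast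
  then have yC: "y \<in> ?C" using y subgroup.one_closed[OF K(1)] by simp
  obtain m where m: "card ?C = card A * m" using sub_dvd[OF A(1) C AC] by auto
  have "card ?C dvd card P" using sub_dvd[OF C P] by blast
  then have "m dvd q" using m A(3) card_pos[OF A(1)] by (simp add: mult.commute)
  moreover have "m \<noteq> 1" using sub_eqI[OF A(1) C AC] m yC False by auto
  ultimately have "m = q" using A(4) prime_nat_iff by blast
  then have "?C = P" using sub_eqI[OF C P] m A(3) by (simp add: mult.commute)
  then show ?thesis using h by blast
qed

lemma abelian_from_prime_index:
  assumes P: "subgroup P G"
    and A: "subgroup A G" "A \<subseteq> P" "card P = q * card A" "prime q" and cA: "A \<subseteq> cent P"
  shows "P \<subseteq> cent P"
proof
  fix y assume y: "y \<in> P"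
  have Pc: "\<And>g. g \<in> P \<Longrightarrow> g \<in> carrier G" using subgroup.mem_carrier[OF P] .
  have n: "P \<subseteq> nzr {\<one>}" using Pc unfolding nzr_def by auto
  have "comm y h \<in> {\<one>}" if "h \<in> P" for h
    by (rule commutators_from_prime_index[OF P triv_subgroup n A _ y that])
       (use cA comm_one_iff Pc A(2) centD in blast)
  then show "y \<in> cent P" unfolding cent_def using comm_one_iff y Pc by auto
qed

text \<open>Reduces inclusions of derived subgroups to single commutators, the form in which most
  later arguments handle them.\<close>

lemma derived_subset_iff:
  assumes K: "subgroup K G" and A: "A \<subseteq> carrier G"
  shows "derived G A \<subseteq> K \<longleftrightarrow> (\<forall>x\<in>A. \<forall>y\<in>A. comm x y \<in> K)"
proof
  assume a: "derived G A \<subseteq> K"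
  show "\<forall>x\<in>A. \<forall>y\<in>A. comm x y \<in> K"
  proof (intro ballI)
    fix x y assume "x \<in> A" "y \<in> A"
    then have "comm x y \<in> derived_set G A" unfolding comm_def by blast
    then show "comm x y \<in> K" using a unfolding derived_def by (meson generate.incl subsetD)
  qed
next
  assume "\<forall>x\<in>A. \<forall>y\<in>A. comm x y \<in> K"
  then have "derived_set G A \<subseteq> K" unfolding comm_def by blast
  then show "derived G A \<subseteq> K" unfolding derived_def using generate_subgroup_incl[OF _ K] by blast
qed

lemma derived_cj:
  assumes g: "g \<in> carrier G" and A: "A \<subseteq> carrier G"
  shows "cj g ` derived G A = derived G (cj g ` A)"
  using group_hom.derived_img[OF cj_hom[OF g] A] by simp

lemma nzr_derived: "A \<subseteq> carrier G \<Longrightarrow> nzr A \<subseteq> nzr (derived G A)"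
proof
  fix x assume A: "A \<subseteq> carrier G" and x: "x \<in> nzr A"
  then have "x \<in> carrier G" "cj x ` A = A" unfolding nzr_def by auto
  then show "x \<in> nzr (derived G A)" using derived_cj[of x A] A unfolding nzr_def by simp
qed

lemma nzr_cent: "A \<subseteq> carrier G \<Longrightarrow> nzr A \<subseteq> nzr (cent A)"
proof
  fix g assume A: "A \<subseteq> carrier G" and g: "g \<in> nzr A"
  then have gc: "g \<in> carrier G" "cj g ` A = A" unfolding nzr_def by auto
  show "g \<in> nzr (cent A)"
    using nzrI[OF cent_subgroup[OF A] gc(1)] cent_image[OF gc(1) A] gc(2) by auto
qed

lemma nzr_Int: "subgroup A G \<Longrightarrow> subgroup B G \<Longrightarrow> nzr A \<inter> nzr B \<subseteq> nzr (A \<inter> B)"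
proof
  fix g assume a: "subgroup A G" "subgroup B G" "g \<in> nzr A \<inter> nzr B"
  then show "g \<in> nzr (A \<inter> B)"
    using nzrI[OF Int_subgroup[OF a(1,2)], of g] nzrD by (auto simp: nzr_def)
qed

section \<open>Transfer\<close>

text \<open>Burnside's fusion argument: as \<open>P\<close> is abelian, \<open>P\<close> and its
  conjugate by \<open>x\<close> are both Sylow in the centralizer of \<open>cj x g\<close>. Some
  \<open>d\<close> there carries the conjugate to \<open>P\<close>, so \<open>d \<otimes> x\<close>
  normalizes \<open>P\<close> and hence fixes \<open>g\<close>, while \<open>d\<close> fixes
  \<open>cj x g\<close>.\<close>

lemma fusion_central_sylow:
  assumes P: "sylow_in p (carrier G) P" and p: "prime p" and c: "nzr P \<subseteq> cent P"
    and g: "g \<in> P" and x: "x \<in> carrier G" and xg: "cj x g \<in> P"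
  shows "cj x g = g"
proof -
  have sP: "subgroup P G" using P unfolding sylow_in_def by auto
  have Pc: "P \<subseteq> carrier G" using subgroup.subset[OF sP] .
  let ?C = "cent {cj x g}"
  have C: "subgroup ?C G" using cent_subgroup xg Pc by blast
  have Pab: "P \<subseteq> cent P" using nzr_ge[OF sP] c by blast
  have "P \<subseteq> ?C" using Pab cent_mono[of "{cj x g}" P] xg by blast
  moreover have "cj x ` P \<subseteq> ?C"
  proof
    fix y assume "y \<in> cj x ` P"
    then obtain z where z: "z \<in> P" "y = cj x z" by auto
    have "z \<in> cent {g}" using Pab cent_mono[of "{g}" P] g z by blast
    then show "y \<in> ?C" using cent_image[OF x, of "{g}" z] g Pc z by auto
  qed
  moreover have "sylow_in p (carrier G) (cj x ` P)" using sylow_in_cjs[OF P subgroup_self x] .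
  ultimately have "sylow_in p ?C P" "sylow_in p ?C (cj x ` P)"
    using sylow_in_mono[OF _ subgroup_self C subgroup.subset[OF C] _ p] P by auto
  from sylow_in_conj[OF C this p] obtain d where d: "d \<in> ?C" "cj d ` (cj x ` P) = P" by blast
  have dc: "d \<in> carrier G" using d subgroup.mem_carrier[OF C] by blast
  then have "d \<otimes> x \<in> nzr P" using d cjs_comp[OF dc x Pc] x unfolding nzr_def by auto
  then have "cj (d \<otimes> x) g = g" using c g cent_iff_cj[OF Pc] by blast
  moreover have "cj (d \<otimes> x) g = cj d (cj x g)" using cj_comp dc x g Pc by blast
  moreover have "cj d (cj x g) = cj x g" using d(1) cent_iff_cj[of "{cj x g}"] xg Pc by auto
  ultimately show ?thesis by simp
qed

lemma finprod_cj:
  assumes P: "subgroup P G" "comm_group (G\<lparr>carrier := P\<rparr>)" and x: "x \<in> carrier G" and A: "finite A"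
    and w: "\<And>a. a \<in> A \<Longrightarrow> w a \<in> P" and xw: "\<And>a. a \<in> A \<Longrightarrow> cj x (w a) \<in> P"
  shows "finprod (G\<lparr>carrier := P\<rparr>) (\<lambda>a. cj x (w a)) A = cj x (finprod (G\<lparr>carrier := P\<rparr>) w A)"
  using A w xw
proof (induction A)
  case empty
  interpret Pg: comm_group "G\<lparr>carrier := P\<rparr>" by (rule P(2))
  show ?case using x by simp
next
  case (insert a A)
  interpret Pg: comm_group "G\<lparr>carrier := P\<rparr>" by (rule P(2))
  have f: "w \<in> A \<rightarrow> carrier (G\<lparr>carrier := P\<rparr>)" "(\<lambda>a. cj x (w a)) \<in> A \<rightarrow> carrier (G\<lparr>carrier := P\<rparr>)"
    using insert.prems by auto
  have "finprod (G\<lparr>carrier := P\<rparr>) w A \<in> P" using Pg.finprod_closed[OF f(1)] by simp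
  then have "finprod (G\<lparr>carrier := P\<rparr>) w A \<in> carrier G" "w a \<in> carrier G"
    using subgroup.mem_carrier[OF P(1)] insert.prems(1) by auto
  then show ?case
    using insert f Pg.finprod_insert[OF insert.hyps(1,2) f(1)] Pg.finprod_insert[OF insert.hyps(1,2) f(2)]
    by (simp add: cj_mult x)
qed

lemma (in comm_group) finprod_pow_sum:
  assumes "g \<in> carrier G" "finite A"
  shows "finprod G (\<lambda>a. g [^] (k a :: nat)) A = g [^] (\<Sum>a\<in>A. k a)"
  using assms(2) by (induction A) (simp_all add: assms(1) Pi_def nat_pow_mult)

text \<open>The transfer of \<^term>\<open>G\<close> into the abelian Sylow subgroup \<^term>\<open>P\<close>, computed with coset representatives
  of the form \<open>x \<otimes> u\<close>, where \<open>x\<close> depends only on the double coset and \<open>u \<in> P\<close>.  This choice turns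
  the contribution of each double coset, for arguments in \<^term>\<open>P\<close>, into a conjugate of a power.\<close>

theorem burnside_normal_complement:
  assumes P: "sylow_in p (carrier G) P" and p: "prime p" and c: "nzr P \<subseteq> cent P"
  shows "\<exists>K. K \<lhd> G \<and> card K * card P = order G"
proof -
  have sP: "subgroup P G" and cP: "card P = p ^ multiplicity p (order G)"
    using P unfolding sylow_in_def order_def by auto
  have Pc: "P \<subseteq> carrier G" using subgroup.subset[OF sP] .
  have Pab: "P \<subseteq> cent P" using nzr_ge[OF sP] c by blast
  let ?P = "G\<lparr>carrier := P\<rparr>"
  interpret P0: fin_group ?P by (rule sub_group[OF sP])
  have cg: "comm_group ?P"
    by (rule P0.group_comm_groupI) (use Pab centD in auto)
  interpret Pg: comm_group ?P by (rule cg)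
  let ?R = "rcosets P"
  have finR: "finite ?R" by (simp add: RCOSETS_def)
  \<comment> \<open>The orbit of \<open>C\<close> under right multiplication by \<open>P\<close> is
    the set of cosets inside one double coset. \<open>xo\<close> chooses a representative of that
    double coset and \<open>u\<close> the remaining factor in \<open>P\<close>.\<close>
  define orb where "orb C = (\<lambda>u. C #> u) ` P" for C
  define xo where "xo B = (SOME x. x \<in> carrier G \<and> orb (P #> x) = B)" for B
  define u where "u C = (SOME u. u \<in> P \<and> C = P #> (xo (orb C) \<otimes> u))" for C
  define rep where "rep C = xo (orb C) \<otimes> u C" for C
  have Rc: "C \<subseteq> carrier G" if "C \<in> ?R" for C using that subgroup.rcosets_carrier[OF sP is_group] by blast
  have Rg: "C #> g \<in> ?R" if "C \<in> ?R" "g \<in> carrier G" for C g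
    using that Pc unfolding RCOSETS_def by (auto simp: coset_mult_assoc)
  have orb_R: "orb C \<subseteq> ?R" if "C \<in> ?R" for C using Rg that Pc unfolding orb_def by auto
  have orb_refl: "C \<in> orb C" if "C \<in> ?R" for C
    using Rc[OF that] subgroup.one_closed[OF sP] unfolding orb_def by (metis coset_mult_one imageI)
  have orb_g: "orb (C #> g) = orb C" if C: "C \<in> ?R" and g: "g \<in> P" for C g
  proof -
    have eq: "C #> g #> h = C #> (g \<otimes> h)" if "h \<in> P" for h
      using coset_mult_assoc[OF Rc[OF C]] g that Pc by blast
    have "(\<lambda>h. g \<otimes> h) ` P = P"
    proof
      show "(\<lambda>h. g \<otimes> h) ` P \<subseteq> P" using g sP by (auto simp: subgroup.m_closed)
      show "P \<subseteq> (\<lambda>h. g \<otimes> h) ` P"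
      proof
        fix h assume h: "h \<in> P"
        then have "h = g \<otimes> (inv g \<otimes> h)" "inv g \<otimes> h \<in> P"
          using g Pc sP by (auto simp: subgroup.m_closed subgroup.m_inv_closed subset_iff)
        then show "h \<in> (\<lambda>h. g \<otimes> h) ` P" by blast
      qed
    qed
    moreover have "orb (C #> g) = (\<lambda>h. C #> (g \<otimes> h)) ` P" unfolding orb_def by (rule image_cong) (simp_all add: eq)
    ultimately show ?thesis unfolding orb_def by (metis image_image)
  qed
  have orb_eq: "orb C' = orb C" if "C \<in> ?R" "C' \<in> orb C" for C C'
  proof -
    from that(2) obtain v where "v \<in> P" "C' = C #> v" by (auto simp: orb_def)
    then show ?thesis using orb_g[OF that(1)] by simp
  qed
  have xo: "xo (orb C) \<in> carrier G" "orb (P #> xo (orb C)) = orb C" if "C \<in> ?R" for C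
  proof -
    obtain y where "y \<in> carrier G" "C = P #> y" using \<open>C \<in> ?R\<close> unfolding RCOSETS_def by auto
    then have "\<exists>x. x \<in> carrier G \<and> orb (P #> x) = orb C" by blast
    from someI_ex[OF this] show "xo (orb C) \<in> carrier G" "orb (P #> xo (orb C)) = orb C"
      unfolding xo_def by auto
  qed
  have u: "u C \<in> P" "C = P #> rep C" if C: "C \<in> ?R" for C
  proof -
    have "C \<in> orb (P #> xo (orb C))" using orb_refl[OF C] xo[OF C] by simp
    then obtain v where "v \<in> P" "C = P #> xo (orb C) #> v" unfolding orb_def by auto
    then have "\<exists>u. u \<in> P \<and> C = P #> (xo (orb C) \<otimes> u)"
      using coset_mult_assoc[OF Pc xo(1)[OF C]] Pc by blast
    from someI_ex[OF this] show "u C \<in> P" "C = P #> rep C" unfolding u_def rep_def by auto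
  qed
  have repc: "rep C \<in> carrier G" if "C \<in> ?R" for C
    using xo(1)[OF that] u(1)[OF that] Pc unfolding rep_def by auto
  \<comment> \<open>The element of \<open>P\<close> by which \<open>rep C \<otimes> g\<close>
    differs from the representative of the coset \<open>C #> g\<close>; the transfer is the product
    of these.\<close>
  define F where "F g C = rep C \<otimes> g \<otimes> inv (rep (C #> g))" for g C
  have FP: "F g C \<in> P" if C: "C \<in> ?R" and g: "g \<in> carrier G" for g C
  proof -
    have "P #> rep (C #> g) = P #> (rep C \<otimes> g)"
      using u(2)[OF Rg[OF C g]] u(2)[OF C] coset_mult_assoc[OF Pc repc[OF C] g] by simp
    moreover have "rep C \<otimes> g \<in> carrier G" using repc[OF C] g by simp
    ultimately have "rep C \<otimes> g \<in> P #> rep (C #> g)" using rcos_self[OF _ sP] by simp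
    then show ?thesis unfolding F_def
      using subgroup.rcos_module_imp[OF sP is_group repc[OF Rg[OF C g]]] by simp
  qed
  define tr where "tr g = finprod ?P (F g) ?R" for g
  have trP: "tr g \<in> P" if "g \<in> carrier G" for g
    using Pg.finprod_closed[of "F g" ?R] FP that unfolding tr_def by auto
  have hom_tr: "tr (g \<otimes> h) = tr g \<otimes> tr h" if g: "g \<in> carrier G" and h: "h \<in> carrier G" for g h
  proof -
    have "F (g \<otimes> h) C = F g C \<otimes> F h (C #> g)" if C: "C \<in> ?R" for C
      using repc[OF C] repc[OF Rg[OF C g]] repc[OF Rg[OF C m_closed[OF g h]]] g h
        coset_mult_assoc[OF Rc[OF C] g h]
      unfolding F_def by (simp add: m_assoc)
    then have "tr (g \<otimes> h) = finprod ?P (\<lambda>C. F g C \<otimes>\<^bsub>?P\<^esub> F h (C #> g)) ?R"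
      unfolding tr_def using FP[OF _ g] FP[OF Rg[OF _ g] h] sP
      by (intro Pg.finprod_cong') (auto simp: subgroup.m_closed)
    also have "\<dots> = tr g \<otimes> finprod ?P (\<lambda>C. F h (C #> g)) ?R"
      unfolding tr_def using FP[OF _ g] FP[OF Rg[OF _ g] h] by (subst Pg.finprod_multf) auto
    also have "finprod ?P (\<lambda>C. F h (C #> g)) ?R = finprod ?P (F h) ((\<lambda>C. C #> g) ` ?R)"
    proof (rule Pg.finprod_reindex[symmetric])
      show "F h \<in> (\<lambda>C. C #> g) ` ?R \<rightarrow> carrier ?P" using FP[OF Rg[OF _ g] h] by auto
      show "inj_on (\<lambda>C. C #> g) ?R"
        by (rule inj_on_inverseI[where g = "\<lambda>C. C #> inv g"]) (simp add: coset_mult_assoc Rc g)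
    qed
    also have "(\<lambda>C. C #> g) ` ?R = ?R"
    proof
      show "(\<lambda>C. C #> g) ` ?R \<subseteq> ?R" using Rg g by auto
      have "C = (C #> inv g) #> g" if "C \<in> ?R" for C using Rc[OF that] g by (simp add: coset_mult_assoc)
      then show "?R \<subseteq> (\<lambda>C. C #> g) ` ?R" using Rg[OF _ inv_closed[OF g]] by blast
    qed
    finally show ?thesis unfolding tr_def .
  qed
  \<comment> \<open>For \<open>g\<close> in \<open>P\<close> the transfer is a plain power: each
    double coset contributes as many factors \<open>g\<close> as it has cosets.\<close>
  have trg: "tr g = g [^] card ?R" if g: "g \<in> P" for g
  proof -
    have gc: "g \<in> carrier G" using g Pc by blast
    have one: "finprod ?P (F g) B = g [^]\<^bsub>?P\<^esub> card B" if B: "B \<in> orb ` ?R" for B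
    proof -
      obtain C0 where C0: "C0 \<in> ?R" "B = orb C0" using B by auto
      have BR: "B \<subseteq> ?R" using C0 orb_R by blast
      have finB: "finite B" using BR finR finite_subset by blast
      have oB: "orb C = B" if "C \<in> B" for C using that C0 orb_eq by blast
      define x where "x = xo B"
      have xc: "x \<in> carrier G" using xo(1)[OF C0(1)] C0(2) unfolding x_def by simp
      define w where "w C = u C \<otimes> g \<otimes> inv (u (C #> g))" for C
      have Bg: "C #> g \<in> B" if "C \<in> B" for C
      proof -
        have "C \<in> ?R" using that BR by blast
        then show ?thesis using orb_refl[OF Rg[OF _ gc]] orb_g[OF _ g] oB[OF that] by metis
      qed
      have uP: "u C \<in> P" if "C \<in> B" for C using u(1) BR that by blast
      have wP: "w C \<in> P" if "C \<in> B" for C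
        using uP[OF that] uP[OF Bg[OF that]] g sP unfolding w_def by (simp add: subgroup.m_closed subgroup.m_inv_closed)
      have Fw: "F g C = cj x (w C)" if "C \<in> B" for C
      proof -
        have "rep C = x \<otimes> u C" "rep (C #> g) = x \<otimes> u (C #> g)"
          using oB[OF that] oB[OF Bg[OF that]] unfolding rep_def x_def by auto
        moreover have "u C \<in> carrier G" "u (C #> g) \<in> carrier G" using uP that Bg Pc by auto
        ultimately show ?thesis unfolding F_def w_def cj_def using xc gc
          by (simp add: m_assoc inv_mult_group)
      qed
      have FB: "cj x (w C) \<in> P" if "C \<in> B" for C using FP[OF _ gc, of C] Fw[OF that] that BR by auto
      \<comment> \<open>All representatives in \<open>B\<close> share the factor \<open>x\<close>,
        so the product is the conjugate by \<open>x\<close> of a product in the abelian group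
        \<open>P\<close>. There the factors \<open>u\<close> cancel, because \<open>C #> g\<close>
        runs through \<open>B\<close> again.\<close>
      have "finprod ?P (F g) B = finprod ?P (\<lambda>C. cj x (w C)) B"
        by (rule Pg.finprod_cong') (use Fw FB in auto)
      also have "\<dots> = cj x (finprod ?P w B)" by (rule finprod_cj[OF sP cg xc finB wP FB])
      finally have e1: "finprod ?P (F g) B = cj x (finprod ?P w B)" .
      have "finprod ?P w B = finprod ?P (\<lambda>C. (u C \<otimes>\<^bsub>?P\<^esub> g) \<otimes>\<^bsub>?P\<^esub> inv\<^bsub>?P\<^esub> (u (C #> g))) B"
        unfolding w_def using uP Bg g sP
        by (intro Pg.finprod_cong') (auto simp: subgroup.m_closed subgroup.m_inv_closed)
      also have "\<dots> = (finprod ?P u B \<otimes>\<^bsub>?P\<^esub> finprod ?P (\<lambda>C. g) B) \<otimes>\<^bsub>?P\<^esub> finprod ?P (\<lambda>C. inv\<^bsub>?P\<^esub> (u (C #> g))) B"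
      proof -
        have a: "u \<in> B \<rightarrow> carrier ?P" "(\<lambda>C. g) \<in> B \<rightarrow> carrier ?P"
            "(\<lambda>C. inv\<^bsub>?P\<^esub> (u (C #> g))) \<in> B \<rightarrow> carrier ?P"
          using uP Bg g P0.inv_closed by auto
        then have "(\<lambda>C. u C \<otimes>\<^bsub>?P\<^esub> g) \<in> B \<rightarrow> carrier ?P"
          using P0.m_closed by (auto simp: Pi_iff)
        then show ?thesis using a by (simp only: Pg.finprod_multf)
      qed
      also have "finprod ?P (\<lambda>C. inv\<^bsub>?P\<^esub> (u (C #> g))) B = finprod ?P (\<lambda>C. inv\<^bsub>?P\<^esub> (u C)) ((\<lambda>C. C #> g) ` B)"
      proof (rule Pg.finprod_reindex[symmetric])
        show "(\<lambda>C. inv\<^bsub>?P\<^esub> (u C)) \<in> (\<lambda>C. C #> g) ` B \<rightarrow> carrier ?P" using uP Bg P0.inv_closed by auto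
        have "(C #> g) #> inv g = C" if "C \<in> B" for C
          using Rc BR that gc by (metis coset_mult_assoc coset_mult_one inv_closed r_inv subsetD)
        then show "inj_on (\<lambda>C. C #> g) B" by (rule inj_on_inverseI)
      qed
      also have "(\<lambda>C. C #> g) ` B = B"
      proof (rule card_subset_eq[OF finB])
        show "(\<lambda>C. C #> g) ` B \<subseteq> B" using Bg by auto
        have "(C #> g) #> inv g = C" if "C \<in> B" for C
          using Rc BR that gc by (metis coset_mult_assoc coset_mult_one inv_closed r_inv subsetD)
        then have "inj_on (\<lambda>C. C #> g) B" by (rule inj_on_inverseI)
        then show "card ((\<lambda>C. C #> g) ` B) = card B" by (rule card_image)
      qed
      finally have "finprod ?P w B = (finprod ?P u B \<otimes>\<^bsub>?P\<^esub> finprod ?P (\<lambda>C. g) B) \<otimes>\<^bsub>?P\<^esub> finprod ?P (\<lambda>C. inv\<^bsub>?P\<^esub> (u C)) B" .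
      also have "\<dots> = finprod ?P (\<lambda>C. g) B \<otimes>\<^bsub>?P\<^esub> (finprod ?P u B \<otimes>\<^bsub>?P\<^esub> finprod ?P (\<lambda>C. inv\<^bsub>?P\<^esub> (u C)) B)"
      proof -
        have "finprod ?P u B \<in> carrier ?P" "finprod ?P (\<lambda>C. g) B \<in> carrier ?P"
             "finprod ?P (\<lambda>C. inv\<^bsub>?P\<^esub> (u C)) B \<in> carrier ?P"
          using uP g P0.inv_closed by (intro Pg.finprod_closed; auto)+
        then show ?thesis using P0.m_assoc Pg.m_comm by metis
      qed
      also have "finprod ?P u B \<otimes>\<^bsub>?P\<^esub> finprod ?P (\<lambda>C. inv\<^bsub>?P\<^esub> (u C)) B
          = finprod ?P (\<lambda>C. u C \<otimes>\<^bsub>?P\<^esub> inv\<^bsub>?P\<^esub> (u C)) B"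
        using uP P0.inv_closed by (subst Pg.finprod_multf) auto
      also have "\<dots> = \<one>\<^bsub>?P\<^esub>" using uP P0.r_inv by (intro Pg.finprod_one_eqI) auto
      also have "finprod ?P (\<lambda>C. g) B = g [^]\<^bsub>?P\<^esub> card B" using Pg.finprod_const g by auto
      finally have e2: "finprod ?P w B = g [^]\<^bsub>?P\<^esub> card B" using g P0.nat_pow_closed P0.r_one by auto
      \<comment> \<open>The power of \<open>g\<close> and its conjugate by \<open>x\<close> both lie
        in \<open>P\<close>, so the fusion lemma identifies them.\<close>
      have "finprod ?P (F g) B \<in> P" using Pg.finprod_closed[of "F g" B] FP[OF _ gc] BR by auto
      then have "cj x (g [^]\<^bsub>?P\<^esub> card B) = g [^]\<^bsub>?P\<^esub> card B"
        using e1 e2 by (intro fusion_central_sylow[OF P p c _ xc]) (use P0.nat_pow_closed[of g] g in auto)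
      then show ?thesis using e1 e2 by simp
    qed
    have UR: "\<Union>(orb ` ?R) = ?R" using orb_R orb_refl by blast
    have disj: "pairwise disjnt (orb ` ?R)"
    proof (rule pairwiseI)
      fix A B assume "A \<in> orb ` ?R" "B \<in> orb ` ?R" "A \<noteq> B"
      then show "disjnt A B" using orb_eq unfolding disjnt_def by blast
    qed
    have finO: "\<And>B. B \<in> orb ` ?R \<Longrightarrow> finite B" using orb_R finR finite_subset by blast
    have "tr g = finprod ?P (F g) (\<Union>(orb ` ?R))" unfolding tr_def UR ..
    also have "\<dots> = finprod ?P (finprod ?P (F g)) (orb ` ?R)"
    proof (rule Pg.finprod_Union_disjoint)
      show "finite (orb ` ?R)" using finR by blast
      show "finite A \<and> (\<forall>x\<in>A. F g x \<in> carrier ?P)" if "A \<in> orb ` ?R" for A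
        using that finO FP[OF _ gc] orb_R by auto
      show "pairwise disjnt (orb ` ?R)" by (rule disj)
    qed
    also have "\<dots> = finprod ?P (\<lambda>B. g [^]\<^bsub>?P\<^esub> card B) (orb ` ?R)"
      using one P0.nat_pow_closed[of g] g by (intro Pg.finprod_cong') auto
    also have "\<dots> = g [^]\<^bsub>?P\<^esub> (\<Sum>B\<in>orb ` ?R. card B)"
      using Pg.finprod_pow_sum[of g "orb ` ?R" card] g finR by simp
    also have "(\<Sum>B\<in>orb ` ?R. card B) = card (\<Union>(orb ` ?R))"
      using card_Union_disjoint[OF disj finO] by simp
    also have "g [^]\<^bsub>?P\<^esub> card (\<Union>(orb ` ?R)) = g [^] card ?R" unfolding UR by (rule nat_pow_consistent[symmetric])
    finally show ?thesis .
  qed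
  have h: "group_hom G ?P tr"
    using trP hom_tr P0.is_group by (auto simp: group_hom_def group_hom_axioms_def hom_def)
  interpret tr: group_hom G ?P tr by (rule h)
  have surj: "tr ` carrier G = carrier ?P"
  proof
    show "tr ` carrier G \<subseteq> carrier ?P" using trP by auto
    \<comment> \<open>On \<open>P\<close> the transfer raises to the power of the index, which is
      prime to \<open>card P\<close>; a Bezout coefficient \<open>a\<close> then gives the preimage
      \<open>y [^] a\<close> of \<open>y\<close>.\<close>
    have cop: "coprime (card ?R) (card P)"
    proof -
      have e: "card ?R * card P = order G" using lagrange[OF sP] .
      have "\<not> p dvd card ?R"
      proof -
        have "order G \<noteq> 0" using card_pos[OF subgroup_self] unfolding order_def by linarith
        moreover have "card ?R = order G div p ^ multiplicity p (order G)"
          using e card_pos[OF sP] cP by (metis div_mult_self_is_m)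
        ultimately show ?thesis using p by (metis multiplicity_decompose not_prime_unit)
      qed
      then have "coprime p (card ?R)" using p prime_imp_coprime by blast
      then show ?thesis unfolding cP by (simp add: coprime_commute)
    qed
    show "carrier ?P \<subseteq> tr ` carrier G"
    proof
      fix y assume "y \<in> carrier ?P"
      then have y: "y \<in> P" "y \<in> carrier G" using Pc by auto
      have "card ?R \<noteq> 0" using lagrange[OF sP] card_pos[OF subgroup_self] by (metis mult_is_0 order_def not_less_zero)
      then obtain a b where ab: "card ?R * a = card P * b + gcd (card ?R) (card P)" using bezout_nat by blast
      have g1: "gcd (card ?R) (card P) = 1" using cop by simp
      have yP: "y [^] card P = \<one>"
        using P0.pow_order_eq_1[of y] y by (simp add: order_def nat_pow_consistent[symmetric])
      have "y [^] a \<in> P" using y(1) P0.nat_pow_closed[of y a] by (simp add: nat_pow_consistent[symmetric])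
      then have "tr (y [^] a) = y [^] (card ?R * a)"
        using trg y(2) by (simp add: nat_pow_pow mult.commute)
      also have "\<dots> = (y [^] card P) [^] b \<otimes> y" unfolding ab g1
        using y(2) by (simp add: nat_pow_mult[symmetric] nat_pow_pow)
      also have "\<dots> = y" using y yP by simp
      finally show "y \<in> tr ` carrier G" using y(2) by (metis imageI nat_pow_closed)
    qed
  qed
  let ?K = "kernel G ?P tr"
  have K: "?K \<lhd> G" by (rule tr.normal_kernel)
  have "G Mod ?K \<cong> ?P" using tr.FactGroup_iso[OF surj] .
  then have "order (G Mod ?K) = card P" using iso_same_card by (fastforce simp: order_def)
  then have "card ?K * card P = order G" using fact_order[OF K] by (simp add: mult.commute)
  then show ?thesis using K by blast
qed

lemma order_pos: "order G > 0"
  using card_pos[OF subgroup_self] unfolding order_def .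

lemma nzr_subset: "nzr H \<subseteq> carrier G"
  unfolding nzr_def by blast

definition syls :: "nat \<Rightarrow> 'a set \<Rightarrow> 'a set set" where "syls p K = {P. sylow_in p K P}"

lemma syls_eq:
  assumes K: "subgroup K G" and P: "sylow_in p K P" and p: "prime p"
  shows "syls p K = (\<lambda>g. cj g ` P) ` K"
proof
  show "(\<lambda>g. cj g ` P) ` K \<subseteq> syls p K" unfolding syls_def using sylow_in_cjs[OF P K] by blast
  show "syls p K \<subseteq> (\<lambda>g. cj g ` P) ` K"
  proof
    fix Q assume "Q \<in> syls p K"
    then have "sylow_in p K Q" unfolding syls_def by simp
    from sylow_in_conj[OF K this P p] show "Q \<in> (\<lambda>g. cj g ` P) ` K" by blast
  qed
qed

lemma finite_syls: "subgroup K G \<Longrightarrow> finite (syls p K)"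
  unfolding syls_def sylow_in_def by (rule finite_subset[of _ "Pow K"]) (auto simp: sub_finite)

lemma card_syls:
  assumes K: "subgroup K G" and P: "sylow_in p K P" and p: "prime p"
  shows "card (syls p K) * card (K \<inter> nzr P) = card K" "p dvd card (syls p K) - 1" "card (syls p K) > 0"
    "card (syls p K) dvd card K" "\<not> p dvd card (syls p K)"
proof -
  have sP: "subgroup P G" using P unfolding sylow_in_def by simp
  show a: "card (syls p K) * card (K \<inter> nzr P) = card K"
    unfolding syls_eq[OF K P p] by (rule card_conjugates[OF subgroup.subset[OF sP] K])
  show b: "p dvd card (syls p K) - 1"
    unfolding syls_eq[OF K P p] by (rule sylow_count_mod[OF K P p])
  show c: "card (syls p K) > 0" using a card_pos[OF K] by (metis mult_is_0 not_gr_zero)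
  show "card (syls p K) dvd card K" using a by (metis dvd_triv_left)
  show "\<not> p dvd card (syls p K)"
  proof
    assume "p dvd card (syls p K)"
    then have "p dvd 1" using b c by (metis One_nat_def Suc_leI dvd_diffD1)
    then show False using p by simp
  qed
qed

lemma sylow_in_over:
  assumes K: "subgroup K G" and p: "prime p" and Q: "subgroup Q G" "Q \<subseteq> K" "card Q = p ^ k"
  shows "\<exists>P. sylow_in p K P \<and> Q \<subseteq> P"
proof -
  obtain P where P: "sylow_in p K P" using sylow_in_exists[OF K p] by blast
  obtain x where x: "x \<in> K" "cj x ` Q \<subseteq> P" using sylow_in_conj_into[OF K P p Q] by blast
  have xc: "x \<in> carrier G" using x subgroup.mem_carrier[OF K] by blast
  have "cj (inv x) ` (cj x ` Q) \<subseteq> cj (inv x) ` P" using x(2) by blast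
  then have "Q \<subseteq> cj (inv x) ` P" using cjs_inv[OF xc subgroup.subset[OF Q(1)]] by simp
  then show ?thesis using sylow_in_cjs[OF P K subgroup.m_inv_closed[OF K x(1)]] by blast
qed

text \<open>\<open>P\<close> is the only Sylow subgroup of \<open>K \<inter> nzr P\<close>, so the
  one that contains \<open>Q\<close> is \<open>P\<close>.\<close>

lemma sylow_in_normalized:
  assumes K: "subgroup K G" and p: "prime p" and Q: "subgroup Q G" "Q \<subseteq> K" "card Q = p ^ k"
    and P: "sylow_in p K P" and n: "Q \<subseteq> nzr P"
  shows "Q \<subseteq> P"
proof -
  have sP: "subgroup P G" "P \<subseteq> K" using P unfolding sylow_in_def by auto
  let ?L = "K \<inter> nzr P"
  have L: "subgroup ?L G" using Int_subgroup[OF K nzr_subgroup[OF subgroup.subset[OF sP(1)]]] .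
  have PL: "sylow_in p ?L P" using sylow_in_mono[OF P K L _ _ p] nzr_ge[OF sP(1)] sP by blast
  have "Q \<subseteq> ?L" using Q n by blast
  from sylow_in_over[OF L p Q(1) this Q(3)] obtain P' where P': "sylow_in p ?L P'" "Q \<subseteq> P'" by blast
  have "P' \<subseteq> nzr P" using P' unfolding sylow_in_def by blast
  then have "P' = P" using sylow_in_nzr_unique[OF L P'(1) PL p] by blast
  then show ?thesis using P' by simp
qed

lemma sylow_in_nontrivial: "subgroup K G \<Longrightarrow> sylow_in p K P \<Longrightarrow> prime p \<Longrightarrow> p dvd card K \<Longrightarrow> p dvd card P"
proof -
  assume a: "subgroup K G" "sylow_in p K P" "prime p" "p dvd card K"
  have "card K \<noteq> 0" using card_pos[OF a(1)] by simp
  then have "multiplicity p (card K) > 0" using a(3,4)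
    by (metis multiplicity_geI not_prime_unit power_one_right zero_less_one less_le_trans)
  then show ?thesis using a(2) unfolding sylow_in_def by simp
qed

text \<open>Orders are compared prime by prime. The lemma is used to show that something is
  centralized by all of \<open>K\<close> after checking one Sylow subgroup for each prime.\<close>

lemma eq_of_contains_sylows:
  assumes K: "subgroup K G" and C: "subgroup C G" "C \<subseteq> K"
    and s: "\<And>p. prime p \<Longrightarrow> p dvd card K \<Longrightarrow> \<exists>P. sylow_in p K P \<and> P \<subseteq> C"
  shows "C = K"
proof -
  have nz: "card K \<noteq> 0" "card C \<noteq> 0" using card_pos K C by fastforce+
  have "card K dvd card C"
  proof (rule multiplicity_le_imp_dvd)
    show "card K \<noteq> 0" by fact
    fix p :: nat assume p: "prime p"
    show "multiplicity p (card K) \<le> multiplicity p (card C)"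
    proof (cases "p dvd card K")
      case True
      obtain P where P: "sylow_in p K P" "P \<subseteq> C" using s[OF p True] by blast
      have "card P dvd card C" using sub_dvd[OF _ C(1) P(2)] P(1) unfolding sylow_in_def by blast
      then show ?thesis using P(1) nz p unfolding sylow_in_def
        by (metis multiplicity_geI not_prime_unit)
    next
      case False
      then show ?thesis by (simp add: not_dvd_imp_multiplicity_0)
    qed
  qed
  then have "card C = card K" using sub_dvd[OF C(1) K C(2)] by (simp add: dvd_antisym)
  then show ?thesis using sub_eqI[OF C(1) K C(2)] by simp
qed

text \<open>The centre of a nontrivial \<open>p\<close>-group is nontrivial, so here it has index 1
  or \<open>p\<close>, and prime index over a central subgroup forces commutativity.\<close>

lemma abelian_order_le_p_squared:
  assumes P: "subgroup P G" "card P = p ^ k" "prime p" "k \<le> 2"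
  shows "P \<subseteq> cent P"
proof (cases "k = 0")
  case True
  then have "P = {\<one>}" using card_eq_one[OF P(1)] P(2) by simp
  then show ?thesis unfolding cent_def by auto
next
  case k: False
  have Pc: "P \<subseteq> carrier G" using subgroup.subset[OF P(1)] .
  let ?Z = "P \<inter> cent P"
  have Z: "subgroup ?Z G" using Int_subgroup[OF P(1) cent_subgroup[OF Pc]] .
  obtain x where x: "x \<in> P" "x \<noteq> \<one>" "\<forall>g\<in>P. cj g x = x"
    using p_group_fixes_nontrivial[OF P(1,2,3) P(1)] P(2) k nzr_ge[OF P(1)] by auto
  have "g \<otimes> x = x \<otimes> g" if "g \<in> P" for g using x(3,1) cj_eq_iff Pc that by blast
  then have xZ: "x \<in> ?Z" using x Pc unfolding cent_def by auto
  obtain j where j: "j \<le> k" "card ?Z = p ^ j" using card_prime_power_sub[OF P(1,2,3) Z] by auto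
  have "j \<noteq> 0" using j xZ x card_eq_one[OF Z] by (metis power_0 singletonD)
  then consider "j = k" | "j = 1" "k = 2" using j P(4) by linarith
  then show ?thesis
  proof cases
    case 1 then show ?thesis using sub_eqI[OF Z P(1)] j P(2) by auto
  next
    case 2
    show ?thesis
      by (rule abelian_from_prime_index[OF P(1) Z _ _ P(3)])
         (use 2 j P(2) cent_mono[of ?Z P] in \<open>auto simp: power2_eq_square\<close>)
  qed
qed

section \<open>Orders of non-self-normalizing subgroups\<close>

lemma nsnI: "subgroup H G \<Longrightarrow> H \<noteq> {\<one>} \<Longrightarrow> nzr H \<noteq> H \<Longrightarrow> nsn H"
  unfolding nsn_def by simp

lemma nsn_normal: "N \<lhd> G \<Longrightarrow> N \<noteq> {\<one>} \<Longrightarrow> N \<noteq> carrier G \<Longrightarrow> nsn N"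
  unfolding nsn_def normal_iff_nzr by auto

lemma nsn_of_sub: "subgroup K G \<Longrightarrow> subgroup H G \<Longrightarrow> H \<noteq> {\<one>} \<Longrightarrow> K \<inter> nzr H \<noteq> H \<Longrightarrow> H \<subseteq> K \<Longrightarrow> nsn H"
  unfolding nsn_def by blast

lemma nsn_of_sub_group:
  assumes K: "subgroup K G" and H: "fin_group.nsn (G\<lparr>carrier := K\<rparr>) H"
  shows "nsn H"
proof -
  interpret K: fin_group "G\<lparr>carrier := K\<rparr>" by (rule sub_group[OF K])
  show ?thesis using H sub_iff[OF K] sub_nzr[OF K] nsn_of_sub[OF K] unfolding K.nsn_def by auto
qed

lemma nsn_p:
  assumes "subgroup H G" "card H = p ^ k" "prime p" "k > 0" "p ^ Suc k dvd order G"
  shows "nsn H"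
proof (rule nsnI[OF assms(1)])
  have "card H \<noteq> 1" using assms by (metis less_numeral_extra(3) nat_power_eq_Suc_0_iff not_prime_1 One_nat_def)
  then show "H \<noteq> {\<one>}" by auto
  show "nzr H \<noteq> H" using nzr_ne_of_dvd[OF assms(1,2,3,5)] .
qed

definition nsn_orders :: "nat set" where "nsn_orders = card ` {H. nsn H}"

lemma finite_nsn: "finite {H. nsn H}"
  by (rule finite_subset[of _ "Pow (carrier G)"]) (auto simp: nsn_def dest: subgroup.mem_carrier)

lemma finite_nsn_orders [simp]: "finite nsn_orders"
  unfolding nsn_orders_def using finite_nsn by simp

lemma nsn_orderI: "nsn H \<Longrightarrow> card H \<in> nsn_orders"
  unfolding nsn_orders_def by blast

lemma nsn_orders_p:
  assumes "prime p" "k > 0" "p ^ Suc k dvd order G"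
  shows "p ^ k \<in> nsn_orders"
proof -
  have "p ^ k dvd card (carrier G)" using assms(3) by (metis dvd_trans le_imp_power_dvd lessI less_imp_le_nat order_def)
  from subgroup_of_prime_power_exists[OF subgroup_self assms(1) this]
  obtain H where "subgroup H G" "card H = p ^ k" by blast
  then show ?thesis using nsn_p[of H p k] assms nsn_orderI by metis
qed

lemma card_TI_family:
  assumes "finite E" "\<And>H. H \<in> E \<Longrightarrow> subgroup H G \<and> card H = c"
    and "\<And>H K. H \<in> E \<Longrightarrow> K \<in> E \<Longrightarrow> H \<noteq> K \<Longrightarrow> H \<inter> K = {\<one>}"
  shows "card (\<Union>E - {\<one>}) = card E * (c - 1)"
proof -
  have "\<Union>E - {\<one>} = (\<Union>H\<in>E. H - {\<one>})" by blast
  also have "card \<dots> = (\<Sum>H\<in>E. card (H - {\<one>}))"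
    using assms by (intro card_UN_disjoint) (auto simp: sub_finite)
  also have "\<dots> = (\<Sum>H\<in>E. c - 1)"
    using assms(2) by (intro sum.cong) (auto simp: subgroup.one_closed card_Diff_singleton)
  finally show ?thesis by simp
qed

lemma coprime_Int: "subgroup H G \<Longrightarrow> subgroup K G \<Longrightarrow> coprime (card H) (card K) \<Longrightarrow> H \<inter> K = {\<one>}"
proof -
  assume a: "subgroup H G" "subgroup K G" "coprime (card H) (card K)"
  have i: "subgroup (H \<inter> K) G" using Int_subgroup a by blast
  have "card (H \<inter> K) dvd card H" "card (H \<inter> K) dvd card K" using sub_dvd[OF i] a by auto
  then have "card (H \<inter> K) = 1" using a(3) coprime_common_divisor_nat by blast
  then show ?thesis using card_eq_one[OF i] by simp
qed

text \<open>\<open>S/D\<close> has order at most \<open>p\<^sup>2\<close> and is therefore abelian, so the transfer theorem applies in \<open>G/D\<close>.\<close>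

lemma relative_normal_complement:
  assumes D: "D \<lhd> G" and S: "sylow_in p (carrier G) S" and p: "prime p" and DS: "D \<subseteq> S"
    and cD: "card D = p ^ d" and cS: "card S = p ^ s" "s \<le> d + 2" and sn: "nzr S = S"
  shows "\<exists>M. M \<lhd> G \<and> D \<subseteq> M \<and> card M * card S = order G * card D"
proof -
  interpret D: normal D G by (rule D)
  interpret Q: fin_group "G Mod D" by (rule fact_fin_group[OF D])
  have sD: "subgroup D G" using D.is_subgroup .
  have sS: "subgroup S G" using S unfolding sylow_in_def by simp
  have Sc: "S \<subseteq> carrier G" using subgroup.subset[OF sS] .
  define T where "T = (\<lambda>x. D #> x) ` S"
  have hom: "group_hom G (G Mod D) (\<lambda>x. D #> x)"
    using D.r_coset_hom_Mod Q.is_group by (auto simp: group_hom_def group_hom_axioms_def)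
  have T: "subgroup T (G Mod D)" unfolding T_def using group_hom.subgroup_img_is_subgroup[OF hom sS] .
  have cT: "card T * card D = card S" unfolding T_def by (rule card_nzr_rcosets[OF sD sS DS])
  have ds: "d \<le> s" using sub_dvd[OF sD sS DS] cD cS p by (metis power_dvd_imp_le prime_gt_1_nat)
  have cT': "card T = p ^ (s - d)"
  proof -
    have "p ^ s = p ^ (s - d) * p ^ d" using ds by (simp add: power_add[symmetric])
    then have "card T * p ^ d = p ^ (s - d) * p ^ d" using cT cD cS by simp
    then show ?thesis using p prime_gt_0_nat by simp
  qed
  have oQ: "order (G Mod D) * card D = order G" by (rule fact_order[OF D])
  have nz: "order G \<noteq> 0" using order_pos by simp
  then have nzQ: "order (G Mod D) \<noteq> 0" using oQ by (metis mult_0)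
  have mult: "multiplicity p (order G) = s"
    using S cS(1) p unfolding sylow_in_def order_def
    by (metis power_inject_exp prime_gt_1_nat)
  have "multiplicity p (order G) = multiplicity p (order (G Mod D)) + multiplicity p (card D)"
    using oQ nzQ nz p by (metis mult_eq_0_iff prime_elem_multiplicity_mult_distrib prime_imp_prime_elem)
  moreover have "multiplicity p (card D) = d"
    using cD p by (metis multiplicity_same_power not_prime_0 not_prime_unit)
  ultimately have "multiplicity p (order (G Mod D)) = s - d" using mult by simp
  then have TS: "Q.sylow_in p (carrier (G Mod D)) T"
    unfolding Q.sylow_in_def using T cT' subgroup.subset[OF T] by (simp add: order_def)
  have Tab: "T \<subseteq> Q.cent T" by (rule Q.abelian_order_le_p_squared[OF T cT' p]) (use cS in simp)
  \<comment> \<open>Since \<open>D\<close> lies in \<open>S\<close>, an element that normalizes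
    \<open>S\<close> modulo \<open>D\<close> normalizes \<open>S\<close>. So \<open>T\<close> is
    self-normalizing and, being abelian, has its normalizer inside its centralizer.\<close>
  have "Q.nzr T \<subseteq> T"
  proof
    fix C assume C: "C \<in> Q.nzr T"
    then have "C \<in> carrier (G Mod D)" unfolding Q.nzr_def by simp
    then obtain g where g: "g \<in> carrier G" "C = D #> g" unfolding carrier_FactGroup by blast
    have "g \<in> nzr S"
    proof (rule nzrI[OF sS g(1)])
      fix x assume x: "x \<in> S"
      have xc: "x \<in> carrier G" using x Sc by blast
      have "Q.cj C (D #> x) \<in> T" using Q.nzrD[OF C] x unfolding T_def by blast
      moreover have "Q.cj C (D #> x) = D #> (cj g x)"
        unfolding Q.cj_def cj_def g(2)
        using g(1) xc group_hom.hom_mult[OF hom] group_hom.hom_inv[OF hom] by simp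
      ultimately obtain y where y: "y \<in> S" "D #> cj g x = D #> y" unfolding T_def by auto
      have "cj g x \<in> D #> y" using rcos_self[OF _ sD, of "cj g x"] y(2) g xc by simp
      then obtain d where "d \<in> D" "cj g x = d \<otimes> y" unfolding r_coset_def by auto
      then show "cj g x \<in> S" using DS y(1) subgroup.m_closed[OF sS] by auto
    qed
    then show "C \<in> T" using sn g(2) unfolding T_def by blast
  qed
  then have "Q.nzr T \<subseteq> Q.cent T" using Tab by blast
  from Q.burnside_normal_complement[OF TS p this]
  obtain K where K: "K \<lhd> G Mod D" "card K * card T = order (G Mod D)" by blast
  have sK: "subgroup K (G Mod D)" using K(1) normal_imp_subgroup by blast
  have "\<Union>K \<lhd> G" using D.factgroup_subgroup_union_normal[OF K(1)] .
  moreover have "D \<subseteq> \<Union>K" using card_fact_union(3)[OF D sK] .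
  moreover have "card (\<Union>K) * card S = order G * card D"
    using card_fact_union(2)[OF D sK] cT K(2) oQ by (metis mult.assoc mult.commute)
  ultimately show ?thesis by blast
qed

end

section \<open>Simple groups with at most four such orders\<close>

text \<open>The second assumption excludes the trivial group as well as the groups of prime
  order.\<close>

locale simple_fin = fin_group +
  assumes simple: "N \<lhd> G \<Longrightarrow> N = {\<one>} \<or> N = carrier G"
    and nonabelian: "\<not> carrier G \<subseteq> cent (carrier G)"
begin

lemma not_p_group: "prime p \<Longrightarrow> order G \<noteq> p ^ n"
proof
  assume p: "prime p" and o: "order G = p ^ n"
  have "n \<noteq> 0"
  proof
    assume "n = 0"
    then have "carrier G = {\<one>}" using o card_eq_one[OF subgroup_self] by (simp add: order_def)
    then show False using nonabelian unfolding cent_def by auto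
  qed
  let ?Z = "cent (carrier G)"
  have n: "?Z \<lhd> G"
    unfolding normal_iff_nzr using cent_subgroup[OF subset_refl] nzr_cent[OF subset_refl] nzr_ge[OF subgroup_self]
      nzr_subset[of ?Z] by blast
  obtain x where x: "x \<in> carrier G" "x \<noteq> \<one>" "\<forall>g\<in>carrier G. cj g x = x"
    using p_group_fixes_nontrivial[OF subgroup_self o[unfolded order_def] p subgroup_self _ nzr_ge[OF subgroup_self]]
      o \<open>n \<noteq> 0\<close> by (auto simp: order_def)
  have "x \<otimes> g = g \<otimes> x" if g: "g \<in> carrier G" for g using x(3) cj_eq_iff[OF g x(1)] g by simp
  then have "x \<in> ?Z" using x(1) unfolding cent_def by blast
  then have "?Z = carrier G" using simple[OF n] x by blast
  then show False using nonabelian by blast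
qed

text \<open>A normal complement would be trivial or everything: in the first case \<open>G\<close>
  is a \<open>p\<close>-group, in the second \<open>P\<close> is trivial.\<close>

lemma sylow_not_central:
  assumes P: "sylow_in p (carrier G) P" and p: "prime p" "p dvd order G"
  shows "\<not> nzr P \<subseteq> cent P"
proof
  assume "nzr P \<subseteq> cent P"
  from burnside_normal_complement[OF P p(1) this] obtain K where K: "K \<lhd> G" "card K * card P = order G" by blast
  have "p dvd card P" using sylow_in_nontrivial[OF subgroup_self P p(1)] p(2) by (simp add: order_def)
  then have "card P \<noteq> 1" using p by auto
  moreover have "K = {\<one>} \<or> K = carrier G" using simple[OF K(1)] .
  moreover have "order G > 0" by (rule order_pos)
  ultimately have "order G = card P" using K(2) by (auto simp: order_def)
  then show False using not_p_group[OF p(1)] P unfolding sylow_in_def by metis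
qed

lemma sylow_not_normal:
  assumes P: "sylow_in p (carrier G) P" and p: "prime p" "p dvd order G"
  shows "nzr P \<noteq> carrier G"
proof
  assume n: "nzr P = carrier G"
  have sP: "subgroup P G" using P unfolding sylow_in_def by simp
  have "P \<lhd> G" using normal_iff_nzr n sP by simp
  then have "P = {\<one>} \<or> P = carrier G" by (rule simple)
  moreover have "P \<noteq> {\<one>}"
    using sylow_in_nontrivial[OF subgroup_self P p(1)] p by (auto simp: order_def)
  ultimately show False using not_p_group[OF p(1)] P unfolding sylow_in_def order_def by metis
qed

lemma syls_gt_one:
  assumes p: "prime p" "p dvd order G"
  shows "card (syls p (carrier G)) > 1"
proof -
  obtain P where P: "sylow_in p (carrier G) P" using sylow_in_exists[OF subgroup_self p(1)] by blast
  have sP: "subgroup P G" using P unfolding sylow_in_def by simp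
  have "card (syls p (carrier G)) \<noteq> 1"
  proof
    assume "card (syls p (carrier G)) = 1"
    then have "card (carrier G \<inter> nzr P) = card (carrier G)" using card_syls(1)[OF subgroup_self P p(1)] by simp
    moreover have "carrier G \<inter> nzr P = nzr P" unfolding nzr_def by auto
    ultimately have "nzr P = carrier G" 
      using sub_eqI[OF nzr_subgroup[OF subgroup.subset[OF sP]] subgroup_self nzr_subset] by simp
    then show False using sylow_not_normal[OF P p] by simp
  qed
  then show ?thesis using card_syls(3)[OF subgroup_self P p(1)] by linarith
qed

text \<open>If \<open>p^k\<close> is the full power of \<open>p\<close>, then \<open>k\<close> is at
  most 2 and the Sylow subgroup is abelian; were it self-normalizing, its normalizer would
  centralize it.\<close>

lemma nsn_orders_prime_power:
  assumes p: "prime p" and k: "k > 0" "p ^ k dvd order G" and e: "k \<le> 2 \<or> p ^ Suc k dvd order G"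
  shows "p ^ k \<in> nsn_orders"
proof (cases "p ^ Suc k dvd order G")
  case True then show ?thesis using nsn_orders_p[OF p k(1)] by simp
next
  case False
  obtain P where P: "sylow_in p (carrier G) P" using sylow_in_exists[OF subgroup_self p] by blast
  have sP: "subgroup P G" using P unfolding sylow_in_def by simp
  have "multiplicity p (order G) = k" using k(2) False by (simp add: multiplicity_eqI)
  then have cP: "card P = p ^ k" using P unfolding sylow_in_def order_def by simp
  have pd: "p dvd order G" using k by (meson dvd_power dvd_trans)
  have "P \<subseteq> cent P" using abelian_order_le_p_squared[OF sP cP p] e False by simp
  then have "nzr P \<noteq> P" using sylow_not_central[OF P p pd] by auto
  moreover have "P \<noteq> {\<one>}" using cP k p by (metis card_eq_one[OF sP] less_numeral_extra(3) nat_power_eq_Suc_0_iff not_prime_1 One_nat_def)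
  ultimately show ?thesis using nsnI[OF sP] nsn_orderI cP by metis
qed

text \<open>A Sylow subgroup \<open>P\<close> of prime order has only \<open>p - 1\<close>
  nonidentity elements, so a Sylow subgroup of \<open>nzr P\<close> for a prime
  \<open>r \<ge> p\<close> can move none of them. Hence the normalizer centralizes \<open>P\<close>,
  against transfer.\<close>

lemma smallest_prime_sq_dvd:
  assumes p: "prime p" "p dvd order G" and min: "\<And>q. prime q \<Longrightarrow> q dvd order G \<Longrightarrow> p \<le> q"
  shows "p ^ 2 dvd order G"
proof (rule ccontr)
  assume nd: "\<not> p ^ 2 dvd order G"
  obtain P where P: "sylow_in p (carrier G) P" using sylow_in_exists[OF subgroup_self p(1)] by blast
  have sP: "subgroup P G" using P unfolding sylow_in_def by simp
  have Pc: "P \<subseteq> carrier G" using subgroup.subset[OF sP] .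
  have "multiplicity p (order G) = 1" using p nd by (simp add: multiplicity_eqI power2_eq_square numeral_2_eq_2)
  then have cP: "card P = p" using P unfolding sylow_in_def order_def by simp
  let ?N = "nzr P"
  have N: "subgroup ?N G" using nzr_subgroup[OF Pc] .
  have C: "subgroup (cent P) G" using cent_subgroup[OF Pc] .
  have "?N \<inter> cent P = ?N"
  proof (rule eq_of_contains_sylows[OF N Int_subgroup[OF N C]])
    fix r assume r: "prime r" "r dvd card ?N"
    obtain R where R: "sylow_in r ?N R" using sylow_in_exists[OF N r(1)] by blast
    have sR: "subgroup R G" "R \<subseteq> ?N" using R unfolding sylow_in_def by auto
    have Rc: "\<And>g. g \<in> R \<Longrightarrow> g \<in> carrier G" using subgroup.mem_carrier[OF sR(1)] .
    let ?F = "{x \<in> P. \<forall>g\<in>R. cj g x = x}"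
    have F: "?F = P \<inter> cent R"
      using Pc Rc cj_eq_iff unfolding cent_def by (auto simp: subset_iff)
    have sF: "subgroup ?F G" unfolding F using Int_subgroup[OF sP cent_subgroup[OF subgroup.subset[OF sR(1)]]] .
    have "r dvd card (P - ?F)"
      using R sR(2) nzrD by (intro prime_dvd_moved_points[OF sR(1) _ r(1) Pc]) (auto simp: sylow_in_def)
    moreover have "card ?F = 1 \<or> card ?F = p"
      using sub_dvd[OF sF sP] cP p(1) by (auto simp: prime_nat_iff)
    moreover have "card (P - ?F) = card P - card ?F"
      by (rule card_Diff_subset) (auto simp: sub_finite[OF sP])
    moreover have "\<not> r dvd p - 1"
    proof
      assume "r dvd p - 1"
      then have "r \<le> p - 1" using p(1) prime_gt_1_nat by (intro dvd_imp_le) auto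
      moreover have "p \<le> r" using min[OF r(1)] r(2) order_dvd[OF N] by (meson dvd_trans)
      ultimately show False using p(1) prime_gt_0_nat[of p] by simp
    qed
    ultimately have "card ?F = p" using cP by auto
    then have "?F = P" using sub_eqI[OF sF sP] cP by auto
    then have "P \<subseteq> cent R" using F by blast
    then have "R \<subseteq> cent P" using cent_sym[OF _ subgroup.subset[OF sR(1)]] by blast
    then show "\<exists>R. sylow_in r ?N R \<and> R \<subseteq> ?N \<inter> cent P" using R sR by blast
  qed simp
  then show False using sylow_not_central[OF P p] by blast
qed

text \<open>For a nontrivial intersection \<open>D\<close> of maximal order, the Sylow \<open>p\<close>-subgroups of \<open>N(D)\<close> lie in distinct Sylow
  subgroups of \<open>G\<close>; by hypothesis there are just as many of them, so \<open>D\<close> lies in every Sylow \<open>p\<close>-subgroup, against simplicity.\<close>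

lemma sylow_intersections_trivial:
  assumes p: "prime p" and H: "\<And>k. k dvd order G \<Longrightarrow> p dvd k - 1 \<Longrightarrow> k > 1 \<Longrightarrow> k = card (syls p (carrier G))"
    and P1: "sylow_in p (carrier G) P1" "sylow_in p (carrier G) P2" "P1 \<noteq> P2"
  shows "P1 \<inter> P2 = {\<one>}"
proof (rule ccontr)
  assume nt: "P1 \<inter> P2 \<noteq> {\<one>}"
  let ?E = "syls p (carrier G)"
  define XS where "XS = {(A, B). A \<in> ?E \<and> B \<in> ?E \<and> A \<noteq> B \<and> A \<inter> B \<noteq> {\<one>}}"
  have "XS \<noteq> {}" using P1 nt unfolding XS_def syls_def by auto
  moreover have "finite XS" by (rule finite_subset[of _ "?E \<times> ?E"]) (auto simp: XS_def finite_syls[OF subgroup_self])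
  ultimately obtain A B where AB: "(A, B) \<in> XS" and mx: "\<And>A' B'. (A', B') \<in> XS \<Longrightarrow> card (A' \<inter> B') \<le> card (A \<inter> B)"
    using Max_in[of "(\<lambda>(A, B). card (A \<inter> B)) ` XS"] Max_ge[of "(\<lambda>(A, B). card (A \<inter> B)) ` XS"] by fastforce
  define D where "D = A \<inter> B"
  have A: "sylow_in p (carrier G) A" "sylow_in p (carrier G) B" "A \<noteq> B" "D \<noteq> {\<one>}"
    using AB unfolding XS_def syls_def D_def by auto
  have sA: "subgroup A G" "subgroup B G" using A unfolding sylow_in_def by auto
  have sD: "subgroup D G" unfolding D_def using Int_subgroup sA by blast
  have Dc: "D \<subseteq> carrier G" using subgroup.subset[OF sD] .
  have cA: "card A = p ^ multiplicity p (order G)" "card B = p ^ multiplicity p (order G)"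
    using A unfolding sylow_in_def order_def by auto
  let ?N = "nzr D"
  have N: "subgroup ?N G" using nzr_subgroup[OF Dc] .
  obtain k where k: "k \<le> multiplicity p (order G)" "card D = p ^ k"
    using card_prime_power_sub[OF sA(1) cA(1) p sD] D_def by auto
  have kl: "k < multiplicity p (order G)"
  proof (rule ccontr)
    assume "\<not> ?thesis"
    then have "card D = card A" "card D = card B" using k cA by auto
    then have "D = A" "D = B" using sub_eqI[OF sD] sA D_def by auto
    then show False using A(3) by simp
  qed
  have grow: "card (T \<inter> ?N) > card D" "subgroup (T \<inter> ?N) G"
    if "D \<subseteq> T" "subgroup T G" "card T = p ^ multiplicity p (order G)" for T
  proof -
    show s: "subgroup (T \<inter> ?N) G" using Int_subgroup[OF that(2) N] .
    have "p ^ Suc k dvd card (T \<inter> ?N)"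
      using dvd_card_nzr[OF that(2) sD that(1) k(2) p] that(3) kl by (simp add: le_imp_power_dvd del: power_Suc)
    then have "p ^ Suc k \<le> card (T \<inter> ?N)" using card_pos[OF s] dvd_imp_le by blast
    then show "card (T \<inter> ?N) > card D" using k p by (metis lessI less_le_trans power_strict_increasing_iff prime_gt_1_nat)
  qed
  \<comment> \<open>The part of \<open>A'\<close> in \<open>nzr D\<close> is larger than
    \<open>D\<close>. By maximality of \<open>D\<close>, no other Sylow subgroup of \<open>G\<close>
    can contain it.\<close>
  have uniq: "T = A'" if T: "T \<in> ?E" "A' \<in> ?E" "A' \<inter> ?N \<subseteq> T" "D \<subseteq> A'" for T A'
  proof (rule ccontr)
    assume ne: "T \<noteq> A'"
    have A': "subgroup A' G" "card A' = p ^ multiplicity p (order G)" "subgroup T G"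
      using T unfolding syls_def sylow_in_def order_def by auto
    have g: "card (A' \<inter> ?N) > card D" using grow[OF T(4) A'(1,2)] by simp
    have "A' \<inter> ?N \<subseteq> A' \<inter> T" using T by blast
    then have le: "card (A' \<inter> ?N) \<le> card (A' \<inter> T)" using sub_finite[OF A'(1)] by (intro card_mono) auto
    then have "card (A' \<inter> T) \<noteq> 1" using g card_pos[OF sD] by linarith
    then have "(A', T) \<in> XS" using T ne unfolding XS_def by auto
    from mx[OF this] show False using le g unfolding D_def by simp
  qed
  obtain S0 where S0: "sylow_in p ?N S0" using sylow_in_exists[OF N p] by blast
  have over: "\<exists>T\<in>?E. S \<subseteq> T" if "sylow_in p ?N S" for S
    using sylow_in_over[OF subgroup_self p, of S] that subgroup.subset unfolding sylow_in_def syls_def by fastforce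
  have DS: "D \<subseteq> S" if Ss: "sylow_in p ?N S" for S
  proof -
      obtain T where T: "sylow_in p ?N T" "D \<subseteq> T" using sylow_in_over[OF N p sD nzr_ge[OF sD] k(2)] by blast
      obtain x where x: "x \<in> ?N" "cj x ` T = S" using sylow_in_conj[OF N Ss T(1) p] by blast
      have "cj x ` D = D" using x(1) unfolding nzr_def by simp
      then show "D \<subseteq> S" using x(2) T(2) by blast
  qed
  \<comment> \<open>With a single Sylow subgroup in \<open>nzr D\<close>, one Sylow subgroup of
    \<open>G\<close> would contain the parts of both \<open>A\<close> and \<open>B\<close> in
    \<open>nzr D\<close>, and so equal both.\<close>
  have c1: "card (syls p ?N) \<noteq> 1"
  proof
    assume "card (syls p ?N) = 1"
    then obtain S where S: "syls p ?N = {S}" by (metis card_1_singletonE)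
    then have "sylow_in p ?N S" unfolding syls_def by blast
    then obtain T where T: "T \<in> ?E" "S \<subseteq> T" using over by blast
    have "Y \<inter> ?N \<subseteq> T" if Y: "Y \<in> ?E" "D \<subseteq> Y" for Y
    proof -
      have sY: "subgroup Y G" "card Y = p ^ multiplicity p (order G)" using Y unfolding syls_def sylow_in_def order_def by auto
      obtain j where "card (Y \<inter> ?N) = p ^ j"
        using card_prime_power_sub[OF sY p grow(2)[OF Y(2) sY]] by blast
      from sylow_in_over[OF N p grow(2)[OF Y(2) sY] _ this] obtain S' where "sylow_in p ?N S'" "Y \<inter> ?N \<subseteq> S'" by blast
      then show ?thesis using S T(2) unfolding syls_def by blast
    qed
    moreover have "A \<in> ?E" "B \<in> ?E" "D \<subseteq> A" "D \<subseteq> B" using A unfolding syls_def D_def by auto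
    ultimately have "T = A" "T = B" using uniq[OF T(1)] by auto
    then show False using A(3) by simp
  qed
  have "card (syls p ?N) dvd order G"
    using card_syls(4)[OF N S0 p] order_dvd[OF N] by (rule dvd_trans)
  \<comment> \<open>The number for \<open>nzr D\<close> divides \<open>order G\<close>, is 1 modulo
    \<open>p\<close> and exceeds 1, so the numerical hypothesis identifies it with the number for
    \<open>G\<close>.\<close>
  then have ceq: "card (syls p ?N) = card ?E"
    using H[of "card (syls p ?N)"] card_syls(2,3)[OF N S0 p] c1 by linarith
  define f where "f S = (SOME T. T \<in> ?E \<and> S \<subseteq> T)" for S
  have f: "f S \<in> ?E" "S \<subseteq> f S" if "sylow_in p ?N S" for S
    using someI_ex[of "\<lambda>T. T \<in> ?E \<and> S \<subseteq> T"] over[OF that] unfolding f_def by blast+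
  have fS: "S = f S \<inter> ?N" if S: "sylow_in p ?N S" for S
  proof (rule card_subset_eq)
    have sT: "subgroup (f S) G" "card (f S) = p ^ multiplicity p (order G)"
      using f[OF S] unfolding syls_def sylow_in_def order_def by auto
    have s: "subgroup (f S \<inter> ?N) G" using Int_subgroup[OF sT(1) N] .
    show "finite (f S \<inter> ?N)" using sub_finite[OF s] .
    show i: "S \<subseteq> f S \<inter> ?N" using f[OF S] S unfolding sylow_in_def by blast
    obtain j where j: "card (f S \<inter> ?N) = p ^ j" using card_prime_power_sub[OF sT p s] by blast
    from sylow_in_over[OF N p s _ j] obtain S' where S': "sylow_in p ?N S'" "f S \<inter> ?N \<subseteq> S'" by blast
    have "card (f S \<inter> ?N) \<le> card S'" using S' sub_finite unfolding sylow_in_def by (intro card_mono) auto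
    moreover have "card S' = card S" using S S' unfolding sylow_in_def by simp
    moreover have "card S \<le> card (f S \<inter> ?N)" using i sub_finite[OF s] by (rule card_mono[rotated])
    ultimately show "card S = card (f S \<inter> ?N)" by simp
  qed
  have "f ` syls p ?N = ?E"
  proof (rule card_subset_eq[OF finite_syls[OF subgroup_self]])
    show "f ` syls p ?N \<subseteq> ?E" using f unfolding syls_def by blast
    have "inj_on f (syls p ?N)" using fS unfolding syls_def by (metis inj_onI mem_Collect_eq)
    then show "card (f ` syls p ?N) = card ?E" using ceq card_image by metis
  qed
  then have Dall: "D \<subseteq> T" if "T \<in> ?E" for T using that DS f unfolding syls_def by (smt (verit) image_iff mem_Collect_eq subset_trans)
  \<comment> \<open>This intersection is normal and contains \<open>D\<close>, so simplicity would
    make \<open>G\<close> a \<open>p\<close>-group.\<close>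
  let ?I = "\<Inter>?E"
  have Ene: "?E \<noteq> {}" using P1(1) unfolding syls_def by blast
  have sI: "subgroup ?I G" by (rule subgroups_Inter[OF _ Ene]) (auto simp: syls_def sylow_in_def)
  have "?I \<lhd> G" unfolding normal_iff_cj
  proof (intro conjI ballI)
    show "subgroup ?I G" by (rule sI)
    fix g x assume g: "g \<in> carrier G" and x: "x \<in> ?I"
    show "cj g x \<in> ?I"
    proof
      fix T assume T: "T \<in> ?E"
      have sT: "subgroup T G" using T unfolding syls_def sylow_in_def by simp
      have "cj (inv g) ` T \<in> ?E" using T sylow_in_cjs[OF _ subgroup_self inv_closed[OF g]] unfolding syls_def by blast
      then have "x \<in> cj (inv g) ` T" using x by blast
      then obtain y where "y \<in> T" "x = cj (inv g) y" by blast
      then show "cj g x \<in> T" using g subgroup.mem_carrier[OF sT] by auto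
    qed
  qed
  then have "?I = {\<one>} \<or> ?I = carrier G" by (rule simple)
  moreover have "?I \<noteq> {\<one>}" using Dall A(4) subgroup.one_closed[OF sD] by blast
  ultimately have "carrier G \<subseteq> A" using A(1) unfolding syls_def by blast
  then have "A = carrier G" using subgroup.subset[OF sA(1)] by blast
  then show False using not_p_group[OF p] cA by (metis order_def)
qed

end

section \<open>Arithmetic of primes and prime powers\<close>

lemma prime_power_ne: "prime p \<Longrightarrow> prime q \<Longrightarrow> p \<noteq> q \<Longrightarrow> i > 0 \<Longrightarrow> p ^ i \<noteq> q ^ j" for p q :: nat
  using prime_power_inj''[of p q i j] by auto

lemma power_of_only_prime_divisor:
  fixes m :: nat
  assumes "m > 0" "prime q" "\<And>r. prime r \<Longrightarrow> r dvd m \<Longrightarrow> r = q"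
  shows "m = q ^ multiplicity q m"
proof -
  obtain x where x: "m = q ^ multiplicity q m * x" "\<not> q dvd x"
    using multiplicity_decompose'[of m q] assms by (metis not_prime_unit neq0_conv)
  have "x = 1"
  proof (rule ccontr)
    assume "x \<noteq> 1"
    then obtain r where "prime r" "r dvd x" using prime_factor_nat by blast
    moreover from this have "r dvd m" using x(1) by (metis dvd_mult)
    ultimately show False using assms(3) x(2) by blast
  qed
  then show ?thesis using x(1) by simp
qed

lemma multiplicity_prime_power_times:
  fixes p m :: nat
  assumes "prime p" "\<not> p dvd m"
  shows "multiplicity p (p ^ a * m) = a"
proof (rule multiplicity_eqI)
  show "\<not> p ^ Suc a dvd p ^ a * m"
  proof
    assume "p ^ Suc a dvd p ^ a * m"
    then have "p ^ a * p dvd p ^ a * m" by (simp add: mult.commute)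
    then have "p dvd m" using assms(1) by (simp only: nat_mult_dvd_cancel_disj) simp
    then show False using assms(2) by simp
  qed
qed simp

lemma primes_consecutive: "prime (p::nat) \<Longrightarrow> prime (p + 1) \<Longrightarrow> p = 2"
  using prime_odd_nat[of p] prime_odd_nat[of "p + 1"] prime_gt_1_nat[of p] by (cases "p = 2") auto

text \<open>As \<open>s > p\<close> divides \<open>(p - 1) (p + 1)\<close>, only
  \<open>s = p + 1\<close> remains, and 2 and 3 are the only consecutive primes.\<close>

lemma prime_dvd_sq_minus_one:
  fixes p s :: nat
  assumes "prime p" "prime s" "s > p" "s dvd p\<^sup>2 - 1"
  shows "p = 2" "s = 3"
proof -
  have p1: "p > 1" using assms(1) prime_gt_1_nat by blast
  have "p\<^sup>2 - 1 = (p - 1) * (p + 1)" using p1 by (simp add: algebra_simps power2_eq_square diff_mult_distrib2)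
  then have "s dvd p - 1 \<or> s dvd p + 1" using assms(2,4) prime_dvd_mult_iff by metis
  moreover have "\<not> s dvd p - 1" using p1 assms(3) by (auto dest!: dvd_imp_le)
  ultimately have "s dvd p + 1" by blast
  then have "s \<le> p + 1" by (rule dvd_imp_le) simp
  then have "s = p + 1" using assms(3) by simp
  then show "p = 2" "s = 3" using primes_consecutive[OF assms(1)] assms(2) by auto
qed

context fin_group begin

lemma prime_order_Int: "subgroup H G \<Longrightarrow> subgroup K G \<Longrightarrow> card H = r \<Longrightarrow> card K = r \<Longrightarrow> prime r \<Longrightarrow> H \<noteq> K \<Longrightarrow> H \<inter> K = {\<one>}"
proof -
  assume a: "subgroup H G" "subgroup K G" "card H = r" "card K = r" "prime r" "H \<noteq> K"
  have i: "subgroup (H \<inter> K) G" using Int_subgroup a by blast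
  have "card (H \<inter> K) dvd r" using sub_dvd[OF i a(1)] a(3) by auto
  then have "card (H \<inter> K) = 1 \<or> card (H \<inter> K) = r" using a(5) prime_nat_iff by blast
  moreover have "card (H \<inter> K) \<noteq> r"
    using sub_eqI[OF i a(1)] sub_eqI[OF i a(2)] a by auto
  ultimately show ?thesis using card_eq_one[OF i] by blast
qed

end

section \<open>Simple groups: exclusion of two prime divisors, then three\<close>

context simple_fin begin

text \<open>Pairwise trivial intersections leave exactly \<open>q^b\<close> elements outside the
  nonidentity elements of the Sylow \<open>p\<close>-subgroups. Every Sylow
  \<open>q\<close>-subgroup fills that set, so there is only one, against simplicity.\<close>

lemma no_TI_sylow_with_full_count:
  assumes p: "prime p" and q: "prime q" "p \<noteq> q" and o: "order G = p ^ a * q ^ b" "b > 0"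
    and c: "card (syls p (carrier G)) = q ^ b"
    and ti: "\<And>A B. A \<in> syls p (carrier G) \<Longrightarrow> B \<in> syls p (carrier G) \<Longrightarrow> A \<noteq> B \<Longrightarrow> A \<inter> B = {\<one>}"
  shows False
proof -
  let ?E = "syls p (carrier G)"
  have "\<not> p dvd q ^ b" "\<not> q dvd p ^ a" using p q prime_dvd_power_nat primes_dvd_imp_eq by metis+
  then have mp: "multiplicity p (order G) = a" and mq: "multiplicity q (order G) = b"
    using multiplicity_prime_power_times[OF p, of "q ^ b" a] multiplicity_prime_power_times[OF q(1), of "p ^ a" b]
    by (simp_all add: o mult.commute)
  have "card (\<Union>?E - {\<one>}) = q ^ b * (p ^ a - 1)"
  proof -
    have "subgroup H G \<and> card H = p ^ a" if "H \<in> ?E" for H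
      using that mp unfolding syls_def sylow_in_def order_def by simp
    from card_TI_family[OF finite_syls[OF subgroup_self] this ti] show ?thesis using c by simp
  qed
  moreover have U: "\<Union>?E - {\<one>} \<subseteq> carrier G"
    unfolding syls_def sylow_in_def by blast
  ultimately have cW: "card (carrier G - (\<Union>?E - {\<one>})) = q ^ b"
    using o p prime_gt_0_nat[of p] finite_subset[OF U fin]
    by (simp add: card_Diff_subset order_def algebra_simps diff_mult_distrib2)
  have "Q = carrier G - (\<Union>?E - {\<one>})" if Q: "sylow_in q (carrier G) Q" for Q
  proof (rule card_subset_eq)
    have sQ: "subgroup Q G" "card Q = q ^ b" using Q mq unfolding sylow_in_def order_def by auto
    show "card Q = card (carrier G - (\<Union>?E - {\<one>}))" using sQ cW by simp
    have "Q \<inter> A = {\<one>}" if "A \<in> ?E" for A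
      using that mp sQ p q by (intro coprime_Int) (auto simp: syls_def sylow_in_def order_def primes_coprime)
    then show "Q \<subseteq> carrier G - (\<Union>?E - {\<one>})" using subgroup.subset[OF sQ(1)] by blast
  qed simp
  then have "card (syls q (carrier G)) \<le> 1" unfolding syls_def
    by (metis (mono_tags, lifting) card_le_Suc0_iff_eq One_nat_def mem_Collect_eq finite_syls subgroup_self syls_def)
  moreover have "q dvd order G" using o by simp
  ultimately show False using syls_gt_one[OF q(1)] by fastforce
qed

lemma sylow_count_cond:
  assumes p: "prime p" "p dvd order G"
  shows "card (syls p (carrier G)) dvd order G" "p dvd card (syls p (carrier G)) - 1" "card (syls p (carrier G)) > 1"
proof -
  obtain P where "sylow_in p (carrier G) P" using sylow_in_exists[OF subgroup_self p(1)] by blast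
  then show "card (syls p (carrier G)) dvd order G" "p dvd card (syls p (carrier G)) - 1"
    using card_syls[OF subgroup_self _ p(1)] unfolding order_def by blast+
  show "card (syls p (carrier G)) > 1" using syls_gt_one[OF p] .
qed

lemma coprime_of_dvd_pred: "prime p \<Longrightarrow> p dvd k - 1 \<Longrightarrow> k > 1 \<Longrightarrow> coprime k (p ^ a)" for k p :: nat
proof -
  assume a: "prime p" "p dvd k - 1" "k > 1"
  have "\<not> p dvd k"
  proof
    assume "p dvd k"
    then have "p dvd 1" using a by (metis dvd_diffD1 less_imp_le_nat)
    then show False using a by simp
  qed
  then have "coprime p k" using a(1) prime_imp_coprime by blast
  then show ?thesis by (simp add: coprime_commute)
qed

text \<open>The only divisor above 1 that is 1 modulo \<open>p\<close> is \<open>q\<close>. So Sylow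
  \<open>p\<close>-subgroups meet trivially, and their number is the forbidden one.\<close>

lemma order_not_prime_power_times_prime:
  assumes p: "prime p" "a > 0" and q: "prime q" "p \<noteq> q" and o: "order G = p ^ a * q"
  shows False
proof -
  let ?n = "card (syls p (carrier G))"
  have k: "k = q" if "k dvd order G" "p dvd k - 1" "k > 1" for k
  proof -
    have "k dvd q" using coprime_of_dvd_pred[OF p(1) that(2,3)] that(1) o
      by (metis coprime_dvd_mult_right_iff)
    then show ?thesis using q(1) that(3) prime_nat_iff by auto
  qed
  have "p dvd order G" using o p by simp
  then have n: "?n = q" using k sylow_count_cond[OF p(1)] by blast
  show False
  proof (rule no_TI_sylow_with_full_count[OF p(1) q, of a 1])
    show "order G = p ^ a * q ^ 1" "card (syls p (carrier G)) = q ^ 1" using o n by simp_all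
    show "A \<inter> B = {\<one>}" if "A \<in> syls p (carrier G)" "B \<in> syls p (carrier G)" "A \<noteq> B" for A B
      using sylow_intersections_trivial[OF p(1)] that k n unfolding syls_def by auto
  qed simp
qed

text \<open>The number of Sylow \<open>q\<close>-subgroups is a power of \<open>p\<close> that is 1
  modulo \<open>q\<close>. As \<open>q > p\<close>, it is \<open>p^3\<close>, which is then all of
  \<open>p^a\<close>, or 4 with \<open>q = 3\<close>. In both cases Sylow \<open>q\<close>-subgroups
  meet trivially, which is contradictory.\<close>

lemma order_not_cubes:
  assumes p: "prime p" and q: "prime q" "p < q" and o: "order G = p ^ a * q ^ b" and a: "a > 0" "a \<le> 3" and b: "b \<ge> 2"
  shows False
proof -
  let ?n = "card (syls q (carrier G))"
  have p1: "p > 1" using p prime_gt_1_nat by blast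
  \<comment> \<open>The clause \<open>p + 1 \<noteq> q\<close> makes the alternatives exclusive,
    since \<open>q = 3\<close> means \<open>p = 2\<close>. The resulting uniqueness of
    \<open>k\<close> is what the lemma on trivial intersections asks for.\<close>
  have k: "k = p ^ 3 \<and> a = 3 \<and> p + 1 \<noteq> q \<or> k = 4 \<and> q = 3" if kk: "k dvd order G" "q dvd k - 1" "k > 1" for k
  proof -
    have "k dvd p ^ a" using coprime_of_dvd_pred[OF q(1) kk(2,3)] kk(1) o
      by (metis coprime_dvd_mult_left_iff)
    then obtain j where j: "j \<le> a" "k = p ^ j" using p divides_primepow_nat by blast
    have "j \<noteq> 0" using j kk(3) by (metis less_irrefl power_0)
    moreover have "j \<noteq> 1" using j kk q(2) p1 by (auto dest!: dvd_imp_le)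
    ultimately have "j = 2 \<or> j = 3" using j a by linarith
    then show ?thesis
    proof
      assume "j = 2"
      then have "p = 2" "q = 3" using prime_dvd_sq_minus_one[OF p q] kk(2) j by auto
      then show ?thesis using j \<open>j = 2\<close> by simp
    next
      assume "j = 3"
      moreover have "p + 1 \<noteq> q"
      proof
        assume "p + 1 = q"
        then have "p = 2" "q = 3" using primes_consecutive[OF p] q by auto
        then have "(3::nat) dvd 7" using kk(2) j \<open>j = 3\<close> by simp
        then show False by simp
      qed
      ultimately show ?thesis using j a by simp
    qed
  qed
  have qo: "q dvd order G" using o b by simp
  note nn = sylow_count_cond[OF q(1) qo]
  have H: "k = ?n" if "k dvd order G" "q dvd k - 1" "k > 1" for k
    using k[OF that] k[OF nn] p q(2) primes_consecutive[OF p] by (metis q(1) numeral_3_eq_3 Suc_eq_plus1 numeral_2_eq_2 prime_ge_2_nat le_antisym less_Suc_eq_le)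
  have ti: "A \<inter> B = {\<one>}" if "A \<in> syls q (carrier G)" "B \<in> syls q (carrier G)" "A \<noteq> B" for A B
    using sylow_intersections_trivial[OF q(1) H] that unfolding syls_def by auto
  from k[OF nn] show False
  proof
    assume "?n = p ^ 3 \<and> a = 3 \<and> p + 1 \<noteq> q"
    then show False using no_TI_sylow_with_full_count[OF q(1) p _ _ _ _ ti, of b a] o q(2) a by (simp add: mult.commute)
  next
    assume n4: "?n = 4 \<and> q = 3"
    have fE: "finite (syls q (carrier G))" by (rule finite_syls[OF subgroup_self])
    obtain A where A: "A \<in> syls q (carrier G)" using n4 by fastforce
    have "syls q (carrier G) \<noteq> {A}" using n4 by auto
    then obtain B where B: "B \<in> syls q (carrier G)" "A \<noteq> B" using A by blast
    have sA: "subgroup A G" "sylow_in q (carrier G) A" and sB: "subgroup B G" "sylow_in q (carrier G) B"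
      using A B unfolding syls_def sylow_in_def by auto
    have "\<not> q dvd p ^ a" using p q prime_dvd_power_nat primes_dvd_imp_eq by (metis less_irrefl)
    then have mq: "multiplicity q (order G) = b"
      using multiplicity_prime_power_times[OF q(1), of "p ^ a" b] by (simp add: o(1) mult.commute)
    have cA: "card A = q ^ b" using sA(2) mq unfolding sylow_in_def order_def by simp
    have i: "subgroup (A \<inter> nzr B) G" using Int_subgroup[OF sA(1) nzr_subgroup[OF subgroup.subset[OF sB(1)]]] .
    obtain j where j: "card (A \<inter> nzr B) = q ^ j" using card_prime_power_sub[OF sA(1) cA q(1) i] by blast
    \<comment> \<open>\<open>A\<close> has order at least 9 and acts on the four Sylow subgroups;
      the trivial intersection makes the orbit of \<open>B\<close> as long as
      \<open>A\<close>.\<close>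
    have "A \<inter> nzr B \<subseteq> B"
      by (rule sylow_in_normalized[OF subgroup_self q(1) i _ j sB(2)]) (use nzr_subset in auto)
    then have "A \<inter> nzr B = {\<one>}" using ti[OF A B] subgroup.one_closed[OF i] by blast
    then have "card ((\<lambda>g. cj g ` B) ` A) = q ^ b"
      using card_conjugates[OF subgroup.subset[OF sB(1)] sA(1)] cA by simp
    moreover have "(\<lambda>g. cj g ` B) ` A \<subseteq> syls q (carrier G)"
      using sylow_in_cjs[OF sB(2) subgroup_self] subgroup.mem_carrier[OF sA(1)] unfolding syls_def by blast
    ultimately have "q ^ b \<le> 4" using card_mono[OF fE] n4 by metis
    moreover have "(3::nat) ^ 2 \<le> 3 ^ b" using b by (intro power_increasing) auto
    ultimately show False using n4 by simp
  qed
qed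

text \<open>Both squares divide the order, so \<open>p\<close>, \<open>p^2\<close>,
  \<open>q\<close>, \<open>q^2\<close> are already four orders, and divisibility by
  \<open>p^4\<close> would add \<open>p^3\<close>. Hence \<open>a \<le> 3\<close>, the case just
  excluded.\<close>

lemma order_not_two_primes:
  assumes p: "prime p" and q: "prime q" "p < q" and o: "order G = p ^ a * q ^ b" "a > 0" "b > 0"
    and d: "card nsn_orders \<le> 4"
  shows False
proof -
  have min: "p \<le> s" if "prime s" "s dvd order G" for s
  proof -
    have "s dvd p ^ a \<or> s dvd q ^ b" using that o prime_dvd_mult_iff by metis
    then have "s = p \<or> s = q" using that p q prime_dvd_power_nat primes_dvd_imp_eq by metis
    then show ?thesis using q(2) by auto
  qed
  have po: "p dvd order G" "q dvd order G" using o by simp_all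
  have p2: "p ^ 2 dvd order G" using smallest_prime_sq_dvd[OF p po(1) min] .
  have b2: "b \<ge> 2"
  proof (rule ccontr)
    assume "\<not> b \<ge> 2"
    then have "b = 1" using o by simp
    then show False using order_not_prime_power_times_prime[OF p o(2) q(1)] q(2) o by auto
  qed
  then have q2: "q ^ 2 dvd order G" using o le_imp_power_dvd[of 2 b q] by simp
  have "p ^ 1 \<in> nsn_orders" "p ^ 2 \<in> nsn_orders" "q ^ 1 \<in> nsn_orders" "q ^ 2 \<in> nsn_orders"
    by (rule nsn_orders_prime_power; use p q(1) po p2 q2 in simp)+
  have "a \<le> 3"
  proof (rule ccontr)
    assume "\<not> a \<le> 3"
    then have "p ^ 4 dvd order G" using o le_imp_power_dvd[of 4 a p] by simp
    moreover from this have "p ^ 3 dvd order G" 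
      by (rule dvd_trans[rotated]) (rule le_imp_power_dvd, simp)
    ultimately have "p ^ 3 \<in> nsn_orders" using nsn_orders_prime_power[OF p, of 3] by simp
    then have s: "{p ^ 1, p ^ 2, p ^ 3, q ^ 1, q ^ 2} \<subseteq> nsn_orders" using \<open>p ^ 1 \<in> nsn_orders\<close> \<open>p ^ 2 \<in> nsn_orders\<close>
      \<open>q ^ 1 \<in> nsn_orders\<close> \<open>q ^ 2 \<in> nsn_orders\<close> by blast
    have "p ^ i \<noteq> q ^ j" if "i > 0" for i j using prime_power_ne[OF p q(1) _ that] q(2) by simp
    from this[of 1 1] this[of 1 2] this[of 2 1] this[of 2 2] this[of 3 1] this[of 3 2]
    have "p \<noteq> q" "p \<noteq> q\<^sup>2" "p\<^sup>2 \<noteq> q" "p\<^sup>2 \<noteq> q\<^sup>2" "p ^ 3 \<noteq> q" "p ^ 3 \<noteq> q\<^sup>2" by simp_all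
    moreover have "p ^ i = p ^ j \<longleftrightarrow> i = j" "q ^ i = q ^ j \<longleftrightarrow> i = j" for i j
      using p q(1) prime_power_inj by blast+
    from this(1)[of 1 2] this(1)[of 1 3] this(1)[of 2 3] this(2)[of 1 2]
    have "p \<noteq> p\<^sup>2" "p \<noteq> p ^ 3" "p\<^sup>2 \<noteq> p ^ 3" "q \<noteq> q\<^sup>2" by simp_all
    ultimately have "card {p ^ 1, p ^ 2, p ^ 3, q ^ 1, q ^ 2} = 5" by simp
    then show False using card_mono[OF finite_nsn_orders s] d by simp
  qed
  then show False using order_not_cubes[OF p q o(1)] o b2 by blast
qed

text \<open>By transfer, a Sylow \<open>s\<close>-subgroup of \<open>N(P)\<close>, for some \<open>s \<noteq> p\<close>, acts fixed point freely on the Sylow \<open>p\<close>-subgroup \<open>P\<close>,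
  which forces \<open>p = 2\<close>, \<open>s = 3\<close> and \<open>|N(P)| = 12\<close>.\<close>

lemma order_p2qr:
  assumes p: "prime p" "p < q" "p < r" and q: "prime q" and r: "prime r" "q \<noteq> r" and o: "order G = p ^ 2 * q * r"
  shows "order G = 60 \<and> (\<exists>N. subgroup N G \<and> card N = 12)"
proof -
  have pd: "\<not> p dvd q" "\<not> p dvd r" using p q r primes_dvd_imp_eq by blast+
  have prm: "s = p \<or> s = q \<or> s = r" if "prime s" "s dvd order G" for s
    using that p(1) q r(1) unfolding o by (metis prime_dvd_mult_iff prime_dvd_power_nat primes_dvd_imp_eq)
  have "\<not> p dvd q * r" using pd p(1) prime_dvd_mult_iff by blast
  then have mp: "multiplicity p (order G) = 2"
    using multiplicity_prime_power_times[OF p(1), of "q * r" 2] by (simp add: o mult.assoc)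
  obtain P where P: "sylow_in p (carrier G) P" using sylow_in_exists[OF subgroup_self p(1)] by blast
  have sP: "subgroup P G" and cP: "card P = p ^ 2" using P mp unfolding sylow_in_def order_def by auto
  have Pc: "P \<subseteq> carrier G" using subgroup.subset[OF sP] .
  have Pab: "P \<subseteq> cent P" using abelian_order_le_p_squared[OF sP cP p(1)] by simp
  let ?N = "nzr P"
  have N: "subgroup ?N G" using nzr_subgroup[OF Pc] .
  have C: "subgroup (?N \<inter> cent P) G" using Int_subgroup[OF N cent_subgroup[OF Pc]] .
  have po: "p dvd order G" using o by simp
  have nc: "\<not> ?N \<subseteq> cent P" using sylow_not_central[OF P p(1) po] .
  \<comment> \<open>Some Sylow subgroup of the normalizer does not centralize \<open>P\<close>; as
    \<open>P\<close> is abelian, the prime in question is not \<open>p\<close>.\<close>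
  have "\<not> (\<forall>s. prime s \<longrightarrow> s dvd card ?N \<longrightarrow> (\<exists>S. sylow_in s ?N S \<and> S \<subseteq> ?N \<inter> cent P))"
    using eq_of_contains_sylows[OF N C] nc by blast
  then obtain s where s: "prime s" "s dvd card ?N" "\<And>S. sylow_in s ?N S \<Longrightarrow> \<not> S \<subseteq> cent P"
    unfolding sylow_in_def by blast
  obtain S where S: "sylow_in s ?N S" using sylow_in_exists[OF N s(1)] by blast
  have sS: "subgroup S G" "S \<subseteq> ?N" "card S = s ^ multiplicity s (card ?N)" using S unfolding sylow_in_def by auto
  have "sylow_in p ?N P" using sylow_in_mono[OF P subgroup_self N nzr_subset nzr_ge[OF sP] p(1)] .
  then have "s \<noteq> p" using s(3) Pab by blast
  moreover have "s dvd order G" using s(2) order_dvd[OF N] by (rule dvd_trans)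
  ultimately have sqr: "s = q \<or> s = r" using prm s(1) by blast
  then have sp: "s > p" using p by auto
  let ?F = "{x \<in> P. \<forall>g\<in>S. cj g x = x}"
  have F: "?F = P \<inter> cent S"
    using Pc subgroup.subset[OF sS(1)] cj_eq_iff unfolding cent_def by (auto simp: subset_iff)
  have sF: "subgroup ?F G" unfolding F using Int_subgroup[OF sP cent_subgroup[OF subgroup.subset[OF sS(1)]]] .
  have "s dvd card (P - ?F)"
    using sS(2) nzrD by (intro prime_dvd_moved_points[OF sS(1,3) s(1) Pc]) auto
  moreover have "card (P - ?F) = card P - card ?F"
    by (rule card_Diff_subset) (auto simp: sub_finite[OF sP])
  ultimately have sd: "s dvd p ^ 2 - card ?F" using cP by simp
  obtain j where j: "j \<le> 2" "card ?F = p ^ j" using card_prime_power_sub[OF sP cP p(1) sF] by blast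
  have "j \<noteq> 2"
  proof
    assume "j = 2"
    then have "?F = P" using sub_eqI[OF sF sP] j cP by auto
    then have "P \<subseteq> cent S" using F by blast
    then have "S \<subseteq> cent P" using cent_sym[OF _ subgroup.subset[OF sS(1)]] by blast
    then show False using s(3)[OF S] by blast
  qed
  moreover have "j \<noteq> 1"
  proof
    assume "j = 1"
    then have "s dvd p * (p - 1)" using sd j by (simp add: power2_eq_square diff_mult_distrib2)
    then have "s dvd p \<or> s dvd p - 1" using s(1) prime_dvd_mult_iff by blast
    then show False using sp p(1) prime_gt_1_nat[of p] by (auto dest!: dvd_imp_le)
  qed
  ultimately have "j = 0" using j by linarith
  then have "s dvd p\<^sup>2 - 1" using sd j by simp
  then have ps: "p = 2" "s = 3" using prime_dvd_sq_minus_one[OF p(1) s(1) sp] by auto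
  define t where "t = (if s = q then r else q)"
  have t: "prime t" "t \<noteq> 3" "t \<noteq> 2" "order G = 12 * t"
    using sqr q r o ps p unfolding t_def by (auto simp: mult.commute)
  have t5: "t \<ge> 5" using t(1,2,3) prime_ge_2_nat[of t] by (cases "t = 4") (auto simp: )
  have "4 dvd card ?N" using sub_dvd[OF sP N nzr_ge[OF sP]] cP ps by simp
  moreover have "3 dvd card ?N" using s(2) ps by simp
  moreover have "coprime (4::nat) 3" using coprime_Suc_left_nat[of 3] by simp
  ultimately have "4 * 3 dvd card ?N" by (rule divides_mult)
  then obtain m where m: "card ?N = 12 * m" by auto
  then have "12 * m dvd 12 * t" using order_dvd[OF N] t(4) by simp
  then have "m dvd t" by simp
  then have "m = 1 \<or> m = t" using t(1) prime_nat_iff by blast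
  moreover have "m \<noteq> t"
  proof
    assume "m = t"
    then have "?N = carrier G" using sub_eqI[OF N subgroup_self nzr_subset] m t(4) by (simp add: order_def)
    then show False using sylow_not_normal[OF P p(1) po] by blast
  qed
  ultimately have cN: "card ?N = 12" using m by simp
  have td: "t dvd order G" using t by simp
  have mt: "multiplicity t (order G) = 1"
  proof (rule multiplicity_eqI)
    show "t ^ 1 dvd order G" using td by simp
    show "\<not> t ^ Suc 1 dvd order G"
    proof
      assume "t ^ Suc 1 dvd order G"
      then have "t dvd 12" using t(1,4) by (simp add: mult.commute)
      then have "t dvd 2 * 2 * 3" by simp
      then have "t dvd 2 \<or> t dvd 3" using t(1) prime_dvd_mult_iff by blast
      then show False using t5 by (auto dest!: dvd_imp_le)
    qed
  qed
  obtain R where R: "sylow_in t (carrier G) R" using sylow_in_exists[OF subgroup_self t(1)] by blast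
  have sR: "subgroup R G" and cR: "card R = t ^ 1" using R mt unfolding sylow_in_def order_def by auto
  have "R \<subseteq> cent R" using abelian_order_le_p_squared[OF sR cR t(1)] by simp
  then have nR: "nzr R \<noteq> R" using sylow_not_central[OF R t(1) td] by auto
  have NR: "subgroup (nzr R) G" using nzr_subgroup[OF subgroup.subset[OF sR]] .
  obtain k where k: "card (nzr R) = t * k" using sub_dvd[OF sR NR nzr_ge[OF sR]] cR by auto
  have "k \<noteq> 1" using nR sub_eqI[OF sR NR nzr_ge[OF sR]] k cR by auto
  have "carrier G \<inter> nzr R = nzr R" using nzr_subset by blast
  then have "card (syls t (carrier G)) * (t * k) = 12 * t"
    using card_syls(1)[OF subgroup_self R t(1)] k t(4) by (simp add: order_def)
  \<comment> \<open>The number of Sylow \<open>t\<close>-subgroups divides 12, and it is not 12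
    because the abelian group \<open>R\<close> is not self-normalizing. Being 1 modulo a prime
    \<open>t \<ge> 5\<close>, it is 6, and \<open>t = 5\<close>.\<close>
  then have nk: "card (syls t (carrier G)) * k = 12" using t5 by (simp add: mult.left_commute mult.commute[of 12])
  define n where "n = card (syls t (carrier G))"
  have n: "n > 1" "t dvd n - 1" "n * k = 12" using sylow_count_cond[OF t(1) td] nk unfolding n_def by auto
  have "n \<le> 12" using n(3) \<open>k \<noteq> 1\<close> by (cases k) auto
  then have "n dvd 12" "n \<noteq> 12" using n \<open>k \<noteq> 1\<close> by (auto intro: dvdI[of _ _ k])
  then have "n \<in> {2,3,4,6}" using \<open>n \<le> 12\<close> n(1)
  proof -
    have "n = 2 \<or> n = 3 \<or> n = 4 \<or> n = 5 \<or> n = 6 \<or> n = 7 \<or> n = 8 \<or> n = 9 \<or> n = 10 \<or> n = 11"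
      using \<open>n \<le> 12\<close> \<open>n \<noteq> 12\<close> n(1) by presburger
    then show ?thesis using \<open>n dvd 12\<close> by (elim disjE) auto
  qed
  then have "n = 6"
    using n(2) t5 by (auto dest!: dvd_imp_le)
  then have "t dvd 5" using n(2) by simp
  then have "t = 5" using t5 by (meson dvd_imp_le le_antisym zero_less_numeral)
  then show ?thesis using t(4) N cN by auto
qed

end

context fin_group begin

lemma nsn_of_normal_in_sub:
  assumes K: "subgroup K G" and M: "M \<lhd> G\<lparr>carrier := K\<rparr>" "M \<noteq> {\<one>}" "M \<noteq> K"
  shows "nsn M"
proof -
  interpret K: fin_group "G\<lparr>carrier := K\<rparr>" by (rule sub_group[OF K])
  show ?thesis using nsn_of_sub_group[OF K] K.nsn_normal[OF M(1)] M(2,3) by simp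
qed

text \<open>Transfer modulo \<open>D\<close> yields a normal subgroup of \<open>N\<close> of this
  order. It contains \<open>D\<close>, and \<open>d < s\<close> makes it proper, so \<open>N\<close>
  normalizes it without being equal to it.\<close>

lemma relative_complement_nsn:
  assumes N: "subgroup N G" and D: "subgroup D G" "D \<subseteq> S" "N \<subseteq> nzr D" "card D = p ^ d" "d > 0"
    and S: "sylow_in p N S" "card S = p ^ s" "s \<le> d + 2" and p: "prime p"
    and sn: "N \<inter> nzr S = S" and c: "card N = p ^ s * m" and ds: "d < s"
  shows "p ^ d * m \<in> nsn_orders"
proof -
  interpret N: fin_group "G\<lparr>carrier := N\<rparr>" by (rule sub_group[OF N])
  have sS: "subgroup S G" "S \<subseteq> N" using S unfolding sylow_in_def by auto
  have "D \<lhd> G\<lparr>carrier := N\<rparr>" using normal_in_nzr[OF D(1) N] D(2,3) sS(2) by blast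
  moreover have "N.sylow_in p (carrier (G\<lparr>carrier := N\<rparr>)) S"
    using S(1) sub_iff[OF N] unfolding N.sylow_in_def sylow_in_def by simp
  moreover have "N.nzr S = S" using sub_nzr[OF N] sn by simp
  ultimately obtain M where M: "M \<lhd> G\<lparr>carrier := N\<rparr>" "D \<subseteq> M" "card M * card S = card N * card D"
    using N.relative_normal_complement[of D p S d s] p D S sub_order by metis
  have p1: "p > 1" using p prime_gt_1_nat by blast
  have "card M * p ^ s = p ^ s * m * p ^ d" using M(3) unfolding S(2) c D(4) .
  also have "\<dots> = (p ^ d * m) * p ^ s" by (simp only: mult_ac)
  finally have "card M * p ^ s = (p ^ d * m) * p ^ s" .
  moreover have "p ^ s > 0" using p1 by simp
  ultimately have cM: "card M = p ^ d * m" by (metis mult_cancel2 neq0_conv)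
  have m0: "m > 0" using c card_pos[OF N] by (metis mult_0_right neq0_conv)
  have "D \<noteq> {\<one>}" using D(4,5) p by (metis card_eq_one[OF D(1)] less_numeral_extra(3) prime_power_eq_one_iff)
  then have "M \<noteq> {\<one>}" using M(2) subgroup.one_closed[OF D(1)] by blast
  moreover have "p ^ d < p ^ s" using ds p1 by simp
  then have "card M \<noteq> card N" using cM c m0 by simp
  then have "M \<noteq> N" by blast
  ultimately have "nsn M" using nsn_of_normal_in_sub[OF N M(1)] by blast
  then show ?thesis using nsn_orderI cM by metis
qed

end

context simple_fin begin

text \<open>As \<open>p^3\<close> is not an admissible order, Sylow \<open>p\<close>-subgroups are
  self-normalizing. If two of them met nontrivially, relative transfer in a normalizer would give an
  inadmissible order \<open>p^d m\<close>. So there are \<open>q r\<close> of them with trivial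
  intersections, which leave room for only \<open>q r\<close> elements, too few for the Sylow
  \<open>r\<close>-subgroups.\<close>

lemma order_not_p3qr:
  assumes p: "prime p" "p < q" "q < r" and q: "prime q" and r: "prime r" and o: "order G = p ^ 3 * q * r"
    and d: "nsn_orders \<subseteq> {p, p ^ 2, q, r}"
  shows False
proof -
  have pd: "\<not> p dvd q" "\<not> p dvd r" "\<not> r dvd p" "\<not> r dvd q" "\<not> q dvd p" "\<not> q dvd r"
    using p q r primes_dvd_imp_eq[of p q] primes_dvd_imp_eq[of p r] primes_dvd_imp_eq[of r p]
      primes_dvd_imp_eq[of r q] primes_dvd_imp_eq[of q p] primes_dvd_imp_eq[of q r] by auto
  have p1: "p > 1" using p prime_gt_1_nat by blast
  have nqr: "\<not> p dvd q * r" using pd p(1) prime_dvd_mult_iff by blast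
  then have mp: "multiplicity p (order G) = 3"
    using multiplicity_prime_power_times[OF p(1), of "q * r" 3] by (simp add: o mult.assoc)
  have "\<not> r dvd p ^ 3 * q" using pd r prime_dvd_mult_iff prime_dvd_power_nat by blast
  then have mr: "multiplicity r (order G) = 1"
    using multiplicity_prime_power_times[OF r, of "p ^ 3 * q" 1] by (simp add: o mult.commute)
  have po: "p dvd order G" using o by simp
  have no: "x \<notin> nsn_orders" if "x = p ^ i * m" "m > 1" "m dvd q * r" "i > 0" for x i m
  proof
    assume "x \<in> nsn_orders"
    then have x: "x = p \<or> x = p ^ 2 \<or> x = q \<or> x = r" using d by blast
    have pm: "\<not> p dvd m" using that(3) nqr dvd_trans by blast
    have px: "p dvd x" using that(1,4) by simp
    then have "x = p \<or> x = p ^ 2" using x pd by blast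
    then have "x dvd p ^ 2" by (auto simp: power2_eq_square)
    moreover have "m dvd x" using that(1) by simp
    ultimately have "m dvd p ^ 2" by (rule dvd_trans[rotated])
    then obtain j where "m = p ^ j" using p divides_primepow_nat by blast
    moreover from this have "j \<noteq> 0" using that(2) by (metis less_irrefl power_0)
    ultimately show False using pm by simp
  qed
  have SN: "nzr T = T" if T: "sylow_in p (carrier G) T" for T
  proof (rule ccontr)
    assume n: "nzr T \<noteq> T"
    have sT: "subgroup T G" "card T = p ^ 3" using T mp unfolding sylow_in_def order_def by auto
    have "T \<noteq> {\<one>}" using sT p(1) by (metis card_eq_one[OF sT(1)] prime_power_eq_one_iff zero_neq_numeral)
    then have "p ^ 3 \<in> nsn_orders" using nsnI[OF sT(1) _ n] nsn_orderI sT(2) by metis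
    then have "p ^ 3 = p \<or> p ^ 3 = p ^ 2 \<or> p ^ 3 = q \<or> p ^ 3 = r" using d by blast
    moreover have "p dvd p ^ 3" by simp
    moreover have "p ^ 3 \<noteq> p ^ 1" "p ^ 3 \<noteq> p ^ 2"
      using prime_power_inj[OF p(1), of 3 1] prime_power_inj[OF p(1), of 3 2] by auto
    ultimately show False using pd by auto
  qed
  have cT: "card T = p ^ 3" "subgroup T G" if "sylow_in p (carrier G) T" for T
    using that mp unfolding sylow_in_def order_def by auto
  have cN: "\<exists>m. card N = p ^ s * m \<and> m dvd q * r" if N: "subgroup N G" "sylow_in p N S" "card S = p ^ s" for N S s
  proof -
    have "p ^ s dvd card N" using that sub_dvd[of S N] unfolding sylow_in_def by auto
    then obtain m where m: "card N = p ^ s * m" by auto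
    have "\<not> p dvd m"
    proof
      assume "p dvd m"
      then have "p ^ Suc s dvd card N" using m by (auto simp: mult.commute intro: mult_dvd_mono)
      moreover have "s = multiplicity p (card N)" using N p(1) prime_power_inj unfolding sylow_in_def by metis
      ultimately show False using card_pos[OF N(1)] p(1)
        by (metis Suc_n_not_le_n multiplicity_geI not_prime_unit less_numeral_extra(3))
    qed
    then have "coprime p m" using p(1) prime_imp_coprime by blast
    then have "coprime m (p ^ 3)" by (simp add: coprime_commute)
    moreover have "m dvd p ^ 3 * (q * r)" using order_dvd[OF N(1)] m o by (metis dvd_mult_right mult.assoc)
    ultimately have "m dvd q * r" by (simp add: coprime_dvd_mult_right_iff)
    then show ?thesis using m by blast
  qed
  \<comment> \<open>\<open>T\<close> normalizes its subgroup \<open>U\<close> of index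
    \<open>p\<close>. If the normalizer were larger, relative transfer with \<open>D = U\<close>
    would yield the order \<open>p^2 m\<close> with \<open>m > 1\<close>.\<close>
  have p2: "nzr U = T" if U: "subgroup U G" "card U = p ^ 2" and T: "sylow_in p (carrier G) T" "U \<subseteq> T" for U T
  proof (rule ccontr)
    assume ne: "nzr U \<noteq> T"
    have sN: "subgroup (nzr U) G" using nzr_subgroup[OF subgroup.subset[OF U(1)]] .
    have TN: "T \<subseteq> nzr U" using p_index_p_normalized[of T p 2 U] cT[OF T(1)] p(1) U T(2) by simp
    have TS: "sylow_in p (nzr U) T" using sylow_in_mono[OF T(1) subgroup_self sN nzr_subset TN p(1)] .
    obtain m where m: "card (nzr U) = p ^ 3 * m" "m dvd q * r" using cN[OF sN TS cT(1)[OF T(1)]] by blast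
    have "m \<noteq> 1" using ne sub_eqI[OF cT(2)[OF T(1)] sN TN] m cT(1)[OF T(1)] by auto
    moreover have "m \<noteq> 0" using m card_pos[OF sN] by auto
    ultimately have "m > 1" by simp
    have "p ^ 2 * m \<in> nsn_orders"
      by (rule relative_complement_nsn[OF sN U(1) T(2) subset_refl U(2) _ TS cT(1)[OF T(1)] _ p(1) _ m(1)])
         (use SN[OF T(1)] TN in auto)
    then show False using no[OF refl \<open>m > 1\<close> m(2), of 2] by simp
  qed
  have ti: "A \<inter> B = {\<one>}" if A: "A \<in> syls p (carrier G)" "B \<in> syls p (carrier G)" "A \<noteq> B" for A B
  proof (rule ccontr)
    assume nt: "A \<inter> B \<noteq> {\<one>}"
    \<comment> \<open>An intersection of order \<open>p^2\<close> would have a normalizer equal to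
      both Sylow subgroups.\<close>
    have meet: "card (X1 \<inter> X2) < p ^ 2" if X: "sylow_in p (carrier G) X1" "sylow_in p (carrier G) X2" "X1 \<noteq> X2" for X1 X2
    proof -
      have s: "subgroup (X1 \<inter> X2) G" using Int_subgroup cT(2) X by blast
      obtain k where k: "k \<le> 3" "card (X1 \<inter> X2) = p ^ k" using card_prime_power_sub[OF cT(2)[OF X(1)] cT(1)[OF X(1)] p(1) s] by blast
      have "k \<noteq> 3"
      proof
        assume "k = 3"
        then have "X1 \<inter> X2 = X1" "X1 \<inter> X2 = X2"
          using sub_eqI[OF s cT(2)[OF X(1)]] sub_eqI[OF s cT(2)[OF X(2)]] k cT(1)[OF X(1)] cT(1)[OF X(2)] by auto
        then show False using X(3) by simp
      qed
      moreover have "k \<noteq> 2"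
      proof
        assume "k = 2"
        then have "nzr (X1 \<inter> X2) = X1" "nzr (X1 \<inter> X2) = X2" using p2[OF s _ X(1)] p2[OF s _ X(2)] k by auto
        then show False using X(3) by simp
      qed
      ultimately have "k < 2" using k by linarith
      then show ?thesis using k p1 by simp
    qed
    define D where "D = A \<inter> B"
    have sy: "sylow_in p (carrier G) A" "sylow_in p (carrier G) B" using A unfolding syls_def by auto
    have sD: "subgroup D G" unfolding D_def using Int_subgroup cT(2) sy by blast
    have Dc: "D \<subseteq> carrier G" using subgroup.subset[OF sD] .
    obtain k where k: "k \<le> 3" "card D = p ^ k" using card_prime_power_sub[OF cT(2)[OF sy(1)] cT(1)[OF sy(1)] p(1) sD] D_def by blast
    have "p ^ k < p ^ 2" using meet[OF sy A(3)] k unfolding D_def by simp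
    then have "k < 2" using p1 by simp
    moreover have "k \<noteq> 0" using nt k card_eq_one[OF sD] unfolding D_def by auto
    ultimately have cD: "card D = p ^ 1" using k by (metis One_nat_def less_2_cases)
    let ?N = "nzr D"
    have sN: "subgroup ?N G" using nzr_subgroup[OF Dc] .
    have grow: "subgroup (X1 \<inter> ?N) G" "p ^ 2 \<le> card (X1 \<inter> ?N)" "\<exists>j. card (X1 \<inter> ?N) = p ^ j"
      if X: "sylow_in p (carrier G) X1" "D \<subseteq> X1" for X1
    proof -
      show s: "subgroup (X1 \<inter> ?N) G" using Int_subgroup[OF cT(2)[OF X(1)] sN] .
      have "p ^ Suc 1 dvd card (X1 \<inter> ?N)"
        using dvd_card_nzr[OF cT(2)[OF X(1)] sD X(2) cD p(1)] cT(1)[OF X(1)] by (simp add: le_imp_power_dvd del: power_Suc)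
      then have "p ^ Suc 1 \<le> card (X1 \<inter> ?N)" by (rule dvd_imp_le) (rule card_pos[OF s])
      then show "p ^ 2 \<le> card (X1 \<inter> ?N)" by (simp add: power2_eq_square)
      show "\<exists>j. card (X1 \<inter> ?N) = p ^ j"
        using sub_dvd[OF s cT(2)[OF X(1)]] cT(1)[OF X(1)] p(1) divides_primepow_nat by (metis inf_le1)
    qed
    have DA: "D \<subseteq> A" "D \<subseteq> B" unfolding D_def by auto
    obtain j where j: "card (A \<inter> ?N) = p ^ j" using grow(3)[OF sy(1) DA(1)] by blast
    obtain S where S: "sylow_in p ?N S" "A \<inter> ?N \<subseteq> S" using sylow_in_over[OF sN p(1) grow(1)[OF sy(1) DA(1)] _ j] by blast
    have sS: "subgroup S G" "S \<subseteq> ?N" using S unfolding sylow_in_def by auto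
    have DS: "D \<subseteq> S" using S(2) DA(1) nzr_ge[OF sD] by blast
    obtain s where s: "card S = p ^ s" using S unfolding sylow_in_def by blast
    have "p ^ 2 \<le> card S" using grow(2)[OF sy(1) DA(1)] card_mono[OF sub_finite[OF sS(1)] S(2)] by simp
    then have s2: "s \<ge> 2" using s p1 power_le_imp_le_exp by metis
    obtain T where T: "sylow_in p (carrier G) T" "S \<subseteq> T"
      using sylow_in_over[OF subgroup_self p(1) sS(1) _ s] subgroup.subset[OF sS(1)] by blast
    have "p ^ s \<le> p ^ 3" using card_mono[OF sub_finite[OF cT(2)[OF T(1)]] T(2)] s cT(1)[OF T(1)] by simp
    then have s3: "s \<le> 3" using p1 power_le_imp_le_exp by metis
    obtain m where m: "card ?N = p ^ s * m" "m dvd q * r" using cN[OF sN S(1) s] by blast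
    \<comment> \<open>Were \<open>nzr D\<close> a \<open>p\<close>-group, it would lie in
      \<open>T\<close>. Every Sylow subgroup above \<open>D\<close> has at least \<open>p^2\<close>
      elements in \<open>nzr D\<close>, so both \<open>A\<close> and \<open>B\<close> would equal
      \<open>T\<close>.\<close>
    have "m \<noteq> 1"
    proof
      assume "m = 1"
      then have "?N = S" using sub_eqI[OF sS(1) sN sS(2)] m s by simp
      then have N: "?N \<subseteq> T" using T by simp
      have "X1 = T" if X: "sylow_in p (carrier G) X1" "D \<subseteq> X1" for X1
      proof (rule ccontr)
        assume "X1 \<noteq> T"
        then have "card (X1 \<inter> T) < p ^ 2" using meet[OF X(1) T(1)] by blast
        moreover have "card (X1 \<inter> ?N) \<le> card (X1 \<inter> T)"
          using N sub_finite[OF cT(2)[OF X(1)]] by (intro card_mono) auto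
        ultimately show False using grow(2)[OF X] by simp
      qed
      then show False using sy DA A(3) by blast
    qed
    moreover have "m \<noteq> 0" using m card_pos[OF sN] by auto
    ultimately have m1: "m > 1" by simp
    \<comment> \<open>\<open>S\<close> is a Sylow subgroup of \<open>nzr D\<close> of order
      \<open>p^2\<close> or \<open>p^3\<close>, and \<open>nzr S = T\<close> in either case; the
      part of \<open>T\<close> in \<open>nzr D\<close> is no larger than \<open>S\<close>.\<close>
    have sn: "?N \<inter> nzr S = S"
    proof (cases "s = 3")
      case True
      then have "S = T" using sub_eqI[OF sS(1) cT(2)[OF T(1)] T(2)] s cT(1)[OF T(1)] by simp
      then show ?thesis using SN[OF T(1)] sS(2) by auto
    next
      case False
      then have "s = 2" using s2 s3 by simp
      then have "nzr S = T" using p2[OF sS(1) _ T] s by simp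
      moreover have "?N \<inter> T = S"
      proof (rule sym, rule card_seteq)
        have i: "subgroup (T \<inter> ?N) G" "\<exists>j. card (T \<inter> ?N) = p ^ j" using grow[OF T(1)] DS T(2) by auto
        then obtain j where j: "card (T \<inter> ?N) = p ^ j" by blast
        obtain S' where S': "sylow_in p ?N S'" "T \<inter> ?N \<subseteq> S'" using sylow_in_over[OF sN p(1) i(1) _ j] by blast
        have "card (T \<inter> ?N) \<le> card S'" using S' sub_finite unfolding sylow_in_def by (intro card_mono) auto
        then show "card (?N \<inter> T) \<le> card S" using S' S unfolding sylow_in_def by (simp add: Int_commute)
        show "finite (?N \<inter> T)" using sub_finite[OF i(1)] by (simp add: Int_commute)
        show "S \<subseteq> ?N \<inter> T" using sS(2) T(2) by blast
      qed
      ultimately show ?thesis by simp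
    qed
    have "p ^ 1 * m \<in> nsn_orders"
      by (rule relative_complement_nsn[OF sN sD DS subset_refl cD _ S(1) s _ p(1) sn m(1)]) (use s2 s3 in auto)
    then show False using no[OF refl m1 m(2), of 1] by simp
  qed
  obtain P where P: "sylow_in p (carrier G) P" using sylow_in_exists[OF subgroup_self p(1)] by blast
  have "carrier G \<inter> nzr P = P" using SN[OF P] subgroup.subset[OF cT(2)[OF P]] by blast
  then have "card (syls p (carrier G)) * p ^ 3 = (q * r) * p ^ 3"
    using card_syls(1)[OF subgroup_self P p(1)] cT(1)[OF P] o by (simp add: order_def mult_ac)
  then have cE: "card (syls p (carrier G)) = q * r" using p1 by simp
  have U: "\<Union>(syls p (carrier G)) - {\<one>} \<subseteq> carrier G" unfolding syls_def sylow_in_def by blast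
  have "card (\<Union>(syls p (carrier G)) - {\<one>}) = q * r * (p ^ 3 - 1)"
  proof -
    have "subgroup H G \<and> card H = p ^ 3" if "H \<in> syls p (carrier G)" for H using cT that unfolding syls_def by blast
    from card_TI_family[OF finite_syls[OF subgroup_self] this ti] show ?thesis using cE by simp
  qed
  moreover have "q * r * (p ^ 3 - 1) + q * r = order G"
    using p1 o by (simp add: algebra_simps diff_mult_distrib2)
  ultimately have cW: "card (carrier G - (\<Union>(syls p (carrier G)) - {\<one>})) = q * r"
    using finite_subset[OF U fin] U by (simp add: card_Diff_subset order_def)
  have ro: "r dvd order G" using o by simp
  have R: "subgroup H G \<and> card H = r" if "H \<in> syls r (carrier G)" for H
    using that mr unfolding syls_def sylow_in_def order_def by simp
  have tir: "A \<inter> B = {\<one>}" if "A \<in> syls r (carrier G)" "B \<in> syls r (carrier G)" "A \<noteq> B" for A B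
    using R[OF that(1)] R[OF that(2)] that(3) prime_order_Int[OF _ _ _ _ r] by blast
  let ?n = "card (syls r (carrier G))"
  have cR: "card (\<Union>(syls r (carrier G)) - {\<one>}) = ?n * (r - 1)"
    by (rule card_TI_family[OF finite_syls[OF subgroup_self] R tir])
  have n: "?n > 1" "r dvd ?n - 1" using sylow_count_cond[OF r ro] by auto
  then have "r \<le> ?n - 1" by (intro dvd_imp_le) auto
  then have "r + 1 \<le> ?n" using n(1) by linarith
  then have "(r + 1) * (r - 1) \<le> ?n * (r - 1)" by (rule mult_le_mono1)
  moreover have "insert \<one> (\<Union>(syls r (carrier G)) - {\<one>}) \<subseteq> carrier G - (\<Union>(syls p (carrier G)) - {\<one>})"
  proof -
    have "H \<inter> K = {\<one>}" if "H \<in> syls r (carrier G)" "K \<in> syls p (carrier G)" for H K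
    proof (rule coprime_Int)
      show "coprime (card H) (card K)" using R[OF that(1)] cT(1)[of K] that(2) r p(1) pd
        by (simp add: syls_def primes_coprime)
          (metis less_irrefl less_trans p(2,3) primes_coprime)
    qed (use R[OF that(1)] cT(2)[of K] that(2) in \<open>auto simp: syls_def\<close>)
    then show ?thesis using R subgroup.subset by fastforce
  qed
  then have "card (insert \<one> (\<Union>(syls r (carrier G)) - {\<one>})) \<le> q * r"
    using card_mono[of "carrier G - (\<Union>(syls p (carrier G)) - {\<one>})"] cW by (metis fin finite_Diff)
  moreover have "finite (\<Union>(syls r (carrier G)) - {\<one>})"
    using R sub_finite finite_syls[OF subgroup_self] by auto
  then have "card (insert \<one> (\<Union>(syls r (carrier G)) - {\<one>})) = Suc (?n * (r - 1))"
    unfolding cR[symmetric] by (rule card_insert_disjoint) simp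
  \<comment> \<open>At least \<open>r + 1\<close> Sylow \<open>r\<close>-subgroups, meeting
    trivially, must fit with the identity into the remaining \<open>q r\<close> elements. The left
    side is \<open>r^2\<close>, although \<open>q < r\<close>.\<close>
  ultimately have "(r + 1) * (r - 1) + 1 \<le> q * r" by linarith
  moreover have "(r + 1) * (r - 1) + 1 = r * r" using r prime_gt_0_nat[of r] by (cases r) auto
  ultimately have "r * r \<le> q * r" by simp
  then show False using p(3) by simp
qed

text \<open>Every prime divisor and the square of the smallest are orders. Two primes being
  excluded, these are exactly \<open>p\<close>, \<open>p^2\<close>, \<open>q'\<close>,
  \<open>r\<close>: there is no fourth prime, \<open>q'\<close> and \<open>r\<close> divide only
  once, and \<open>p^4\<close> would bring in \<open>p^3\<close>.\<close>

theorem order_60_if_few_nsn_orders: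
  assumes d: "card nsn_orders \<le> 4"
  shows "order G = 60 \<and> (\<exists>N. subgroup N G \<and> card N = 12) \<and> card nsn_orders = 4"
proof -
  have o1: "order G \<noteq> 1" using not_p_group[of 2 0] by simp
  define p where "p = (LEAST s. prime s \<and> s dvd order G)"
  have ex: "\<exists>s. prime s \<and> s dvd order G" using o1 prime_factor_nat by blast
  have p: "prime p" "p dvd order G" using LeastI_ex[OF ex] unfolding p_def by auto
  have min: "p \<le> s" if "prime s" "s dvd order G" for s unfolding p_def using that by (intro Least_le) simp
  have p1: "p > 1" using p prime_gt_1_nat by blast
  have p2: "p ^ 2 dvd order G" by (rule smallest_prime_sq_dvd[OF p min])
  have "\<exists>q. prime q \<and> q dvd order G \<and> q \<noteq> p"
    using power_of_only_prime_divisor[OF order_pos p(1)] not_p_group[OF p(1)] by blast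
  then obtain q where q: "prime q" "q dvd order G" "q \<noteq> p" by blast
  have "\<exists>r. prime r \<and> r dvd order G \<and> r \<noteq> p \<and> r \<noteq> q"
  proof (rule ccontr)
    assume c: "\<not> ?thesis"
    define a where "a = multiplicity p (order G)"
    obtain m where m: "order G = p ^ a * m" "\<not> p dvd m"
      using multiplicity_decompose'[of "order G" p] order_pos p(1) unfolding a_def by (metis not_prime_unit neq0_conv)
    have m0: "m > 0" using m(1) order_pos by (metis mult_0_right neq0_conv)
    have "m = q ^ multiplicity q m"
    proof (rule power_of_only_prime_divisor[OF m0 q(1)])
      fix s assume s: "prime s" "s dvd m"
      then have "s dvd order G" using m(1) by (metis dvd_mult)
      moreover have "s \<noteq> p" using s m(2) by blast
      ultimately show "s = q" using c s(1) by blast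
    qed
    then obtain b where b: "order G = p ^ a * q ^ b" using m(1) by metis
    have "a > 0" using b p q by (metis neq0_conv mult_1 power_0 prime_dvd_power_nat primes_dvd_imp_eq)
    moreover have "b > 0" using b p q by (metis neq0_conv mult_1_right power_0 prime_dvd_power_nat primes_dvd_imp_eq)
    moreover have "p < q" using min[OF q(1,2)] q(3) by simp
    ultimately show False using order_not_two_primes[OF p(1) q(1) _ b] d by blast
  qed
  then obtain r0 where r0: "prime r0" "r0 dvd order G" "r0 \<noteq> p" "r0 \<noteq> q" by blast
  obtain q' r where qr: "prime q'" "q' dvd order G" "prime r" "r dvd order G" "q' < r" "q' \<noteq> p" "r \<noteq> p"
    using q r0 by (metis linorder_neqE_nat)
  have pq: "p < q'" "p < r" using min[OF qr(1,2)] min[OF qr(3,4)] qr(6,7) by auto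
  have "p ^ 1 \<in> nsn_orders" "p ^ 2 \<in> nsn_orders" "q' ^ 1 \<in> nsn_orders" "r ^ 1 \<in> nsn_orders"
    by (rule nsn_orders_prime_power; use p p2 qr in simp)+
  then have sub: "{p, p ^ 2, q', r} \<subseteq> nsn_orders" by simp
  have pp: "\<not> prime (p ^ 2)" using p(1) by (simp add: prime_power_iff)
  have c4: "card {p, p ^ 2, q', r} = 4"
  proof -
    have "p ^ 2 \<noteq> q'" "p ^ 2 \<noteq> r" using pp qr by auto
    moreover have "p ^ 2 \<noteq> p" using p1 by (simp add: power2_eq_square)
    ultimately show ?thesis using pq qr(5) by auto
  qed
  have eq: "nsn_orders = {p, p ^ 2, q', r}"
    using card_seteq[OF finite_nsn_orders sub] d c4 by simp
  have prm: "s = p \<or> s = q' \<or> s = r" if s: "prime s" "s dvd order G" for s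
  proof -
    have "s ^ 1 \<in> nsn_orders" by (rule nsn_orders_prime_power) (use s in auto)
    then show ?thesis using eq pp s by auto
  qed
  have sq: "\<not> s ^ 2 dvd order G" if s: "prime s" "s \<noteq> p" for s
  proof
    assume "s ^ 2 dvd order G"
    then have "s ^ 2 \<in> nsn_orders" by (intro nsn_orders_prime_power) (use s in auto)
    moreover have "\<not> prime (s ^ 2)" using s(1) by (simp add: prime_power_iff)
    ultimately have "s ^ 2 = p \<or> s ^ 2 = p ^ 2" using eq qr p by auto
    then show False using \<open>\<not> prime (s ^ 2)\<close> p(1) s(2) by auto
  qed
  have p4: "\<not> p ^ 4 dvd order G"
  proof
    assume a: "p ^ 4 dvd order G"
    then have "p ^ 3 dvd order G" by (rule dvd_trans[rotated]) (rule le_imp_power_dvd, simp)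
    then have "p ^ 3 \<in> nsn_orders" using a by (intro nsn_orders_prime_power[OF p(1)]) auto
    moreover have "\<not> prime (p ^ 3)" using p(1) by (simp add: prime_power_iff)
    ultimately have "p ^ 3 = p \<or> p ^ 3 = p ^ 2" using eq qr by auto
    then show False using prime_power_inj[OF p(1), of 3 1] prime_power_inj[OF p(1), of 3 2] by auto
  qed
  define a where "a = multiplicity p (order G)"
  obtain m where m: "order G = p ^ a * m" "\<not> p dvd m"
    using multiplicity_decompose'[of "order G" p] order_pos p(1) unfolding a_def by (metis not_prime_unit neq0_conv)
  have m0: "m > 0" using m(1) order_pos by (metis mult_0_right neq0_conv)
  have a23: "a = 2 \<or> a = 3"
  proof -
    have "a \<ge> 2" unfolding a_def using p2 order_pos p(1) by (metis multiplicity_geI not_prime_unit less_numeral_extra(3))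
    moreover have "\<not> a \<ge> 4" using p4 unfolding m(1) by (metis dvd_mult2 le_imp_power_dvd)
    ultimately show ?thesis by linarith
  qed
  have dm: "s dvd m" if "prime s" "s dvd order G" "s \<noteq> p" for s
    using that m(1) p(1) by (metis prime_dvd_mult_iff prime_dvd_power_nat primes_dvd_imp_eq)
  obtain m1 where m1: "m = q' * m1" using dm[OF qr(1,2,6)] by auto
  have "\<not> q' dvd m1" using sq[OF qr(1,6)] m(1) m1 by (auto simp: power2_eq_square)
  have "r dvd m1" using dm[OF qr(3,4,7)] m1 qr(1,3,5) by (metis less_irrefl prime_dvd_mult_iff primes_dvd_imp_eq)
  then obtain m2 where m2: "m1 = r * m2" by auto
  have "\<not> r dvd m2" using sq[OF qr(3,7)] m(1) m1 m2 by (auto simp: power2_eq_square)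
  have "m2 = 1"
  proof (rule ccontr)
    assume "m2 \<noteq> 1"
    then obtain s where s: "prime s" "s dvd m2" using prime_factor_nat by blast
    have "s dvd m" using s(2) m1 m2 by simp
    then have "s \<noteq> p" "s dvd order G" using m by auto
    then have "s = q' \<or> s = r" using prm s(1) by blast
    then show False using s(2) m2 \<open>\<not> q' dvd m1\<close> \<open>\<not> r dvd m2\<close> by auto
  qed
  then have ord: "order G = p ^ a * q' * r" using m m1 m2 by simp
  from a23 show ?thesis
  proof
    assume "a = 2"
    then show ?thesis using order_p2qr[OF p(1) pq qr(1,3)] qr(5) ord eq c4 by auto
  next
    assume "a = 3"
    then show ?thesis using order_not_p3qr[OF p(1) pq(1) qr(5,1,3)] ord eq by auto
  qed
qed

end

section \<open>Permutation representations and the recognition of A5\<close>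

lemma (in fin_group) permutation_representation:
  assumes a: "acts G E f" and E: "finite E" "card E = n"
  shows "\<exists>\<phi>. group_hom G (sym_group n) \<phi> \<and> (\<forall>g\<in>carrier G. \<phi> g = id \<longrightarrow> (\<forall>x\<in>E. f g x = x))"
proof -
  obtain e where e: "bij_betw e {1..n} E" using ex_bij_betw_nat_finite_1[OF E(1)] E(2) by blast
  define e' where "e' = inv_into {1..n} e"
  have e': "e' x \<in> {1..n}" "e (e' x) = x" if "x \<in> E" for x
    using that e unfolding e'_def by (metis bij_betw_imp_surj_on inv_into_into, metis bij_betw_inv_into_right)
  have ei: "e i \<in> E" "e' (e i) = i" if "i \<in> {1..n}" for i
    using that e unfolding e'_def by (metis bij_betwE, metis bij_betw_inv_into_left)
  define \<phi> where "\<phi> g = (\<lambda>i. if i \<in> {1..n} then e' (f g (e i)) else i)" for g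
  have fE: "f g x \<in> E" if "g \<in> carrier G" "x \<in> E" for g x using a that unfolding acts_def by blast
  have in_n: "\<phi> g i \<in> {1..n}" if "g \<in> carrier G" "i \<in> {1..n}" for g i
    using e'(1)[OF fE[OF that(1) ei(1)[OF that(2)]]] that unfolding \<phi>_def by simp
  have comp: "\<phi> (g \<otimes> h) = \<phi> g \<circ> \<phi> h" if g: "g \<in> carrier G" "h \<in> carrier G" for g h
  proof
    fix i show "\<phi> (g \<otimes> h) i = (\<phi> g \<circ> \<phi> h) i"
    proof (cases "i \<in> {1..n}")
      case True
      have "f (g \<otimes> h) (e i) = f g (f h (e i))" using a g ei[OF True] unfolding acts_def by blast
      moreover have "e (\<phi> h i) = f h (e i)" using e'(2)[OF fE[OF g(2) ei(1)[OF True]]] True unfolding \<phi>_def by simp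
      ultimately show ?thesis using in_n[OF g(2) True] True unfolding \<phi>_def by simp
    next
      case False
      then have "\<phi> g i = i" "\<phi> h i = i" "\<phi> (g \<otimes> h) i = i" unfolding \<phi>_def by auto
      then show ?thesis by simp
    qed
  qed
  have one: "\<phi> \<one> = id"
  proof
    fix i show "\<phi> \<one> i = id i" using a ei unfolding \<phi>_def acts_def by simp
  qed
  have perm: "\<phi> g permutes {1..n}" if g: "g \<in> carrier G" for g
  proof -
    have "bij (\<phi> g)"
      by (rule o_bij[of "\<phi> (inv g)"]) (use comp[of g "inv g"] comp[of "inv g" g] g one in auto)
    moreover have "\<forall>x. x \<notin> {1..n} \<longrightarrow> \<phi> g x = x" by (simp add: \<phi>_def)
    ultimately show ?thesis unfolding permutes_def bij_iff by blast
  qed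
  have "group_hom G (sym_group n) \<phi>"
    using perm comp sym_group_is_group
    by (auto simp: group_hom_def group_hom_axioms_def hom_def sym_group_def)
  moreover have "f g x = x" if "g \<in> carrier G" "\<phi> g = id" "x \<in> E" for g x
  proof -
    have "\<phi> g (e' x) = e' (f g (e (e' x)))" using e'(1)[OF that(3)] unfolding \<phi>_def by simp
    then have "e' (f g x) = e' x" using that(2) e'(2)[OF that(3)] by simp
    then show ?thesis using e'(2)[OF that(3)] e'(2)[OF fE[OF that(1,3)]] by metis
  qed
  ultimately show ?thesis by blast
qed

text \<open>Simplicity makes the action on the five cosets of \<open>N\<close> faithful. Its
  composition with the sign cannot be injective on 60 elements, so it is trivial; the image lies in
  \<open>alt_group 5\<close>, which has 60 elements too.\<close>

lemma (in simple_fin) iso_alt_group_5: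
  assumes o: "order G = 60" and N: "subgroup N G" "card N = 12"
  shows "G \<cong> alt_group 5"
proof -
  have "card (rcosets N) * 12 = 60" using lagrange[OF N(1)] N(2) o by simp
  then have c: "card (rcosets N) = 5" by simp
  have fR: "finite (rcosets N)" by (simp add: RCOSETS_def)
  have "acts G (rcosets N) (\<lambda>g C. C #> inv g)" using acts_rcosets[OF N(1) subgroup_self] by simp
  from permutation_representation[OF this fR c]
  obtain \<phi> where \<phi>: "group_hom G (sym_group 5) \<phi>"
    "\<And>g C. g \<in> carrier G \<Longrightarrow> \<phi> g = id \<Longrightarrow> C \<in> rcosets N \<Longrightarrow> C #> inv g = C" by blast
  interpret \<phi>: group_hom G "sym_group 5" \<phi> by (rule \<phi>(1))
  have "kernel G (sym_group 5) \<phi> \<noteq> carrier G"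
  proof
    assume k: "kernel G (sym_group 5) \<phi> = carrier G"
    have "carrier G \<subseteq> N"
    proof
      fix g assume g: "g \<in> carrier G"
      then have "\<phi> g = id" using k unfolding kernel_def sym_group_one by blast
      moreover have "N #> \<one> \<in> rcosets N" using rcosetsI[OF subgroup.subset[OF N(1)] one_closed] .
      ultimately have "(N #> \<one>) #> inv g = N #> \<one>" using \<phi>(2)[OF g] by blast
      then have "cj \<one> g \<in> N" using rcoset_fixed_iff[OF N(1) one_closed g] by simp
      then show "g \<in> N" using g by simp
    qed
    then have "carrier G = N" using subgroup.subset[OF N(1)] by blast
    then show False using o N(2) unfolding order_def by simp
  qed
  then have "kernel G (sym_group 5) \<phi> = {\<one>}" using simple[OF \<phi>.normal_kernel] by blast
  then have inj: "inj_on \<phi> (carrier G)" using \<phi>.inj_iff_trivial_ker by simp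
  have "sign \<circ> \<phi> \<in> hom G sign_img" using Group.hom_compose[OF \<phi>.homh sign_is_hom] .
  then interpret s: group_hom G sign_img "sign \<circ> \<phi>"
    using sign_img_is_group by (simp add: group_hom_def group_hom_axioms_def)
  have "kernel G sign_img (sign \<circ> \<phi>) \<noteq> {\<one>}"
  proof
    assume "kernel G sign_img (sign \<circ> \<phi>) = {\<one>}"
    then have i: "inj_on (sign \<circ> \<phi>) (carrier G)" using s.inj_iff_trivial_ker by blast
    have "(sign \<circ> \<phi>) ` carrier G \<subseteq> {-1, 1}" using s.hom_closed unfolding sign_img_def by auto
    then have "card (carrier G) \<le> card {-1, 1 :: int}" using card_inj_on_le[OF i] by blast
    then show False using o unfolding order_def by simp
  qed
  then have k: "kernel G sign_img (sign \<circ> \<phi>) = carrier G" using simple[OF s.normal_kernel] by blast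
  have into: "\<phi> g \<in> carrier (alt_group 5)" if "g \<in> carrier G" for g
  proof -
    have "g \<in> kernel G sign_img (sign \<circ> \<phi>)" using k that by simp
    then have "sign (\<phi> g) = (1::int)" unfolding kernel_def sign_img_def by simp
    then have "evenperm (\<phi> g)" by (metis sign_def one_neq_neg_one)
    then show ?thesis using \<phi>.hom_closed[OF that] unfolding alt_group_carrier sym_group_carrier by simp
  qed
  have "2 * card (carrier (alt_group 5)) = fact 5" by (rule alt_group_card_carrier) simp
  then have cA: "card (carrier (alt_group 5)) = 60" by (simp add: fact_numeral)
  then have "finite (carrier (alt_group 5))" by (metis card.infinite zero_neq_numeral)
  then have "\<phi> ` carrier G = carrier (alt_group 5)"
    using into card_image[OF inj] cA o unfolding order_def by (intro card_subset_eq) auto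
  moreover have "\<phi> \<in> hom G (alt_group 5)"
    using into \<phi>.hom_mult unfolding hom_def alt_group_mult sym_group_mult by auto
  ultimately have "\<phi> \<in> iso G (alt_group 5)" unfolding iso_def bij_betw_def using inj by blast
  then show ?thesis by (rule is_isoI)
qed

context fin_group begin

section \<open>Nonsolvable groups\<close>

lemma fact_class:
  assumes D: "D \<lhd> G" and T: "subgroup T (G Mod D)" and x: "x \<in> \<Union>T"
  shows "D #> x \<in> T" "x \<in> carrier G"
proof -
  interpret D: normal D G by (rule D)
  obtain t where t: "t \<in> T" "x \<in> t" using x by blast
  then have "t \<in> rcosets D" using subgroup.subset[OF T] by (auto simp: FactGroup_def)
  then obtain y where y: "y \<in> carrier G" "t = D #> y" unfolding RCOSETS_def by auto
  then have "D #> x = t" using repr_independence[OF _ y(1) D.is_subgroup] t(2) by simp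
  then show "D #> x \<in> T" using t by simp
  show "x \<in> carrier G" using t(2) y r_coset_subset_G[OF D.subset] by blast
qed

text \<open>An element normalizing \<open>T\<close> in the quotient lifts to one normalizing the
  preimage. The strict bounds on \<open>card T\<close> later separate these orders from those of
  \<open>D\<close> and of the whole group.\<close>

lemma nsn_fact:
  assumes D: "D \<lhd> G" and T: "fin_group.nsn (G Mod D) T"
  shows "nsn (\<Union>T)" "card (\<Union>T) = card T * card D" "card T > 1" "card T < order (G Mod D)"
proof -
  interpret D: normal D G by (rule D)
  interpret Q: fin_group "G Mod D" by (rule fact_fin_group[OF D])
  have sD: "subgroup D G" using D.is_subgroup .
  have sT: "subgroup T (G Mod D)" and T1: "T \<noteq> {D}" and TN: "Q.nzr T \<noteq> T" using T unfolding Q.nsn_def by auto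
  have hom: "group_hom G (G Mod D) (\<lambda>x. D #> x)"
    using D.r_coset_hom_Mod Q.is_group by (auto simp: group_hom_def group_hom_axioms_def)
  show cU: "card (\<Union>T) = card T * card D" using card_fact_union(2)[OF D sT] .
  have sU: "subgroup (\<Union>T) G" using card_fact_union(1)[OF D sT] .
  show c1: "card T > 1" using Q.card_pos[OF sT] Q.card_eq_one[OF sT] T1 by (metis One_nat_def Suc_lessI one_FactGroup)
  have "T \<noteq> carrier (G Mod D)" using TN Q.nzr_ge[OF Q.subgroup_self] Q.nzr_subset by blast
  then show "card T < order (G Mod D)"
    using subgroup.subset[OF sT] psubset_card_mono[OF Q.fin] unfolding order_def by blast
  obtain C where C: "C \<in> Q.nzr T" "C \<notin> T" using TN Q.nzr_ge[OF sT] by blast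
  then have "C \<in> carrier (G Mod D)" using Q.nzr_subset by blast
  then obtain g where g: "g \<in> carrier G" "C = D #> g" unfolding carrier_FactGroup by blast
  have "g \<in> nzr (\<Union>T)"
  proof (rule nzrI[OF sU g(1)])
    fix x assume x: "x \<in> \<Union>T"
    note fc = fact_class[OF D sT x]
    have "Q.cj C (D #> x) \<in> T" using Q.nzrD[OF C(1) fc(1)] .
    moreover have "Q.cj C (D #> x) = D #> (cj g x)"
      unfolding Q.cj_def cj_def g(2)
      using g(1) fc(2) group_hom.hom_mult[OF hom] group_hom.hom_inv[OF hom] by simp
    moreover have "cj g x \<in> D #> cj g x" using rcos_self[OF _ sD] g fc by simp
    ultimately show "cj g x \<in> \<Union>T" by auto
  qed
  moreover have "g \<notin> \<Union>T" using fact_class(1)[OF D sT] C(2) g(2) by blast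
  ultimately have "nzr (\<Union>T) \<noteq> \<Union>T" by blast
  moreover have "\<Union>T \<noteq> {\<one>}"
  proof
    assume "\<Union>T = {\<one>}"
    then have "card T * card D = 1" using cU by simp
    then show False using c1 by simp
  qed
  ultimately show "nsn (\<Union>T)" using nsnI[OF sU] by blast
qed

text \<open>A term of least order in the derived series equals its own derived subgroup.\<close>

lemma perfect_residual:
  assumes "\<not> solvable G"
  shows "\<exists>R. R \<lhd> G \<and> R \<noteq> {\<one>} \<and> derived G R = R"
proof -
  let ?d = "\<lambda>n. (derived G ^^ n) (carrier G)"
  have sub: "subgroup (?d n) G" for n using exp_of_derived_is_subgroup[OF subgroup_self] .
  have nz: "nzr (?d n) = carrier G" for n
  proof (induction n)
    case 0 then show ?case using nzr_ge[OF subgroup_self] nzr_subset by auto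
  next
    case (Suc n)
    then show ?case using nzr_derived[OF subgroup.subset[OF sub], of n] nzr_subset by auto
  qed
  define n where "n = (ARG_MIN (\<lambda>n. card (?d n)) n. True)"
  have min: "card (?d n) \<le> card (?d m)" for m
    unfolding n_def by (rule arg_min_nat_le) simp
  have "derived G (?d n) \<subseteq> ?d n" using derived_incl[OF subset_refl sub] .
  then have "derived G (?d n) = ?d n"
    using min[of "Suc n"] by (intro card_seteq) (auto simp: sub_finite[OF sub])
  moreover have "?d n \<noteq> {\<one>}"
    using trivial_derived_seq_imp_solvable[OF subgroup_self] assms unfolding solvable_def by blast
  ultimately show ?thesis using sub nz normal_iff_nzr by blast
qed

theorem nonsolvable_iso_alt_group_5:
  assumes ns: "\<not> solvable G" and d: "card nsn_orders \<le> 4"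
  shows "G \<cong> alt_group 5"
proof -
  obtain R where R: "R \<lhd> G" "R \<noteq> {\<one>}" "derived G R = R" using perfect_residual[OF ns] by blast
  have sR: "subgroup R G" using R(1) normal_imp_subgroup by blast
  let ?R = "G\<lparr>carrier := R\<rparr>"
  interpret R: fin_group ?R by (rule sub_group[OF sR])
  define NN where "NN = {N. N \<lhd> ?R \<and> N \<noteq> R}"
  have "{\<one>} \<in> NN" using R.one_is_normal R(2) unfolding NN_def by simp
  moreover have "finite NN"
  proof (rule finite_subset)
    show "NN \<subseteq> Pow R" unfolding NN_def using subgroup.subset[OF normal_imp_subgroup] by fastforce
  qed (simp add: sub_finite[OF sR])
  ultimately obtain N where N: "N \<in> NN" and mx: "\<And>M. M \<in> NN \<Longrightarrow> card M \<le> card N"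
    using Max_in[of "card ` NN"] Max_ge[of "card ` NN"] by (metis (no_types, lifting) empty_iff finite_imageI imageE image_eqI)
  have N': "N \<lhd> ?R" "N \<noteq> R" using N unfolding NN_def by auto
  have sN: "subgroup N ?R" using N'(1) normal_imp_subgroup by blast
  then have sN': "subgroup N G" "N \<subseteq> R" using sub_iff[OF sR] by auto
  let ?Q = "?R Mod N"
  interpret N: normal N ?R by (rule N'(1))
  interpret Q: fin_group ?Q by (rule R.fact_fin_group[OF N'(1)])
  have oQ: "order ?Q * card N = card R" using R.fact_order[OF N'(1)] by (simp add: sub_order)
  interpret Q: simple_fin ?Q
  proof
    fix K assume K: "K \<lhd> ?Q"
    have sK: "subgroup K ?Q" using K normal_imp_subgroup by blast
    note cf = R.card_fact_union[OF N'(1) sK]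
    have nK: "\<Union>K \<lhd> ?R" using N.factgroup_subgroup_union_normal[OF K] .
    have N0: "card N > 0" using card_pos[OF sN'(1)] .
    show "K = {\<one>\<^bsub>?Q\<^esub>} \<or> K = carrier ?Q"
    proof (cases "\<Union>K = R")
      case True
      then have "card K * card N = order ?Q * card N" using cf(2) oQ by metis
      then have "card K = order ?Q" using N0 by (metis less_numeral_extra(3) mult_cancel2)
      then show ?thesis using Q.sub_eqI[OF sK Q.subgroup_self subgroup.subset[OF sK]] by (simp add: order_def)
    next
      case False
      then have "card K * card N \<le> card N" using mx[of "\<Union>K"] nK cf(2) unfolding NN_def by simp
      then have "card K \<le> 1" using N0 by simp
      then have "card K = 1" using Q.card_pos[OF sK] by simp
      then show ?thesis using Q.card_eq_one[OF sK] by simp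
    qed
  next
    \<comment> \<open>An abelian quotient would put \<open>derived G R\<close>, which is
      \<open>R\<close>, inside \<open>N\<close>.\<close>
    show "\<not> carrier ?Q \<subseteq> Q.cent (carrier ?Q)"
    proof
      assume ab: "carrier ?Q \<subseteq> Q.cent (carrier ?Q)"
      have "comm x y \<in> N" if x: "x \<in> R" "y \<in> R" for x y
      proof -
        have xy: "x \<in> carrier ?R" "y \<in> carrier ?R" using x by auto
        have hom: "group_hom ?R ?Q (\<lambda>x. N #>\<^bsub>?R\<^esub> x)"
          using N.r_coset_hom_Mod Q.is_group R.is_group by (auto simp: group_hom_def group_hom_axioms_def)
        interpret h: group_hom ?R ?Q "\<lambda>x. N #>\<^bsub>?R\<^esub> x" by (rule hom)
        have c: "N #>\<^bsub>?R\<^esub> x \<in> carrier ?Q" "N #>\<^bsub>?R\<^esub> y \<in> carrier ?Q" using h.hom_closed xy by auto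
        have "N #>\<^bsub>?R\<^esub> (R.comm x y) = Q.comm (N #>\<^bsub>?R\<^esub> x) (N #>\<^bsub>?R\<^esub> y)"
          unfolding R.comm_def Q.comm_def by (simp only: h.hom_mult h.hom_inv R.m_closed R.inv_closed xy)
        also have "\<dots> = \<one>\<^bsub>?Q\<^esub>" using Q.comm_one_iff[OF c] ab c Q.centD by blast
        finally have "N #>\<^bsub>?R\<^esub> (R.comm x y) = N" by simp
        then have "R.comm x y \<in> N" using R.rcos_self[OF _ sN, of "R.comm x y"] R.comm_closed[OF xy] by simp
        moreover have "R.comm x y = comm x y" using x sR unfolding R.comm_def comm_def by simp
        ultimately show ?thesis by simp
      qed
      then have "derived G R \<subseteq> N" using derived_subset_iff[OF sN'(1) subgroup.subset[OF sR]] by blast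
      then show False using R(3) sN'(2) N'(2) by blast
    qed
  qed
  have img: "(\<lambda>k. k * card N) ` Q.nsn_orders \<subseteq> nsn_orders"
    "\<And>k. k \<in> Q.nsn_orders \<Longrightarrow> 1 < k \<and> k < order ?Q"
  proof -
    have a: "k * card N \<in> nsn_orders \<and> 1 < k \<and> k < order ?Q" if "k \<in> Q.nsn_orders" for k
    proof -
      obtain T where T: "Q.nsn T" "k = card T" using \<open>k \<in> Q.nsn_orders\<close> unfolding Q.nsn_orders_def by blast
      note t = R.nsn_fact[OF N'(1) T(1)]
      have "nsn (\<Union>T)" by (rule nsn_of_sub_group[OF sR t(1)])
      then show ?thesis using t(2-4) T(2) nsn_orderI by metis
    qed
    then show "(\<lambda>k. k * card N) ` Q.nsn_orders \<subseteq> nsn_orders"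
      "\<And>k. k \<in> Q.nsn_orders \<Longrightarrow> 1 < k \<and> k < order ?Q" by blast+
  qed
  have N0: "card N > 0" using card_pos[OF sN'(1)] .
  have ci: "card ((\<lambda>k. k * card N) ` Q.nsn_orders) = card Q.nsn_orders"
    using N0 by (intro card_image inj_onI) simp
  have "card Q.nsn_orders \<le> 4" using card_mono[OF finite_nsn_orders img(1)] ci d by simp
  from Q.order_60_if_few_nsn_orders[OF this]
  obtain L where L: "order ?Q = 60" "subgroup L ?Q" "card L = 12" "card Q.nsn_orders = 4" by blast
  have iso: "?Q \<cong> alt_group 5" by (rule Q.iso_alt_group_5[OF L(1,2,3)])
  \<comment> \<open>The scaled orders from the quotient already number four, so every order in
    \<open>G\<close> is one of them.\<close>
  have notin: "x \<in> (\<lambda>k. k * card N) ` Q.nsn_orders" if "x \<in> nsn_orders" for x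
  proof (rule ccontr)
    assume "x \<notin> (\<lambda>k. k * card N) ` Q.nsn_orders"
    then have "card (insert x ((\<lambda>k. k * card N) ` Q.nsn_orders)) = 5" using ci L(4) by simp
    moreover have "insert x ((\<lambda>k. k * card N) ` Q.nsn_orders) \<subseteq> nsn_orders" using img(1) that by blast
    ultimately have "5 \<le> card nsn_orders" using card_mono[OF finite_nsn_orders] by metis
    then show False using d by simp
  qed
  \<comment> \<open>Otherwise \<open>card N = k * card N\<close> with \<open>k > 1\<close>. In the
    same way a proper \<open>R\<close> would need \<open>k = order ?Q\<close>, which the other bound
    excludes.\<close>
  have N1: "N = {\<one>}"
  proof (rule ccontr)
    assume "N \<noteq> {\<one>}"
    then have "nsn N" using nsn_of_normal_in_sub[OF sR N'(1) _ N'(2)] by blast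
    then obtain k where "k \<in> Q.nsn_orders" "card N = k * card N" using notin nsn_orderI by blast
    then show False using img(2) N0 by (metis less_irrefl mult_cancel2 mult_1 neq0_conv)
  qed
  have RG: "R = carrier G"
  proof (rule ccontr)
    assume "R \<noteq> carrier G"
    then have "nsn R" using nsn_normal[OF R(1,2)] by blast
    then obtain k where "k \<in> Q.nsn_orders" "card R = k * card N" using notin nsn_orderI by blast
    then show False using img(2) N0 oQ by (metis less_irrefl mult_cancel2 neq0_conv)
  qed
  have "G Mod {\<one>} \<cong> alt_group 5" using iso N1 RG by simp
  moreover have "G Mod {\<one>} \<cong> G" using trivial_factor_iso is_isoI by blast
  then have "G \<cong> G Mod {\<one>}"
    using group.iso_sym[OF normal.factorgroup_is_group[OF one_is_normal]] by blast
  ultimately show ?thesis using iso_trans by blast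
qed

lemma D_count_eq: "D_count G = card (subgroup_conj_class G ` {H. nsn H})"
proof -
  have "subgroup H G \<and> H \<noteq> {\<one>} \<and> normalizer G H \<noteq> H \<longleftrightarrow> nsn H" for H
    unfolding nsn_def using normalizer_eq by blast
  then have "{subgroup_conj_class G H | H. subgroup H G \<and> H \<noteq> {\<one>} \<and> normalizer G H \<noteq> H}
      = subgroup_conj_class G ` {H. nsn H}" by auto
  then show ?thesis unfolding D_count_def by simp
qed

lemma card_in_conj_class: "H \<subseteq> carrier G \<Longrightarrow> K \<in> subgroup_conj_class G H \<Longrightarrow> card K = card H"
  unfolding conj_class_eq using cjs_card by blast

lemma self_in_conj_class: "H \<subseteq> carrier G \<Longrightarrow> H \<in> subgroup_conj_class G H"
  unfolding conj_class_eq using cjs_one one_closed by (metis imageI)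

text \<open>The minimum over a class picks out the common order of its members, which turns classes
  into orders by a function.\<close>

lemma nsn_orders_le_D_count: "card nsn_orders \<le> D_count G"
proof -
  have "nsn_orders = (\<lambda>c. Min (card ` c)) ` (subgroup_conj_class G ` {H. nsn H})"
  proof -
    have "card ` subgroup_conj_class G H = {card H}" if "nsn H" for H
    proof -
      have "H \<subseteq> carrier G" using that subgroup.subset unfolding nsn_def by blast
      then show ?thesis using card_in_conj_class self_in_conj_class by blast
    qed
    then show ?thesis unfolding nsn_orders_def by (auto simp: image_image intro!: image_cong)
  qed
  then show ?thesis unfolding D_count_eq using finite_nsn by (simp add: card_image_le)
qed

end

lemma eq_of_card_le_one: "finite A \<Longrightarrow> card A \<le> Suc 0 \<Longrightarrow> a \<in> A \<Longrightarrow> b \<in> A \<Longrightarrow> a = b"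
  by (simp add: card_le_Suc0_iff_eq)

context fin_group begin

lemma nsn_subset: "nsn H \<Longrightarrow> H \<subseteq> carrier G"
  unfolding nsn_def using subgroup.subset by blast

lemma conj_class_eqD:
  assumes H: "H \<subseteq> carrier G" and e: "subgroup_conj_class G H = subgroup_conj_class G K" and K: "K \<subseteq> carrier G"
  shows "\<exists>g\<in>carrier G. cj g ` H = K"
proof -
  have "K \<in> subgroup_conj_class G H" using self_in_conj_class[OF K] e by simp
  then show ?thesis unfolding conj_class_eq by blast
qed

section \<open>Class counts and normal subgroups of prime index\<close>

definition ncls :: "nat \<Rightarrow> nat" where
  "ncls n = card (subgroup_conj_class G ` {H. nsn H \<and> card H = n})"

lemma finite_nsn_card: "finite {H. nsn H \<and> card H = n}"
  by (rule finite_subset[OF _ finite_nsn]) blast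

lemma ncls_sum_le:
  assumes S: "finite S"
  shows "(\<Sum>n\<in>S. ncls n) \<le> D_count G"
proof -
  have "(\<Sum>n\<in>S. ncls n) = card (\<Union>n\<in>S. subgroup_conj_class G ` {H. nsn H \<and> card H = n})"
    unfolding ncls_def
  proof (rule card_UN_disjoint[symmetric, OF S])
    show "\<forall>n\<in>S. finite (subgroup_conj_class G ` {H. nsn H \<and> card H = n})" using finite_nsn_card by blast
    show "\<forall>n\<in>S. \<forall>m\<in>S. n \<noteq> m \<longrightarrow> subgroup_conj_class G ` {H. nsn H \<and> card H = n} \<inter>
        subgroup_conj_class G ` {H. nsn H \<and> card H = m} = {}"
    proof (intro ballI impI)
      fix n m assume nm: "n \<noteq> (m::nat)"
      have False if "nsn H" "nsn K" "card H = n" "card K = m" "subgroup_conj_class G H = subgroup_conj_class G K" for H K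
        using card_in_conj_class[OF nsn_subset[OF that(1)]] self_in_conj_class[OF nsn_subset[OF that(2)]] that nm by metis
      then show "subgroup_conj_class G ` {H. nsn H \<and> card H = n} \<inter>
        subgroup_conj_class G ` {H. nsn H \<and> card H = m} = {}" by blast
    qed
  qed
  also have "\<dots> \<le> card (subgroup_conj_class G ` {H. nsn H})"
    using finite_nsn by (intro card_mono) auto
  finally show ?thesis unfolding D_count_eq .
qed

lemma ncls_pos: "n \<in> nsn_orders \<Longrightarrow> ncls n \<ge> 1"
proof -
  assume "n \<in> nsn_orders"
  then have "subgroup_conj_class G ` {H. nsn H \<and> card H = n} \<noteq> {}" unfolding nsn_orders_def by blast
  moreover have "finite (subgroup_conj_class G ` {H. nsn H \<and> card H = n})"
    using finite_nsn_card by blast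
  ultimately have "card (subgroup_conj_class G ` {H. nsn H \<and> card H = n}) > 0"
    unfolding card_gt_0_iff by (rule conjI)
  then show ?thesis unfolding ncls_def by simp
qed

text \<open>Each order in \<open>S\<close> takes up at least one class; what is left bounds the
  classes of order \<open>n\<close>.\<close>

lemma ncls_bound:
  assumes "finite S" "S \<subseteq> nsn_orders" "n \<notin> S"
  shows "ncls n + card S \<le> D_count G"
proof -
  have "card S = (\<Sum>m\<in>S. 1)" by simp
  also have "\<dots> \<le> (\<Sum>m\<in>S. ncls m)" using ncls_pos assms(2) by (intro sum_mono) blast
  finally have "ncls n + card S \<le> (\<Sum>m\<in>insert n S. ncls m)" using assms by simp
  also have "\<dots> \<le> D_count G" by (rule ncls_sum_le) (use assms in simp)
  finally show ?thesis .
qed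

lemma nsn_orders_eq:
  assumes "finite S" "S \<subseteq> nsn_orders" "card S \<ge> D_count G"
  shows "nsn_orders = S"
  using card_seteq[OF finite_nsn_orders assms(2)] nsn_orders_le_D_count assms(3) by simp

text \<open>When there are as many orders as classes, each order has a single class.\<close>

lemma nsn_conj_unique:
  assumes "finite S" "S \<subseteq> nsn_orders" "card S \<ge> D_count G" and H: "nsn H" and K: "nsn K" and c: "card H = card K"
  shows "\<exists>g\<in>carrier G. cj g ` H = K"
proof -
  let ?n = "card H"
  have S: "nsn_orders = S" by (rule nsn_orders_eq[OF assms(1,2,3)])
  have nS: "?n \<in> S" using nsn_orderI[OF H] S by simp
  have "ncls ?n + card (S - {?n}) \<le> D_count G"
    by (rule ncls_bound) (use assms in auto)
  moreover have "card (S - {?n}) = card S - 1" using nS assms(1) by simp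
  moreover have "card S > 0" using nS assms(1) card_gt_0_iff by blast
  ultimately have le: "card (subgroup_conj_class G ` {L. nsn L \<and> card L = ?n}) \<le> Suc 0"
    using assms(3) unfolding ncls_def by linarith
  have "finite (subgroup_conj_class G ` {L. nsn L \<and> card L = ?n})" using finite_nsn_card by blast
  moreover have "subgroup_conj_class G H \<in> subgroup_conj_class G ` {L. nsn L \<and> card L = ?n}"
    "subgroup_conj_class G K \<in> subgroup_conj_class G ` {L. nsn L \<and> card L = ?n}" using H K c by auto
  ultimately have "subgroup_conj_class G H = subgroup_conj_class G K"
    by (rule eq_of_card_le_one[OF _ le])
  then show ?thesis by (rule conj_class_eqD[OF nsn_subset[OF H] _ nsn_subset[OF K]])
qed

text \<open>A conjugate of \<open>x\<close> is a commutator times \<open>x\<close>.\<close>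

lemma normal_if_contains_derived:
  assumes M: "subgroup M G" "derived G (carrier G) \<subseteq> M"
  shows "M \<lhd> G"
  unfolding normal_iff_cj
proof (intro conjI ballI)
  show "subgroup M G" by (rule M(1))
  fix g x assume g: "g \<in> carrier G" and x: "x \<in> M"
  have xc: "x \<in> carrier G" using x subgroup.mem_carrier[OF M(1)] by blast
  have "comm g x \<in> M" using M(2) derived_subset_iff[OF M(1) subset_refl] g xc by blast
  moreover have "cj g x = comm g x \<otimes> x" using g xc by (simp add: comm_def cj_def m_assoc)
  ultimately show "cj g x \<in> M" using x subgroup.m_closed[OF M(1)] by simp
qed

text \<open>A proper subgroup of largest order above the derived subgroup is normal; the preimage of
  a subgroup of prime order in the quotient is larger, hence everything.\<close>

lemma normal_prime_index_exists:
  assumes "derived G (carrier G) \<noteq> carrier G"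
  obtains M s where "M \<lhd> G" "derived G (carrier G) \<subseteq> M" "prime s" "order G = s * card M"
proof -
  let ?D = "derived G (carrier G)"
  define NN where "NN = {M. subgroup M G \<and> ?D \<subseteq> M \<and> M \<noteq> carrier G}"
  have "?D \<in> NN" unfolding NN_def using derived_is_subgroup[OF subset_refl] assms by blast
  moreover have "finite NN"
    by (rule finite_subset[of _ "Pow (carrier G)"]) (auto simp: NN_def dest: subgroup.mem_carrier)
  ultimately obtain M where M: "M \<in> NN" and mx: "\<And>N. N \<in> NN \<Longrightarrow> card N \<le> card M"
    using Max_in[of "card ` NN"] Max_ge[of "card ` NN"] by (metis (no_types, lifting) empty_iff finite_imageI imageE image_eqI)
  have sM: "subgroup M G" "?D \<subseteq> M" "M \<noteq> carrier G" using M unfolding NN_def by auto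
  have nM: "M \<lhd> G" by (rule normal_if_contains_derived[OF sM(1,2)])
  have o: "order (G Mod M) * card M = order G" by (rule fact_order[OF nM])
  have "order (G Mod M) \<noteq> 1"
  proof
    assume "order (G Mod M) = 1"
    then have "card M = card (carrier G)" using o by (simp add: order_def)
    then show False using sub_eqI[OF sM(1) subgroup_self subgroup.subset[OF sM(1)]] sM(3) by blast
  qed
  then obtain s where s: "prime s" "s dvd order (G Mod M)" using prime_factor_nat by blast
  then have "s ^ 1 * card M dvd order G" using o by (metis mult_dvd_mono dvd_refl power_one_right)
  from subgroup_over_normal[OF nM s(1) this] obtain L where L: "subgroup L G" "M \<subseteq> L" "card L = s ^ 1 * card M" by blast
  have "card L > card M" using L(3) s(1) prime_gt_1_nat card_pos[OF sM(1)] by simp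
  then have "L \<notin> NN" using mx by fastforce
  then have "L = carrier G" using L sM(2) unfolding NN_def by blast
  then have "order G = s * card M" using L(3) by (simp add: order_def)
  then show ?thesis using that nM sM(2) s(1) by blast
qed

text \<open>If \<open>r^k\<close> is the full power of \<open>r\<close> in \<open>order G\<close>,
  it is the order of a Sylow subgroup \<open>R\<close> of \<open>M\<close>, and the Frattini
  argument supplies an element outside \<open>M\<close> that normalizes \<open>R\<close>.\<close>

lemma nsn_orders_prime_index:
  assumes M: "M \<lhd> G" and s: "prime s" and o: "order G = s * card M"
    and r: "prime r" "k > 0" "r ^ k dvd card M"
  shows "r ^ k \<in> nsn_orders"
proof (cases "r ^ Suc k dvd order G")
  case True then show ?thesis by (rule nsn_orders_p[OF r(1,2)])
next
  case False
  have sM: "subgroup M G" using M normal_imp_subgroup by blast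
  obtain R where R: "sylow_in r M R" using sylow_in_exists[OF sM r(1)] by blast
  have nd: "\<not> r ^ Suc k dvd card M" using False o by (metis dvd_mult)
  have "multiplicity r (card M) = k" using r(3) nd by (simp add: multiplicity_eqI)
  then have sR: "subgroup R G" "R \<subseteq> M" "card R = r ^ k" using R unfolding sylow_in_def by auto
  have Mc: "M \<noteq> carrier G"
  proof
    assume "M = carrier G"
    then have "s * card M = card M" using o unfolding order_def by metis
    then have "s = 1" using card_pos[OF sM] by simp
    then show False using s by simp
  qed
  then obtain g where g: "g \<in> carrier G" "g \<notin> M" using subgroup.subset[OF sM] by blast
  have "nzr R \<noteq> R"
  proof
    assume e: "nzr R = R"
    obtain n where n: "n \<in> M" "n \<otimes> g \<in> nzr R" using frattini[OF M R r(1) g(1)] by blast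
    then have "n \<otimes> g \<in> M" using e sR(2) by blast
    then have "inv n \<otimes> (n \<otimes> g) \<in> M" using n(1) sM by (simp add: subgroup.m_closed subgroup.m_inv_closed)
    then show False using g n(1) subgroup.mem_carrier[OF sM] by simp
  qed
  moreover have "R \<noteq> {\<one>}" using sR(3) r by (metis card_eq_one[OF sR(1)] less_irrefl prime_power_eq_one_iff)
  ultimately show ?thesis using nsnI[OF sR(1)] nsn_orderI sR(3) by metis
qed

section \<open>Commutator maps, fixed point free actions, cyclic normal subgroups\<close>

lemma comm_image_central:
  assumes P: "subgroup P G" and x: "x \<in> carrier G" and c: "\<And>g. g \<in> P \<Longrightarrow> comm x g \<in> cent P"
  shows "subgroup (comm x ` P) G" "card (comm x ` P) * card (P \<inter> cent {x}) = card P"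
proof -
  have Pc: "\<And>g. g \<in> P \<Longrightarrow> g \<in> carrier G" using subgroup.mem_carrier[OF P] .
  interpret P: fin_group "G\<lparr>carrier := P\<rparr>" by (rule sub_group[OF P])
  \<comment> \<open>Central values make the commutator map multiplicative, so its image is a
    subgroup.\<close>
  have mult: "comm x (g \<otimes> h) = comm x g \<otimes> comm x h" if "g \<in> P" "h \<in> P" for g h
  proof -
    have "comm x h \<in> cent P" using c that by blast
    then have "cj g (comm x h) = comm x h"
      using cj_eq_iff[OF Pc[OF that(1)] comm_closed[OF x Pc[OF that(2)]]] centD that(1) by metis
    then show ?thesis using comm_mult_right[OF x Pc[OF that(1)] Pc[OF that(2)]] by simp
  qed
  have "group_hom (G\<lparr>carrier := P\<rparr>) G (comm x)"
    using P.is_group is_group mult Pc x by (auto simp: group_hom_def group_hom_axioms_def hom_def)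
  from group_hom.img_is_subgroup[OF this] show "subgroup (comm x ` P) G" by simp
  have "acts (G\<lparr>carrier := P\<rparr>) (carrier G) cj" by (rule acts_cj[OF P]) (use Pc in auto)
  from P.orbit_stabilizer_count[OF this inv_closed[OF x]]
  have "card ((\<lambda>g. cj g (inv x)) ` P) * card {g \<in> P. cj g (inv x) = inv x} = card P"
    using sub_finite[OF P] by (simp add: order_def)
  moreover have "{g \<in> P. cj g (inv x) = inv x} = P \<inter> cent {x}"
  proof -
    have "cj g (inv x) = inv x \<longleftrightarrow> g \<otimes> x = x \<otimes> g" if "g \<in> P" for g
    proof -
      have gc: "g \<in> carrier G" using Pc that by blast
      have "cj g (inv x) = inv x \<longleftrightarrow> cj g x = x" unfolding cj_inv[OF gc x] using x gc by (metis cj_closed inv_inv)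
      then show ?thesis using cj_eq_iff[OF gc x] by simp
    qed
    then show ?thesis using Pc unfolding cent_def by auto
  qed
  \<comment> \<open>\<open>comm x g\<close> is \<open>x\<close> times the conjugate of
    \<open>inv x\<close> by \<open>g\<close>, so the image is a translate of an orbit, whose length
    the centralizer determines.\<close>
  moreover have "card ((\<lambda>g. cj g (inv x)) ` P) = card (comm x ` P)"
  proof -
    have "comm x ` P = (\<lambda>y. x \<otimes> y) ` ((\<lambda>g. cj g (inv x)) ` P)"
      unfolding image_image using Pc x by (intro image_cong) (auto simp: comm_def cj_def m_assoc)
    moreover have "inj_on (\<lambda>y. x \<otimes> y) ((\<lambda>g. cj g (inv x)) ` P)"
      by (rule inj_on_subset[OF inj_on_cmult[OF x]]) (use Pc x in auto)
    ultimately show ?thesis by (simp add: card_image)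
  qed
  ultimately show "card (comm x ` P) * card (P \<inter> cent {x}) = card P" by simp
qed

lemma derived_nonabelian:
  assumes A: "subgroup A G" "derived G (carrier G) \<subseteq> A" and d: "(derived G ^^ 2) (carrier G) \<noteq> {\<one>}"
  shows "\<not> A \<subseteq> cent A"
proof
  assume ab: "A \<subseteq> cent A"
  let ?D = "derived G (carrier G)"
  have sD: "subgroup ?D G" using derived_is_subgroup[OF subset_refl] .
  have Ac: "A \<subseteq> carrier G" using subgroup.subset[OF A(1)] .
  have "comm x y \<in> {\<one>}" if "x \<in> ?D" "y \<in> ?D" for x y
    using comm_one_iff[of x y] that A(2) ab centD Ac by blast
  then have "derived G ?D \<subseteq> {\<one>}" using derived_subset_iff[OF triv_subgroup subgroup.subset[OF sD]] by blast
  moreover have "\<one> \<in> derived G ?D" using subgroup.one_closed[OF derived_is_subgroup[OF subgroup.subset[OF sD]]] .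
  ultimately have "derived G ?D = {\<one>}" by blast
  then show False using d by (simp add: numeral_2_eq_2)
qed

lemma fact_comm:
  assumes N: "N \<lhd> G" and x: "x \<in> carrier G" and y: "y \<in> carrier G"
    and ab: "carrier (G Mod N) \<subseteq> fin_group.cent (G Mod N) (carrier (G Mod N))"
  shows "comm x y \<in> N"
proof -
  interpret N: normal N G by (rule N)
  interpret Q: fin_group "G Mod N" by (rule fact_fin_group[OF N])
  interpret h: group_hom G "G Mod N" "\<lambda>x. N #> x"
    using N.r_coset_hom_Mod Q.is_group is_group by (auto simp: group_hom_def group_hom_axioms_def)
  have c: "N #> x \<in> carrier (G Mod N)" "N #> y \<in> carrier (G Mod N)" using h.hom_closed x y by auto
  have "N #> (comm x y) = Q.comm (N #> x) (N #> y)"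
    unfolding comm_def Q.comm_def by (simp only: h.hom_mult h.hom_inv m_closed inv_closed x y)
  also have "\<dots> = \<one>\<^bsub>G Mod N\<^esub>" using Q.comm_one_iff[OF c] ab c Q.centD by blast
  finally have "N #> (comm x y) = N" by simp
  then show ?thesis using rcos_self[OF _ N.is_subgroup, of "comm x y"] comm_closed[OF x y] by simp
qed

text \<open>The map taking \<open>y\<close> to \<open>inv y \<otimes> cj t y\<close> is injective
  when \<open>t\<close> fixes only the identity, hence onto the finite group \<open>P\<close>; and
  \<open>t\<close> inverts all its values.\<close>

lemma fpf_involution_inverts:
  assumes P: "subgroup P G" and t: "t \<in> nzr P" "t \<otimes> t = \<one>" and f: "\<And>x. x \<in> P \<Longrightarrow> cj t x = x \<Longrightarrow> x = \<one>"
    and x: "x \<in> P"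
  shows "cj t x = inv x"
proof -
  have tc: "t \<in> carrier G" using t nzr_subset by blast
  have Pc: "\<And>g. g \<in> P \<Longrightarrow> g \<in> carrier G" using subgroup.mem_carrier[OF P] .
  have tt: "cj t (cj t y) = y" if "y \<in> carrier G" for y using cj_comp[OF tc tc that] t(2) that by simp
  define h where "h y = inv y \<otimes> cj t y" for y
  have hP: "h ` P \<subseteq> P" unfolding h_def using P nzrD[OF t(1)] by (auto simp: subgroup.m_closed subgroup.m_inv_closed)
  have "inj_on h P"
  proof
    fix a b assume a: "a \<in> P" and b: "b \<in> P" and e: "h a = h b"
    have abc: "a \<in> carrier G" "b \<in> carrier G" "cj t a \<in> carrier G" "cj t b \<in> carrier G" using a b Pc tc by auto
    have "b \<otimes> inv a \<otimes> cj t a = cj t b" using e abc unfolding h_def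
      by (metis inv_closed inv_cancel_left(2) m_assoc)
    then have "b \<otimes> inv a = cj t b \<otimes> inv (cj t a)" using abc by (metis inv_closed inv_solve_right m_closed)
    also have "\<dots> = cj t (b \<otimes> inv a)" using abc tc by (simp add: cj_mult cj_inv)
    finally have "cj t (b \<otimes> inv a) = b \<otimes> inv a" by simp
    moreover have "b \<otimes> inv a \<in> P" using a b P by (simp add: subgroup.m_closed subgroup.m_inv_closed)
    ultimately have "b \<otimes> inv a = \<one>" using f by blast
    then show "a = b" using abc by (metis inv_closed inv_inv inv_equality)
  qed
  then have "h ` P = P" using hP sub_finite[OF P] by (simp add: endo_inj_surj)
  then obtain y where y: "y \<in> P" "x = h y" using x by blast
  have yc: "y \<in> carrier G" "cj t y \<in> carrier G" using y Pc tc by auto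
  have "cj t x = inv (cj t y) \<otimes> y" unfolding y(2) h_def using yc tc tt by (simp add: cj_mult cj_inv)
  also have "\<dots> = inv x" unfolding y(2) h_def using yc by (simp add: inv_mult_group)
  finally show ?thesis .
qed

lemma fpf_involution_abelian:
  assumes P: "subgroup P G" and t: "t \<in> nzr P" "t \<otimes> t = \<one>" and f: "\<And>x. x \<in> P \<Longrightarrow> cj t x = x \<Longrightarrow> x = \<one>"
  shows "P \<subseteq> cent P"
proof
  fix x assume x: "x \<in> P"
  have tc: "t \<in> carrier G" using t nzr_subset by blast
  have Pc: "\<And>g. g \<in> P \<Longrightarrow> g \<in> carrier G" using subgroup.mem_carrier[OF P] .
  note i = fpf_involution_inverts[OF P t f]
  have "x \<otimes> y = y \<otimes> x" if y: "y \<in> P" for y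
  proof -
    have "inv (y \<otimes> x) = cj t (y \<otimes> x)" using i[of "y \<otimes> x"] x y P by (simp add: subgroup.m_closed)
    also have "\<dots> = inv y \<otimes> inv x" using i x y Pc tc by (simp add: cj_mult)
    also have "\<dots> = inv (x \<otimes> y)" using x y Pc by (simp add: inv_mult_group)
    finally show ?thesis using x y Pc by (metis inv_inv m_closed)
  qed
  then show "x \<in> cent P" unfolding cent_def using x Pc by blast
qed

text \<open>A fixed point centralizes \<open>Q\<close>, so it lies in \<open>nzr Q = Q\<close>, and
  \<open>Q\<close> meets \<open>P\<close> trivially because the orders are coprime.\<close>

lemma self_normalizing_fixes_nothing:
  assumes Q: "subgroup Q G" "card Q = s" "prime s" "nzr Q = Q"
    and P: "subgroup P G" "\<not> s dvd card P" and x: "x \<in> P" "\<And>g. g \<in> Q \<Longrightarrow> cj g x = x"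
  shows "x = \<one>"
proof -
  have xc: "x \<in> carrier G" using x subgroup.mem_carrier[OF P(1)] by blast
  have "x \<otimes> g = g \<otimes> x" if "g \<in> Q" for g
    using cj_eq_iff[OF subgroup.mem_carrier[OF Q(1) that] xc] x(2)[OF that] by simp
  then have "x \<in> cent Q" unfolding cent_def using xc by blast
  then have "x \<in> Q" using cent_le_nzr[OF Q(1)] Q(4) by blast
  moreover have "coprime (card Q) (card P)" using Q(2,3) P(2) prime_imp_coprime by blast
  then have "Q \<inter> P = {\<one>}" by (rule coprime_Int[OF Q(1) P(1)])
  ultimately show ?thesis using x(1) by blast
qed

lemma self_normalizing_prime_dvd:
  assumes Q: "subgroup Q G" "card Q = s" "prime s" "nzr Q = Q"
    and P: "subgroup P G" "\<not> s dvd card P" "Q \<subseteq> nzr P"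
  shows "s dvd card P - 1"
proof -
  have "{x \<in> P. \<forall>g\<in>Q. cj g x = x} = {\<one>}"
  proof (intro subset_antisym subsetI)
    fix x assume "x \<in> {x \<in> P. \<forall>g\<in>Q. cj g x = x}"
    then show "x \<in> {\<one>}" using self_normalizing_fixes_nothing[OF Q P(1,2), of x] by simp
  next
    fix x assume "x \<in> {\<one>}"
    then show "x \<in> {x \<in> P. \<forall>g\<in>Q. cj g x = x}"
      using subgroup.one_closed[OF P(1)] subgroup.mem_carrier[OF Q(1)] by simp
  qed
  moreover have "s dvd card (P - {x \<in> P. \<forall>g\<in>Q. cj g x = x})"
    by (rule prime_dvd_moved_points[OF Q(1) _ Q(3) subgroup.subset[OF P(1)], of 1]) (use Q(2) P(3) nzrD in auto)
  ultimately show ?thesis using subgroup.one_closed[OF P(1)] by (simp add: card_Diff_singleton)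
qed

lemma maxes_nsn:
  assumes P: "subgroup P G" "card P = p ^ Suc n" "prime p" "n > 0" and U: "U \<in> maxes p P"
  shows "nsn U" "subgroup U G" "U \<subseteq> P" "card U = p ^ n" "P \<subseteq> nzr U"
proof -
  show u: "subgroup U G" "U \<subseteq> P" "card U = p ^ n" using U maxes_iff[OF P(3,2)] by auto
  show "P \<subseteq> nzr U" by (rule p_index_p_normalized[OF P(1,2,3) u])
  have "p ^ Suc n dvd order G" using order_dvd[OF P(1)] P(2) by simp
  then show "nsn U" by (rule nsn_p[OF u(1,3) P(3,4)])
qed

lemma maxes_cj:
  assumes P: "P \<lhd> G" and g: "g \<in> carrier G" and U: "U \<in> maxes p P"
  shows "cj g ` U \<in> maxes p P"
proof -
  have sU: "subgroup U G" "U \<subseteq> P" "p * card U = card P" using U unfolding maxes_def by auto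
  have "cj g ` U \<subseteq> P" using sU(2) P g unfolding normal_iff_cj by auto
  then show ?thesis using cjs_subgroup[OF g sU(1)] cjs_card[OF g subgroup.subset[OF sU(1)]] sU(3) unfolding maxes_def by simp
qed

lemma prime_order_cyc: "subgroup P G \<Longrightarrow> card P = p \<Longrightarrow> prime p \<Longrightarrow> cyc P"
proof -
  assume P: "subgroup P G" "card P = p" "prime p"
  have "P \<noteq> {\<one>}" using P by auto
  then obtain x where x: "x \<in> P" "x \<noteq> \<one>" using subgroup.one_closed[OF P(1)] by blast
  have "P \<subseteq> H" if H: "subgroup H G" "x \<in> H" for H
  proof -
    have i: "subgroup (P \<inter> H) G" using Int_subgroup[OF P(1) H(1)] .
    have "card (P \<inter> H) dvd p" using sub_dvd[OF i P(1)] P(2) by auto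
    moreover have "card (P \<inter> H) \<noteq> 1" using card_eq_one[OF i] x H by blast
    ultimately have "card (P \<inter> H) = p" using P(3) prime_nat_iff by blast
    then have "P \<inter> H = P" using sub_eqI[OF i P(1)] P(2) by auto
    then show ?thesis by blast
  qed
  then show ?thesis unfolding cyc_def using x by blast
qed

text \<open>Conjugation sends a generator to a power of itself, and taking powers commutes, so
  commutators act trivially.\<close>

lemma derived_centralizes_cyc:
  assumes V: "V \<lhd> G" "cyc V"
  shows "derived G (carrier G) \<subseteq> cent V"
proof -
  have sV: "subgroup V G" using V normal_imp_subgroup by blast
  have Vc: "V \<subseteq> carrier G" using subgroup.subset[OF sV] .
  obtain v where v: "v \<in> V" "\<And>H. subgroup H G \<Longrightarrow> v \<in> H \<Longrightarrow> V \<subseteq> H" using V(2) unfolding cyc_def by blast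
  have vc: "v \<in> carrier G" using v Vc by blast
  have "subgroup (generate G {v}) G" using generate_is_subgroup[of "{v}"] vc by simp
  then have "V \<subseteq> generate G {v}" using v(2) generate.incl[of v "{v}"] by blast
  then have pw: "\<exists>k::int. y = v [^] k" if "y \<in> V" for y using generate_pow[OF vc] that by blast
  have cjv: "cj g v \<in> V" if "g \<in> carrier G" for g using V(1) v(1) that unfolding normal_iff_cj by blast
  have cpow: "cj g (v [^] k) = (cj g v) [^] k" if "g \<in> carrier G" for g and k :: int
    using group_hom.hom_int_pow[OF cj_hom[OF that] vc] .
  have com: "cj g (cj h v) = cj h (cj g v)" if "g \<in> carrier G" "h \<in> carrier G" for g h
  proof -
    have "cj g v \<in> V" "cj h v \<in> V" using cjv that by auto
    then obtain a b :: int where ab: "cj g v = v [^] a" "cj h v = v [^] b" using pw by metis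
    have "cj g (cj h v) = v [^] (a * b)" using ab cpow[OF that(1)] vc by (simp add: int_pow_pow)
    moreover have "cj h (cj g v) = v [^] (b * a)" using ab cpow[OF that(2)] vc by (simp add: int_pow_pow)
    ultimately show ?thesis by (simp add: mult.commute)
  qed
  have "comm g h \<in> cent V" if g: "g \<in> carrier G" and h: "h \<in> carrier G" for g h
  proof -
    \<comment> \<open>The commutator is first seen to fix the conjugate of the generator by
      \<open>h \<otimes> g\<close>. Conjugating back, and using that \<open>V\<close> is normal,
      shows that it centralizes all of \<open>V\<close>.\<close>
    have "cj (g \<otimes> h) v = cj (h \<otimes> g) v" using com[OF g h] cj_comp g h vc by simp
    moreover have "comm g h \<otimes> (h \<otimes> g) = g \<otimes> h" using g h by (simp add: comm_def m_assoc)
    ultimately have "cj (comm g h) (cj (h \<otimes> g) v) = cj (h \<otimes> g) v"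
      using cj_comp[of "comm g h" "h \<otimes> g" v] g h vc by simp
    then have "comm g h \<in> cent {cj (h \<otimes> g) v}" using cent_iff_cj[of "{cj (h \<otimes> g) v}"] g h vc by auto
    then have cc: "cj (h \<otimes> g) v \<in> cent {comm g h}" using cent_sym[of "{comm g h}" "{cj (h \<otimes> g) v}"] g h vc by auto
    have hg: "h \<otimes> g \<in> carrier G" using g h by simp
    have s: "subgroup (cent {comm g h}) G" using cent_subgroup[of "{comm g h}"] g h by simp
    have "subgroup (cj (inv (h \<otimes> g)) ` cent {comm g h}) G" using cjs_subgroup[OF inv_closed[OF hg] s] .
    moreover have "v \<in> cj (inv (h \<otimes> g)) ` cent {comm g h}" using cc cj_inv_cancel(1)[OF hg vc] by (metis imageI)
    ultimately have "V \<subseteq> cj (inv (h \<otimes> g)) ` cent {comm g h}" using v(2) by blast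
    then have "cj (h \<otimes> g) ` V \<subseteq> cj (h \<otimes> g) ` (cj (inv (h \<otimes> g)) ` cent {comm g h})" by (rule image_mono)
    moreover have "cj (h \<otimes> g) ` (cj (inv (h \<otimes> g)) ` cent {comm g h}) = cent {comm g h}"
      using cjs_inv[OF inv_closed[OF hg] subgroup.subset[OF s]] hg by simp
    moreover have "cj (h \<otimes> g) ` V = V" using V(1) hg unfolding normal_iff_nzr nzr_def by blast
    ultimately have "V \<subseteq> cent {comm g h}" by simp
    then show ?thesis using cent_sym[of V "{comm g h}"] g h by auto
  qed
  then show ?thesis using derived_subset_iff[OF cent_subgroup[OF Vc] subset_refl] by blast
qed

end

section \<open>Recognition of SL(2,3)\<close>

text \<open>
  The tuple \<open>(a, b, c, d)\<close> stands for the normal form \<open>z\<^sup>a i\<^sup>b j\<^sup>c t\<^sup>d\<close>, where \<open>i\<close> and \<open>j\<close> generate the quaternion group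
  with central involution \<open>z\<close>, and \<open>t\<close> of order 3 acts by \<open>t i = j t\<close>, \<open>t j = i j t\<close>. The three step functions
  describe right multiplication by \<open>i\<close>, \<open>j\<close> and \<open>t\<close>.
\<close>

fun stepI :: "bool \<times> bool \<times> bool \<times> nat \<Rightarrow> bool \<times> bool \<times> bool \<times> nat" where
  "stepI (a, b, c, d) =
    (if d = 0 then (a \<noteq> (c \<noteq> b), \<not> b, c, d)
     else if d = 1 then (a \<noteq> c, b, \<not> c, d)
     else (a \<noteq> b, \<not> b, \<not> c, d))"

fun stepJ :: "bool \<times> bool \<times> bool \<times> nat \<Rightarrow> bool \<times> bool \<times> bool \<times> nat" where
  "stepJ (a, b, c, d) =
    (if d = 0 then (a \<noteq> c, b, \<not> c, d)
     else if d = 1 then (a \<noteq> b, \<not> b, \<not> c, d)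
     else (a \<noteq> (c \<noteq> b), \<not> b, c, d))"

fun stepT :: "bool \<times> bool \<times> bool \<times> nat \<Rightarrow> bool \<times> bool \<times> bool \<times> nat" where
  "stepT (a, b, c, d) = (a, b, c, if d = 2 then 0 else Suc d)"

fun nf_mult :: "bool \<times> bool \<times> bool \<times> nat \<Rightarrow> bool \<times> bool \<times> bool \<times> nat \<Rightarrow> bool \<times> bool \<times> bool \<times> nat" where
  "nf_mult x (a, b, c, d) = (let
     x1 = (if a then stepI (stepI x) else x);
     x2 = (if b then stepI x1 else x1);
     x3 = (if c then stepJ x2 else x2)
   in if d = 0 then x3 else if d = 1 then stepT x3 else stepT (stepT x3))"

definition nf_list :: "(bool \<times> bool \<times> bool \<times> nat) list" where
  "nf_list = List.product [False, True] (List.product [False, True] (List.product [False, True] [0, 1, 2]))"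

text \<open>The matrices for \<open>i\<close> and \<open>j\<close> have trace 0 and determinant 1,
  so both square to minus the identity, the matrix for \<open>z\<close>; the one for
  \<open>t\<close> has trace -1 and order 3. They satisfy the relations behind the step
  functions.\<close>

fun SL23_nf :: "bool \<times> bool \<times> bool \<times> nat \<Rightarrow> int \<times> int \<times> int \<times> int" where
  "SL23_nf (a, b, c, d) =
    SL23_mult (if a then (2, 0, 0, 2) else (1, 0, 0, 1))
     (SL23_mult (if b then (0, 1, 2, 0) else (1, 0, 0, 1))
       (SL23_mult (if c then (1, 1, 1, 2) else (1, 0, 0, 1))
         (if d = 0 then (1, 0, 0, 1) else if d = 1 then (0, 1, 2, 2) else SL23_mult (0, 1, 2, 2) (0, 1, 2, 2))))"

text \<open>All 576 products are evaluated.\<close>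

lemma SL23_nf_mult:
  "\<forall>x\<in>set nf_list. \<forall>y\<in>set nf_list. SL23_mult (SL23_nf x) (SL23_nf y) = SL23_nf (nf_mult x y)"
  unfolding nf_list_def by code_simp

lemma SL23_nf_distinct: "distinct (map SL23_nf nf_list)"
  unfolding nf_list_def by code_simp

text \<open>The explicit list reduces the comparison with the solutions of the determinant equation
  to a finite check.\<close>

lemma SL23_nf_values:
  "map SL23_nf nf_list =
     [(1, 0, 0, 1), (0, 1, 2, 2), (2, 2, 1, 0), (1, 1, 1, 2), (2, 0, 1, 2), (0, 2, 1, 2),
      (0, 1, 2, 0), (2, 2, 0, 2), (1, 0, 1, 1), (1, 2, 2, 2), (1, 2, 1, 0), (1, 2, 0, 1),
      (2, 0, 0, 2), (0, 2, 1, 1), (1, 1, 2, 0), (2, 2, 2, 1), (1, 0, 2, 1), (0, 1, 2, 1),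
      (0, 2, 1, 0), (1, 1, 0, 1), (2, 0, 2, 2), (2, 1, 1, 1), (2, 1, 2, 0), (2, 1, 0, 2)]"
  unfolding nf_list_def by code_simp

lemma SL23_carrier_eq: "SL23_carrier = set (map SL23_nf nf_list)"
proof
  have r: "x \<in> {0..2} \<longleftrightarrow> x = 0 \<or> x = 1 \<or> x = 2" for x :: int by auto
  show "set (map SL23_nf nf_list) \<subseteq> SL23_carrier"
    unfolding SL23_nf_values SL23_carrier_def by simp
  show "SL23_carrier \<subseteq> set (map SL23_nf nf_list)"
  proof
    fix x assume "x \<in> SL23_carrier"
    then obtain a b c d where x: "x = (a, b, c, d)" and abcd: "a = 0 \<or> a = 1 \<or> a = 2" "b = 0 \<or> b = 1 \<or> b = 2"
        "c = 0 \<or> c = 1 \<or> c = 2" "d = 0 \<or> d = 1 \<or> d = 2" and det: "(a * d - b * c) mod 3 = 1"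
      unfolding SL23_carrier_def r by blast
    from abcd det show "x \<in> set (map SL23_nf nf_list)"
      unfolding SL23_nf_values x by (elim disjE) simp_all
  qed
qed

lemma nf_list_iff: "(a, b, c, d) \<in> set nf_list \<longleftrightarrow> d \<le> 2"
proof -
  have "d \<in> {0, 1, 2} \<longleftrightarrow> d \<le> 2" by auto
  then show ?thesis unfolding nf_list_def by (cases a; cases b; cases c) simp_all
qed

context fin_group begin

text \<open>The relations alone determine how \<open>i\<close>, \<open>j\<close> and
  \<open>t\<close> multiply a normal form from the right, so the normal forms make up a subgroup and
  hence all of \<open>G\<close>. Order 24 makes them distinct, and the matrices obey the same
  table.\<close>

lemma iso_SL23_of_relations:
  assumes c: "i \<in> carrier G" "j \<in> carrier G" "t \<in> carrier G" "z \<in> carrier G"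
    and ii: "i \<otimes> i = z" and jj: "j \<otimes> j = z" and zz: "z \<otimes> z = \<one>" and ttt: "t \<otimes> (t \<otimes> t) = \<one>"
    and ji: "j \<otimes> i = z \<otimes> (i \<otimes> j)" and ti: "t \<otimes> i = j \<otimes> t" and tj: "t \<otimes> j = i \<otimes> (j \<otimes> t)"
    and zc: "i \<otimes> z = z \<otimes> i" "j \<otimes> z = z \<otimes> j" "t \<otimes> z = z \<otimes> t"
    and gen: "\<And>H. subgroup H G \<Longrightarrow> i \<in> H \<Longrightarrow> j \<in> H \<Longrightarrow> t \<in> H \<Longrightarrow> H = carrier G"
    and o: "order G = 24"
  shows "G \<cong> SL23"
proof -
  define F where "F = (\<lambda>(a, b, c, d :: nat). (if a then z else \<one>) \<otimes> ((if b then i else \<one>) \<otimes>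
     ((if c then j else \<one>) \<otimes> (if d = 0 then \<one> else if d = 1 then t else t \<otimes> t))))"
  have tail: "x \<otimes> (y \<otimes> w) = (x \<otimes> y) \<otimes> w" if "x \<in> carrier G" "y \<in> carrier G" "w \<in> carrier G" for x y w
    using that by (simp add: m_assoc)
  \<comment> \<open>The relations with a trailing factor, so that rewriting also reaches inside
    products nested to the right.\<close>
  have r: "i \<otimes> (i \<otimes> w) = z \<otimes> w" "j \<otimes> (j \<otimes> w) = z \<otimes> w" "z \<otimes> (z \<otimes> w) = w" "t \<otimes> (t \<otimes> (t \<otimes> w)) = w"
    "j \<otimes> (i \<otimes> w) = z \<otimes> (i \<otimes> (j \<otimes> w))" "t \<otimes> (i \<otimes> w) = j \<otimes> (t \<otimes> w)" "t \<otimes> (j \<otimes> w) = i \<otimes> (j \<otimes> (t \<otimes> w))"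
    "i \<otimes> (z \<otimes> w) = z \<otimes> (i \<otimes> w)" "j \<otimes> (z \<otimes> w) = z \<otimes> (j \<otimes> w)" "t \<otimes> (z \<otimes> w) = z \<otimes> (t \<otimes> w)"
    if w: "w \<in> carrier G" for w
  proof -
    show "i \<otimes> (i \<otimes> w) = z \<otimes> w" using tail[OF c(1) c(1) w] ii by simp
    show "j \<otimes> (j \<otimes> w) = z \<otimes> w" using tail[OF c(2) c(2) w] jj by simp
    show "z \<otimes> (z \<otimes> w) = w" using tail[OF c(4) c(4) w] zz w by simp
    have "t \<otimes> (t \<otimes> (t \<otimes> w)) = (t \<otimes> (t \<otimes> t)) \<otimes> w" using c w by (simp add: m_assoc)
    then show "t \<otimes> (t \<otimes> (t \<otimes> w)) = w" using ttt w by simp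
    show "j \<otimes> (i \<otimes> w) = z \<otimes> (i \<otimes> (j \<otimes> w))" using tail[OF c(2) c(1) w] ji c w by (simp add: m_assoc)
    show "t \<otimes> (i \<otimes> w) = j \<otimes> (t \<otimes> w)" using tail[OF c(3) c(1) w] ti c w by (simp add: m_assoc)
    show "t \<otimes> (j \<otimes> w) = i \<otimes> (j \<otimes> (t \<otimes> w))" using tail[OF c(3) c(2) w] tj c w by (simp add: m_assoc)
    show "i \<otimes> (z \<otimes> w) = z \<otimes> (i \<otimes> w)" using tail[OF c(1) c(4) w] zc c w by (simp add: m_assoc)
    show "j \<otimes> (z \<otimes> w) = z \<otimes> (j \<otimes> w)" using tail[OF c(2) c(4) w] zc c w by (simp add: m_assoc)
    show "t \<otimes> (z \<otimes> w) = z \<otimes> (t \<otimes> w)" using tail[OF c(3) c(4) w] zc c w by (simp add: m_assoc)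
  qed
  note rules = r ii jj zz ttt ji ti tj zc m_assoc c
  have FC: "F x \<in> carrier G" for x unfolding F_def using c by (cases x) auto
  have FI: "F x \<otimes> i = F (stepI x) \<and> stepI x \<in> set nf_list" if "x \<in> set nf_list" for x
  proof -
    obtain a b cc d where x: "x = (a, b, cc, d)" by (cases x)
    then have "d = 0 \<or> d = 1 \<or> d = 2" using that nf_list_iff by auto
    then show ?thesis unfolding x F_def by (cases a; cases b; cases cc; elim disjE) (simp_all add: rules nf_list_iff)
  qed
  have FJ: "F x \<otimes> j = F (stepJ x) \<and> stepJ x \<in> set nf_list" if "x \<in> set nf_list" for x
  proof -
    obtain a b cc d where x: "x = (a, b, cc, d)" by (cases x)
    then have "d = 0 \<or> d = 1 \<or> d = 2" using that nf_list_iff by auto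
    then show ?thesis unfolding x F_def by (cases a; cases b; cases cc; elim disjE) (simp_all add: rules nf_list_iff)
  qed
  have FT: "F x \<otimes> t = F (stepT x) \<and> stepT x \<in> set nf_list" if "x \<in> set nf_list" for x
  proof -
    obtain a b cc d where x: "x = (a, b, cc, d)" by (cases x)
    then have "d = 0 \<or> d = 1 \<or> d = 2" using that nf_list_iff by auto
    then show ?thesis unfolding x F_def by (cases a; cases b; cases cc; elim disjE) (simp_all add: rules nf_list_iff)
  qed
  have FM: "F x \<otimes> F y = F (nf_mult x y) \<and> nf_mult x y \<in> set nf_list" if x: "x \<in> set nf_list" and y: "y \<in> set nf_list" for x y
  proof -
    obtain a b cc d where yy: "y = (a, b, cc, d)" by (cases y)
    have d: "d = 0 \<or> d = 1 \<or> d = 2" using y yy nf_list_iff by auto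
    define x1 where "x1 = (if a then stepI (stepI x) else x)"
    define x2 where "x2 = (if b then stepI x1 else x1)"
    define x3 where "x3 = (if cc then stepJ x2 else x2)"
    define x4 where "x4 = (if d = 0 then x3 else if d = 1 then stepT x3 else stepT (stepT x3))"
    have 1: "F x \<otimes> (if a then z else \<one>) = F x1" "x1 \<in> set nf_list"
    proof -
      have "F x \<otimes> z = F (stepI (stepI x))" using FI[OF x] FI[of "stepI x"] FC[of x] c
        unfolding ii[symmetric] by (simp add: m_assoc[symmetric])
      then show "F x \<otimes> (if a then z else \<one>) = F x1" unfolding x1_def using FC by simp
      show "x1 \<in> set nf_list" unfolding x1_def using FI x by simp
    qed
    have 2: "F x1 \<otimes> (if b then i else \<one>) = F x2" "x2 \<in> set nf_list"
      using FI[OF 1(2)] FC 1(2) unfolding x2_def by auto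
    have 3: "F x2 \<otimes> (if cc then j else \<one>) = F x3" "x3 \<in> set nf_list"
      using FJ[OF 2(2)] FC 2(2) unfolding x3_def by auto
    have 4: "F x3 \<otimes> (if d = 0 then \<one> else if d = 1 then t else t \<otimes> t) = F x4" "x4 \<in> set nf_list"
      using FT[OF 3(2)] FT[of "stepT x3"] FC 3(2) c unfolding x4_def by (auto simp: m_assoc[symmetric])
    have "F x \<otimes> F y = (((F x \<otimes> (if a then z else \<one>)) \<otimes> (if b then i else \<one>)) \<otimes> (if cc then j else \<one>))
       \<otimes> (if d = 0 then \<one> else if d = 1 then t else t \<otimes> t)"
      unfolding yy using FC[of x] c by (simp add: F_def[of] m_assoc split del: if_split) (simp add: m_assoc)
    also have "\<dots> = F x4" using 1 2 3 4 by simp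
    moreover have "nf_mult x y = x4" unfolding yy x4_def x3_def x2_def x1_def by (simp add: Let_def)
    ultimately show ?thesis using 4(2) by simp
  qed
  let ?H = "F ` set nf_list"
  have Hm: "a \<otimes> b \<in> ?H" if "a \<in> ?H" "b \<in> ?H" for a b using that FM by auto
  have F0: "F (False, False, False, 0) = \<one>" "F (False, True, False, 0) = i" "F (False, False, True, 0) = j" "F (False, False, False, 1) = t"
    unfolding F_def using c by auto
  have el: "\<one> \<in> ?H" "i \<in> ?H" "j \<in> ?H" "t \<in> ?H"
    using F0 nf_list_iff by (metis image_eqI le0, metis image_eqI le0, metis image_eqI le0, metis image_eqI one_le_numeral)
  have sH: "subgroup ?H G"
  proof (rule subgroupI)
    show "?H \<subseteq> carrier G" using FC by auto
    show "?H \<noteq> {}" using el(1) by (metis empty_iff)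
    show "inv a \<in> ?H" if a: "a \<in> ?H" for a
    proof -
      have ac: "a \<in> carrier G" using a FC by auto
      \<comment> \<open>Only closure under products is available; in a group of order 24 inverses
        are 23rd powers.\<close>
      have pw: "a [^] n \<in> ?H" for n :: nat by (induction n) (use el a Hm in auto)
      have "a [^] (24::nat) = \<one>" using pow_order_eq_1[OF ac] o by simp
      moreover have "a [^] Suc 23 = a [^] (23::nat) \<otimes> a" by (rule nat_pow_Suc)
      moreover have "(24::nat) = Suc 23" by simp
      ultimately have "a [^] (23::nat) \<otimes> a = \<one>" by metis
      then have "inv a = a [^] (23::nat)" using ac by (simp add: inv_equality)
      then show ?thesis using pw by metis
    qed
    show "\<And>a b. a \<in> ?H \<Longrightarrow> b \<in> ?H \<Longrightarrow> a \<otimes> b \<in> ?H" by (rule Hm)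
  qed
  have HG: "?H = carrier G" using gen[OF sH el(2,3,4)] .
  have "distinct nf_list" using SL23_nf_distinct by (simp add: distinct_map)
  then have c24: "card (set nf_list) = 24" by (simp add: distinct_card nf_list_def)
  have injF: "inj_on F (set nf_list)"
    by (rule eq_card_imp_inj_on) (use HG o c24 in \<open>simp_all add: order_def\<close>)
  have injS: "inj_on SL23_nf (set nf_list)" using SL23_nf_distinct by (simp add: distinct_map)
  define \<phi> where "\<phi> = SL23_nf \<circ> inv_into (set nf_list) F"
  have \<phi>F: "\<phi> (F x) = SL23_nf x" if "x \<in> set nf_list" for x
    unfolding \<phi>_def using injF that by (simp add: inv_into_f_f)
  have "bij_betw (inv_into (set nf_list) F) (carrier G) (set nf_list)"
    using bij_betw_inv_into[of F "set nf_list" "carrier G"] injF HG unfolding bij_betw_def by blast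
  moreover have "bij_betw SL23_nf (set nf_list) (carrier SL23)"
    using injS SL23_carrier_eq unfolding bij_betw_def SL23_def by simp
  ultimately have "bij_betw \<phi> (carrier G) (carrier SL23)" unfolding \<phi>_def by (rule bij_betw_trans)
  moreover have "\<phi> (a \<otimes> b) = \<phi> a \<otimes>\<^bsub>SL23\<^esub> \<phi> b" if ab: "a \<in> carrier G" "b \<in> carrier G" for a b
  proof -
    obtain x y where xy: "x \<in> set nf_list" "a = F x" "y \<in> set nf_list" "b = F y" using ab HG by blast
    have "\<phi> (a \<otimes> b) = SL23_nf (nf_mult x y)" using FM[OF xy(1,3)] \<phi>F xy by simp
    also have "\<dots> = SL23_mult (SL23_nf x) (SL23_nf y)" using SL23_nf_mult xy by simp
    finally show ?thesis using \<phi>F xy by (simp add: SL23_def)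
  qed
  ultimately have "\<phi> \<in> iso G SL23" unfolding iso_def hom_def bij_betw_def by blast
  then show ?thesis by (rule is_isoI)
qed

text \<open>A centre of index \<open>p\<close> would make \<open>P\<close> abelian, so it has order
  \<open>p\<close>. Maximal subgroups have order \<open>p^2\<close>, contain the centre and pairwise
  meet in it; counting the noncentral elements, \<open>p^3 - p = (p + 1) (p^2 - p)\<close>.\<close>

lemma nonabelian_p_cubed:
  assumes P: "subgroup P G" "card P = p ^ 3" "prime p" and na: "\<not> P \<subseteq> cent P"
  shows "card (P \<inter> cent P) = p" "\<And>U. U \<in> maxes p P \<Longrightarrow> P \<inter> cent P \<subseteq> U"
    "\<And>U V. U \<in> maxes p P \<Longrightarrow> V \<in> maxes p P \<Longrightarrow> U \<noteq> V \<Longrightarrow> U \<inter> V = P \<inter> cent P"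
    "card (maxes p P) = p + 1"
proof -
  let ?Z = "P \<inter> cent P"
  have Pc: "P \<subseteq> carrier G" using subgroup.subset[OF P(1)] .
  have p1: "p > 1" using P(3) prime_gt_1_nat by blast
  have P3: "card P = p ^ Suc 2" using P(2) by simp
  have nc: "\<not> cyc P" using cyc_abelian[OF P(1)] na by blast
  have Z: "subgroup ?Z G" using Int_subgroup[OF P(1) cent_subgroup[OF Pc]] .
  obtain x where x: "x \<in> P" "x \<noteq> \<one>" "\<forall>g\<in>P. cj g x = x"
    using p_group_fixes_nontrivial[OF P(1,2,3) P(1) _ nzr_ge[OF P(1)]] P(2) by auto
  have "g \<otimes> x = x \<otimes> g" if "g \<in> P" for g using x(3,1) cj_eq_iff Pc that by blast
  then have xZ: "x \<in> ?Z" using x Pc unfolding cent_def by auto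
  obtain j where j: "j \<le> 3" "card ?Z = p ^ j" using card_prime_power_sub[OF P(1,2,3) Z] by auto
  have "j \<noteq> 0" using j xZ x card_eq_one[OF Z] by (metis power_0 singletonD)
  moreover have "j \<noteq> 3" using sub_eqI[OF Z P(1)] j P(2) na by auto
  moreover have "j \<noteq> 2"
  proof
    assume "j = 2"
    then have "card P = p * card ?Z" using j P(2) by (simp add: power3_eq_cube power2_eq_square)
    moreover have "?Z \<subseteq> cent P" by blast
    ultimately have "P \<subseteq> cent P" using abelian_from_prime_index[OF P(1) Z _ _ P(3)] by blast
    then show False using na by blast
  qed
  ultimately have "j = 1" using j(1) by linarith
  then show cZ: "card ?Z = p" using j by simp
  have U: "subgroup U G" "U \<subseteq> P" "card U = p ^ 2" if "U \<in> maxes p P" for U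
    using that maxes_iff[OF P(3) P3] by auto
  show ZU: "?Z \<subseteq> U" if u: "U \<in> maxes p P" for U
  proof
    fix y assume y: "y \<in> ?Z"
    show "y \<in> U"
    proof (rule ccontr)
      assume yU: "y \<notin> U"
      have Uc: "U \<subseteq> carrier G" using subgroup.subset[OF U(1)[OF u]] .
      \<comment> \<open>A central element outside the abelian group \<open>U\<close> would enlarge
        the centralizer of \<open>U\<close> to all of \<open>P\<close>; then \<open>U\<close> would
        be central, although it is larger than the centre.\<close>
      let ?C = "P \<inter> cent U"
      have C: "subgroup ?C G" using Int_subgroup[OF P(1) cent_subgroup[OF Uc]] .
      have "U \<subseteq> cent U" using abelian_order_le_p_squared[OF U(1,3)[OF u] P(3)] by simp
      then have UC: "U \<subseteq> ?C" using U(2)[OF u] by blast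
      have yC: "y \<in> ?C" using y cent_mono[OF U(2)[OF u]] by blast
      obtain k where k: "k \<le> 3" "card ?C = p ^ k" using card_prime_power_sub[OF P(1,2,3) C] by auto
      have "card U < card ?C" using psubset_card_mono[OF sub_finite[OF C], of U] UC yC yU by blast
      then have "k > 2" using k U(3)[OF u] p1 by simp
      then have "k = 3" using k by linarith
      then have "?C = P" using sub_eqI[OF C P(1)] k P(2) by simp
      then have "U \<subseteq> ?Z" using cent_sym[of P U] Uc U(2)[OF u] by blast
      then have "p ^ 2 \<le> p" using card_mono[OF sub_finite[OF Z]] cZ U(3)[OF u] by metis
      then show False using p1 by (simp add: power2_eq_square)
    qed
  qed
  show UV: "U \<inter> V = ?Z" if u: "U \<in> maxes p P" "V \<in> maxes p P" "U \<noteq> V" for U V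
  proof -
    have i: "subgroup (U \<inter> V) G" using Int_subgroup U(1) u by blast
    obtain k where k: "k \<le> 2" "card (U \<inter> V) = p ^ k" using card_prime_power_sub[OF U(1)[OF u(1)] U(3)[OF u(1)] P(3) i] by auto
    have "k \<noteq> 2"
    proof
      assume "k = 2"
      then have "U \<inter> V = U" "U \<inter> V = V"
        using sub_eqI[OF i U(1)[OF u(1)]] sub_eqI[OF i U(1)[OF u(2)]] k U(3) u by auto
      then show False using u(3) by simp
    qed
    then have "k \<le> 1" using k by linarith
    then have "card (U \<inter> V) \<le> p ^ 1" using k power_increasing[of k 1 p] p1 by simp
    then show ?thesis using card_seteq[OF sub_finite[OF i], of ?Z] ZU[OF u(1)] ZU[OF u(2)] cZ by auto
  qed
  have fin: "finite (maxes p P)" by (rule finite_maxes[OF P(1)])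
  have un: "P - ?Z = (\<Union>U\<in>maxes p P. U - ?Z)"
    using element_in_maximal[OF P(1) P3 P(3) nc] U(2) by blast
  have "card (P - ?Z) = card (\<Union>U\<in>maxes p P. U - ?Z)" by (rule arg_cong[OF un])
  also have "\<dots> = (\<Sum>U\<in>maxes p P. card (U - ?Z))"
  proof (rule card_UN_disjoint[OF fin])
    show "\<forall>U\<in>maxes p P. finite (U - ?Z)" using sub_finite[OF U(1)] by blast
    show "\<forall>U\<in>maxes p P. \<forall>V\<in>maxes p P. U \<noteq> V \<longrightarrow> (U - ?Z) \<inter> (V - ?Z) = {}" using UV by blast
  qed
  also have "\<dots> = (\<Sum>U\<in>maxes p P. p ^ 2 - p)"
  proof (rule sum.cong[OF refl])
    fix U assume u: "U \<in> maxes p P"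
    show "card (U - ?Z) = p ^ 2 - p"
      using card_Diff_subset[OF sub_finite[OF Z] ZU[OF u]] U(3)[OF u] cZ by simp
  qed
  finally have "card (P - ?Z) = card (maxes p P) * (p ^ 2 - p)" by simp
  moreover have "card (P - ?Z) = p ^ 3 - p" using card_Diff_subset[OF sub_finite[OF Z]] P(2) cZ by simp
  moreover have "p ^ 3 - p = (p + 1) * (p ^ 2 - p)"
    by (simp add: power3_eq_cube power2_eq_square algebra_simps)
  moreover have "p ^ 2 - p > 0" using p1 by (simp add: power2_eq_square)
  ultimately show "card (maxes p P) = p + 1" by (metis mult_cancel2 neq0_conv)
qed

text \<open>Conjugacy of the maximal subgroups makes every noncentral element of \<open>P\<close>
  square to the central involution \<open>z\<close>, so \<open>P\<close> is the quaternion group. An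
  element \<open>t\<close> of order 3 permutes the three maximal subgroups cyclically, and a
  suitable \<open>i\<close> with \<open>j = cj t i\<close> satisfies the relations.\<close>

lemma iso_SL23:
  assumes o: "order G = 24" and P: "P \<lhd> G" "card P = 8" and na: "\<not> P \<subseteq> cent P"
    and conj: "\<And>U V. U \<in> maxes 2 P \<Longrightarrow> V \<in> maxes 2 P \<Longrightarrow> \<exists>g\<in>carrier G. cj g ` U = V"
  shows "G \<cong> SL23"
proof -
  have sP: "subgroup P G" and nP: "nzr P = carrier G" using P(1) normal_iff_nzr by auto
  have Pc: "\<And>x. x \<in> P \<Longrightarrow> x \<in> carrier G" using subgroup.mem_carrier[OF sP] .
  have c3: "card P = 2 ^ 3" "card P = 2 ^ Suc 2" using P(2) by simp_all
  have two: "prime (2::nat)" and three: "prime (3::nat)" by simp_all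
  let ?Z = "P \<inter> cent P"
  note pc = nonabelian_p_cubed[OF sP c3(1) two na]
  have Z: "subgroup ?Z G" using Int_subgroup[OF sP cent_subgroup[OF subgroup.subset[OF sP]]] .
  have nZ: "cj g x \<in> ?Z" if "g \<in> carrier G" "x \<in> ?Z" for g x
    using nzrD[of g P x] nzrD[of g "cent P" x] nzr_cent[OF subgroup.subset[OF sP]] nP that by blast
  have "card (?Z - {\<one>}) = 1" using pc(1) subgroup.one_closed[OF Z] by (simp add: card_Diff_singleton)
  then obtain z where z: "?Z - {\<one>} = {z}" by (metis card_1_singletonE)
  then have zz: "z \<in> ?Z" "z \<noteq> \<one>" "?Z = {\<one>, z}" using subgroup.one_closed[OF Z] by auto
  have zc: "z \<in> carrier G" using zz Pc by blast
  have cz: "cj g z = z" if g: "g \<in> carrier G" for g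
  proof -
    have "cj g z \<in> ?Z" using nZ[OF g zz(1)] .
    moreover have "cj g z \<noteq> \<one>" using cj_inv_cancel(1)[OF g zc] zz(2) g by (metis cj_one_right inv_closed)
    ultimately show ?thesis using zz(3) by blast
  qed
  have zcomm: "g \<otimes> z = z \<otimes> g" if "g \<in> carrier G" for g using cz[OF that] cj_eq_iff[OF that zc] by simp
  have z2: "z \<otimes> z = \<one>"
  proof -
    have "z \<otimes> z \<in> ?Z" using subgroup.m_closed[OF Z] zz(1) by blast
    moreover have "z \<otimes> z \<noteq> z" using zz(2) zc by simp
    ultimately show ?thesis using zz(3) by blast
  qed
  have iz: "inv z = z" using z2 zc by (simp add: inv_equality)
  have U: "subgroup U G" "U \<subseteq> P" "card U = 4" if "U \<in> maxes 2 P" for U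
    using that maxes_iff[OF two c3(2)] by auto
  have "\<exists>x\<in>P. x \<otimes> x \<noteq> \<one>"
  proof (rule ccontr)
    assume c: "\<not> ?thesis"
    have iv: "inv x = x" if "x \<in> P" for x using c that Pc by (metis inv_equality)
    have "x \<otimes> y = y \<otimes> x" if "x \<in> P" "y \<in> P" for x y
    proof -
      have "x \<otimes> y = inv (x \<otimes> y)" using iv[of "x \<otimes> y"] subgroup.m_closed[OF sP that] by simp
      also have "\<dots> = inv y \<otimes> inv x" using that Pc by (simp add: inv_mult_group)
      finally show ?thesis using iv that by simp
    qed
    then have "P \<subseteq> cent P" unfolding cent_def using Pc by blast
    then show False using na by blast
  qed
  then obtain x where x: "x \<in> P" "x \<otimes> x \<noteq> \<one>" by blast
  have nc: "\<not> cyc P" using cyc_abelian[OF sP] na by blast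
  obtain U0 where U0: "U0 \<in> maxes 2 P" "x \<in> U0" using element_in_maximal[OF sP c3(2) two nc x(1)] by blast
  have elts: "U1 = {\<one>, z, y, z \<otimes> y}" if u: "U1 \<in> maxes 2 P" "y \<in> U1" "y \<notin> ?Z" for U1 y
  proof -
    have yc: "y \<in> carrier G" using u U(2) Pc by blast
    have zU: "z \<in> U1" using pc(2)[OF u(1)] zz(1) by blast
    have "y \<noteq> \<one>" "y \<noteq> z" using u(3) zz(3) by auto
    moreover have "z \<otimes> y \<noteq> y" "z \<otimes> y \<noteq> z" using yc zc zz(2) \<open>y \<noteq> \<one>\<close> by simp_all
    moreover have "z \<otimes> y \<noteq> \<one>" using \<open>y \<noteq> z\<close> yc zc iz by (metis inv_equality inv_inv)
    ultimately have "card {\<one>, z, y, z \<otimes> y} = 4" using zz(2) by auto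
    moreover have "{\<one>, z, y, z \<otimes> y} \<subseteq> U1"
      using zU u(2) subgroup.one_closed[OF U(1)[OF u(1)]] subgroup.m_closed[OF U(1)[OF u(1)]] by auto
    ultimately show ?thesis using card_subset_eq[OF sub_finite[OF U(1)[OF u(1)]], of "{\<one>, z, y, z \<otimes> y}"] U(3)[OF u(1)] by simp
  qed
  have xZ: "x \<notin> ?Z" using x(2) z2 zz(3) by auto
  have xc: "x \<in> carrier G" using Pc x by blast
  have xx: "x \<otimes> x = z"
  proof -
    have "x \<otimes> x \<in> U0" using subgroup.m_closed[OF U(1)[OF U0(1)] U0(2) U0(2)] .
    then have "x \<otimes> x \<in> {\<one>, z, x, z \<otimes> x}" using elts[OF U0 xZ] by simp
    moreover have "x \<otimes> x \<noteq> x" using xZ xc zz(3) by auto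
    moreover have "x \<otimes> x \<noteq> z \<otimes> x" using xZ xc zc zz(3) by auto
    ultimately show ?thesis using x(2) by blast
  qed
  have sq0: "y \<otimes> y = z" if "y \<in> U0" "y \<notin> ?Z" for y
  proof -
    have "y = x \<or> y = z \<otimes> x" using elts[OF U0 xZ] that zz(3) by blast
    moreover have "(z \<otimes> x) \<otimes> (z \<otimes> x) = z"
    proof -
      have "(z \<otimes> x) \<otimes> (z \<otimes> x) = z \<otimes> ((x \<otimes> z) \<otimes> x)" using zc xc by (simp add: m_assoc)
      also have "\<dots> = (z \<otimes> z) \<otimes> (x \<otimes> x)" using zcomm[OF xc] zc xc by (simp add: m_assoc)
      finally show ?thesis using z2 xx zc by simp
    qed
    ultimately show ?thesis using xx by blast
  qed
  \<comment> \<open>Conjugation carries \<open>U0\<close> to a maximal subgroup through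
    \<open>y\<close> and fixes \<open>z\<close>.\<close>
  have sq: "y \<otimes> y = z" if y: "y \<in> P" "y \<notin> ?Z" for y
  proof -
    obtain V where V: "V \<in> maxes 2 P" "y \<in> V" using element_in_maximal[OF sP c3(2) two nc y(1)] by blast
    obtain g where g: "g \<in> carrier G" "cj g ` U0 = V" using conj[OF U0(1) V(1)] by blast
    then obtain y0 where y0: "y0 \<in> U0" "y = cj g y0" using V(2) by blast
    have "y0 \<notin> ?Z" using nZ[OF g(1)] y0 y(2) by blast
    then have "y0 \<otimes> y0 = z" using sq0 y0 by blast
    moreover have "y0 \<in> carrier G" using y0 U(2)[OF U0(1)] Pc by blast
    ultimately show ?thesis using cj_mult[OF g(1)] cz[OF g(1)] y0(2) by metis
  qed
  obtain Q where Q: "subgroup Q G" "card Q = 3 ^ 1"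
    using subgroup_of_prime_power_exists[OF subgroup_self three, of 1] o by (auto simp: order_def)
  have QP: "Q \<inter> P = {\<one>}" by (rule coprime_Int[OF Q(1) sP]) (use Q(2) P(2) coprime_Suc_right_nat[of 8] in \<open>simp add: prime_imp_coprime\<close>)
  have "Q \<noteq> {\<one>}" using Q(2) by auto
  then obtain t where t: "t \<in> Q" "t \<noteq> \<one>" using subgroup.one_closed[OF Q(1)] by blast
  have tc: "t \<in> carrier G" using t subgroup.mem_carrier[OF Q(1)] by blast
  have tP: "t \<notin> P" using t QP by blast
  interpret Q: fin_group "G\<lparr>carrier := Q\<rparr>" by (rule sub_group[OF Q(1)])
  have "t [^]\<^bsub>G\<lparr>carrier := Q\<rparr>\<^esub> (3::nat) = \<one>"
    using Q.pow_order_eq_1[of t] t(1) Q(2) by (simp add: order_def)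
  then have "t [^] (3::nat) = \<one>" by (simp add: nat_pow_consistent[symmetric])
  then have ttt: "t \<otimes> (t \<otimes> t) = \<one>" using tc by (simp add: numeral_3_eq_3 m_assoc)
  have whole: "H = carrier G" if H: "subgroup H G" "P \<subseteq> H" "t \<in> H" for H
  proof -
    have d: "8 dvd card H" "card H dvd 24" using sub_dvd[OF sP H(1,2)] order_dvd[OF H(1)] P(2) o by auto
    have "card H > 8" using psubset_card_mono[OF sub_finite[OF H(1)], of P] H tP P(2) by auto
    moreover obtain k where k: "card H = 8 * k" using d(1) by auto
    ultimately have "k dvd 3" "k > 1" using d(2) by auto
    then have "k = 3" using three prime_nat_iff by blast
    then show ?thesis using sub_eqI[OF H(1) subgroup_self subgroup.subset[OF H(1)]] k o by (simp add: order_def)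
  qed
  \<comment> \<open>If \<open>t\<close> normalized \<open>V\<close>, so would \<open>P\<close> and
    \<open>t\<close> together, that is \<open>G\<close>; then \<open>V\<close> would be the only
    maximal subgroup instead of one of three.\<close>
  have moved: "cj t ` V \<noteq> V" if V: "V \<in> maxes 2 P" for V
  proof
    assume e: "cj t ` V = V"
    have sN: "subgroup (nzr V) G" using nzr_subgroup[OF subgroup.subset[OF U(1)[OF V]]] .
    have "P \<subseteq> nzr V" using p_index_p_normalized[OF sP c3(2) two U(1,2)[OF V]] U(3)[OF V] by simp
    moreover have "t \<in> nzr V" using e tc unfolding nzr_def by simp
    ultimately have "nzr V = carrier G" using whole[OF sN] by blast
    then have "W = V" if "W \<in> maxes 2 P" for W using conj[OF V that] unfolding nzr_def by blast
    then have "maxes 2 P \<subseteq> {V}" by blast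
    then have "card (maxes 2 P) \<le> 1" using card_mono[of "{V}"] by fastforce
    then show False using pc(4) by simp
  qed
  obtain U1 where U1: "U1 \<in> maxes 2 P" using U0 by blast
  define U2 where "U2 = cj t ` U1"
  define U3 where "U3 = cj t ` U2"
  have U2: "U2 \<in> maxes 2 P" unfolding U2_def by (rule maxes_cj[OF P(1) tc U1])
  have U3: "U3 \<in> maxes 2 P" unfolding U3_def by (rule maxes_cj[OF P(1) tc U2])
  have n12: "U2 \<noteq> U1" and n23: "U3 \<noteq> U2" using moved[OF U1] moved[OF U2] unfolding U2_def U3_def by auto
  have n13: "U3 \<noteq> U1"
  proof
    assume e: "U3 = U1"
    have U1c: "U1 \<subseteq> carrier G" using subgroup.subset[OF U(1)[OF U1]] .
    have "cj t ` U3 = cj (t \<otimes> (t \<otimes> t)) ` U1"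
      unfolding U3_def U2_def using cjs_comp[OF tc tc U1c] cjs_comp[OF tc _ U1c, of "t \<otimes> t"] tc by simp
    also have "\<dots> = U1" using ttt cjs_one[OF U1c] by simp
    finally show False using moved[OF U3] e by simp
  qed
  have all: "maxes 2 P = {U1, U2, U3}"
    using card_subset_eq[OF finite_maxes[OF sP], of "{U1, U2, U3}"] U1 U2 U3 n12 n23 n13 pc(4) by auto
  have "\<not> U1 \<subseteq> ?Z"
  proof
    assume "U1 \<subseteq> ?Z"
    from card_mono[OF sub_finite[OF Z] this] show False using U(3)[OF U1] pc(1) by simp
  qed
  then obtain i0 where i0: "i0 \<in> U1" "i0 \<notin> ?Z" by blast
  define j0 where "j0 = cj t i0"
  define k0 where "k0 = cj t j0"
  have notZ: "cj t y \<notin> ?Z" if "y \<notin> ?Z" "y \<in> carrier G" for y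
    using nZ[OF inv_closed[OF tc], of "cj t y"] cj_inv_cancel(1)[OF tc that(2)] that(1) by auto
  have i0c: "i0 \<in> carrier G" using i0 U(2)[OF U1] Pc by blast
  have j0: "j0 \<in> U2" "j0 \<notin> ?Z" "j0 \<in> carrier G" unfolding j0_def U2_def using i0 notZ i0c tc by auto
  have k0: "k0 \<in> U3" "k0 \<notin> ?Z" "k0 \<in> carrier G" unfolding k0_def U3_def using j0 notZ tc by auto
  have inP: "i0 \<in> P" "j0 \<in> P" using i0 j0 U(2) U1 U2 by auto
  have i12: "U1 \<inter> U2 = ?Z" using pc(3)[OF U1 U2] n12 by auto
  have p0: "i0 \<otimes> j0 \<in> P" using inP subgroup.m_closed[OF sP] by blast
  have p1: "i0 \<otimes> j0 \<notin> U1"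
  proof
    assume "i0 \<otimes> j0 \<in> U1"
    then have "inv i0 \<otimes> (i0 \<otimes> j0) \<in> U1"
      using U(1)[OF U1] i0 by (simp add: subgroup.m_closed subgroup.m_inv_closed)
    then have "j0 \<in> U1" using i0c j0(3) by simp
    then show False using j0 i12 by blast
  qed
  have p2: "i0 \<otimes> j0 \<notin> U2"
  proof
    assume "i0 \<otimes> j0 \<in> U2"
    then have "(i0 \<otimes> j0) \<otimes> inv j0 \<in> U2"
      using U(1)[OF U2] j0 by (simp add: subgroup.m_closed subgroup.m_inv_closed)
    then have "i0 \<in> U2" using i0c j0(3) by (simp add: m_assoc)
    then show False using i0 i12 by blast
  qed
  have "i0 \<otimes> j0 \<in> U3" using element_in_maximal[OF sP c3(2) two nc p0] all p1 p2 by auto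
  then have "i0 \<otimes> j0 \<in> {\<one>, z, k0, z \<otimes> k0}" using elts[OF U3 k0(1,2)] by simp
  moreover have "i0 \<otimes> j0 \<notin> ?Z" using p1 pc(2)[OF U1] by blast
  ultimately have "i0 \<otimes> j0 = k0 \<or> i0 \<otimes> j0 = z \<otimes> k0" using zz(3) by blast
  \<comment> \<open>Only a sign is open. Replacing \<open>i0\<close> by
    \<open>z \<otimes> i0\<close> replaces \<open>j0\<close> and \<open>k0\<close> likewise, which
    leaves the product \<open>i0 \<otimes> j0\<close> unchanged but multiplies \<open>k0\<close> by
    \<open>z\<close>.\<close>
  then have "\<exists>i. i \<in> U1 \<and> i \<notin> ?Z \<and> cj t (cj t i) = i \<otimes> cj t i"
  proof
    assume "i0 \<otimes> j0 = k0"
    then show ?thesis using i0 unfolding k0_def j0_def by metis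
  next
    assume e: "i0 \<otimes> j0 = z \<otimes> k0"
    have a: "z \<otimes> i0 \<in> U1" using pc(2)[OF U1] zz(1) i0 subgroup.m_closed[OF U(1)[OF U1]] by blast
    have b: "z \<otimes> i0 \<notin> ?Z"
    proof
      assume "z \<otimes> i0 \<in> ?Z"
      then have "inv z \<otimes> (z \<otimes> i0) \<in> ?Z" using zz(1) subgroup.m_closed[OF Z] subgroup.m_inv_closed[OF Z] by blast
      then show False using i0 i0c zc by simp
    qed
    have c: "cj t (z \<otimes> i0) = z \<otimes> j0" "cj t (z \<otimes> j0) = z \<otimes> k0"
      using cj_mult[OF tc zc] cz[OF tc] i0c j0(3) unfolding j0_def k0_def by auto
    have "(z \<otimes> i0) \<otimes> (z \<otimes> j0) = z \<otimes> ((i0 \<otimes> z) \<otimes> j0)" using zc i0c j0 by (simp add: m_assoc)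
    also have "\<dots> = (z \<otimes> z) \<otimes> (i0 \<otimes> j0)" using zcomm[OF i0c] zc i0c j0 by (simp add: m_assoc)
    also have "\<dots> = z \<otimes> k0" using z2 e zc k0 by simp
    finally show ?thesis using a b c by metis
  qed
  then obtain i where i: "i \<in> U1" "i \<notin> ?Z" "cj t (cj t i) = i \<otimes> cj t i" by blast
  define j where "j = cj t i"
  have ic: "i \<in> carrier G" using i U(2)[OF U1] Pc by blast
  have jj: "j \<in> U2" "j \<notin> ?Z" "j \<in> carrier G" unfolding j_def U2_def using i notZ ic tc by auto
  have ijP: "i \<in> P" "j \<in> P" using i jj U(2) U1 U2 by auto
  have jU1: "j \<notin> U1" using jj i12 by blast
  have ijU1: "i \<otimes> j \<notin> U1"
  proof
    assume "i \<otimes> j \<in> U1"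
    then have "inv i \<otimes> (i \<otimes> j) \<in> U1"
      using U(1)[OF U1] i by (simp add: subgroup.m_closed subgroup.m_inv_closed)
    then show False using ic jj(3) jU1 by simp
  qed
  have sqs: "i \<otimes> i = z" "j \<otimes> j = z" using sq ijP i(2) jj(2) by auto
  \<comment> \<open>\<open>i \<otimes> j\<close> is noncentral, so it squares to \<open>z\<close> as
    well; cancelling \<open>i\<close> and \<open>j\<close> gives the commutation rule.\<close>
  have "(i \<otimes> j) \<otimes> (i \<otimes> j) = z"
    using sq[of "i \<otimes> j"] ijP subgroup.m_closed[OF sP] ijU1 pc(2)[OF U1] by blast
  then have "i \<otimes> ((i \<otimes> (j \<otimes> (i \<otimes> j))) \<otimes> j) = i \<otimes> (z \<otimes> j)" using ic jj by (simp add: m_assoc)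
  moreover have "i \<otimes> ((i \<otimes> (j \<otimes> (i \<otimes> j))) \<otimes> j) = (i \<otimes> i) \<otimes> ((j \<otimes> i) \<otimes> (j \<otimes> j))" using ic jj by (simp add: m_assoc)
  ultimately have "z \<otimes> ((j \<otimes> i) \<otimes> z) = i \<otimes> (z \<otimes> j)" using sqs by simp
  then have "(z \<otimes> z) \<otimes> (j \<otimes> i) = z \<otimes> (i \<otimes> j)"
    using zcomm[of "j \<otimes> i"] zcomm[OF ic] zc ic jj by (simp add: m_assoc[symmetric])
  then have ji: "j \<otimes> i = z \<otimes> (i \<otimes> j)" using z2 ic jj by simp
  have ti: "t \<otimes> i = j \<otimes> t" unfolding j_def cj_def using tc ic by (simp add: m_assoc)
  have "cj t j \<otimes> t = t \<otimes> j" unfolding cj_def using tc jj by (simp add: m_assoc)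
  then have tj: "t \<otimes> j = i \<otimes> (j \<otimes> t)" using i(3) tc jj ic unfolding j_def[symmetric] by (simp add: m_assoc)
  show ?thesis
  proof (rule iso_SL23_of_relations[OF ic jj(3) tc zc sqs z2 ttt ji ti tj zcomm[OF ic] zcomm[OF jj(3)] zcomm[OF tc] _ o])
    fix H assume H: "subgroup H G" "i \<in> H" "j \<in> H" "t \<in> H"
    have s: "subgroup (P \<inter> H) G" using Int_subgroup[OF sP H(1)] .
    have "card (P \<inter> H) dvd 2 ^ 3" using sub_dvd[OF s sP] c3(1) by auto
    then obtain k where k: "k \<le> 3" "card (P \<inter> H) = 2 ^ k" using divides_primepow_nat[OF two] by blast
    have "z \<in> H" using sqs(1) H subgroup.m_closed[OF H(1)] by metis
    then have "U1 \<subseteq> P \<inter> H"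
      using elts[OF U1 i(1,2)] H subgroup.one_closed[OF H(1)] subgroup.m_closed[OF H(1)] U(2)[OF U1] by blast
    then have "U1 \<subset> P \<inter> H" using jU1 ijP H by blast
    from psubset_card_mono[OF sub_finite[OF s] this] have "(2::nat) ^ 2 < 2 ^ k" using k U(3)[OF U1] by simp
    then have "k > 2" by (metis one_less_numeral_iff power_strict_increasing_iff semiring_norm(76))
    then have "k = 3" using k by linarith
    then have "card (P \<inter> H) = card P" using k c3(1) by simp
    then have "P \<inter> H = P" using sub_eqI[OF s sP] by blast
    then show "H = carrier G" using whole[OF H(1) _ H(4)] by blast
  qed
qed

section \<open>Solvable groups of derived length above two\<close>

lemma solvable_derived_ne:
  assumes "solvable G" "subgroup H G" "H \<noteq> {\<one>}" shows "derived G H \<noteq> H"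
proof
  assume e: "derived G H = H"
  have "(derived G ^^ n) H = H" for n by (induction n) (use e in auto)
  then show False
    using solvable_imp_trivial_derived_seq[OF solvable_subgroup[OF assms(2,1)]] assms(3) by simp
qed

lemma comm_in_normalized:
  assumes U: "subgroup U G" and a: "a \<in> U" and h: "h \<in> nzr U"
  shows "comm a h \<in> U" "comm h a \<in> U"
proof -
  have c: "a \<in> carrier G" "h \<in> carrier G" using subgroup.mem_carrier[OF U a] nzr_subset h by auto
  have "comm a h = a \<otimes> cj h (inv a)" using c by (simp add: comm_def cj_def m_assoc)
  then show 1: "comm a h \<in> U" using a h U nzrD by (simp add: subgroup.m_closed subgroup.m_inv_closed)
  show "comm h a \<in> U" using comm_swap[OF c] 1 U by (simp add: subgroup.m_inv_closed)
qed

lemma derived_subset_normal_maximal: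
  assumes P: "subgroup P G" "card P = p ^ Suc n" "prime p" and U: "U \<in> maxes p P"
  shows "derived G P \<subseteq> U"
proof -
  have u: "subgroup U G" "U \<subseteq> P" "card U = p ^ n" using U maxes_iff[OF P(3,2)] by auto
  have n: "P \<subseteq> nzr U" by (rule p_index_p_normalized[OF P u])
  have "comm x y \<in> U" if "x \<in> P" "y \<in> P" for x y
    by (rule commutators_from_prime_index[OF P(1) u(1) n u(1,2) _ P(3) _ that])
      (use P(2) u(3) comm_in_normalized[OF u(1)] n in auto)
  then show ?thesis using derived_subset_iff[OF u(1) subgroup.subset[OF P(1)]] by blast
qed

text \<open>For \<open>K\<close> inside \<open>P\<close> this is the preimage of the centre of
  \<open>P\<close> modulo \<open>K\<close>.\<close>

lemma central_mod_subgroup: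
  assumes P: "subgroup P G" and K: "subgroup K G" "P \<subseteq> nzr K"
  shows "subgroup {g \<in> P. \<forall>h\<in>P. comm h g \<in> K} G"
proof -
  have "{g \<in> P. \<forall>h\<in>P. comm h g \<in> K} = \<Inter>((\<lambda>h. {g \<in> P. comm h g \<in> K}) ` P)"
    using subgroup.one_closed[OF P] by auto
  moreover have "subgroup (\<Inter>((\<lambda>h. {g \<in> P. comm h g \<in> K}) ` P)) G"
    by (rule subgroups_Inter) (use comm_set_subgroup[OF P K] subgroup.one_closed[OF P] in auto)
  ultimately show ?thesis by simp
qed

lemma commutators_from_central_mod:
  assumes P: "subgroup P G" and K: "subgroup K G" "P \<subseteq> nzr K"
    and B: "B = {g \<in> P. \<forall>h\<in>P. comm h g \<in> K}" and i: "card P = card B \<or> (\<exists>q. prime q \<and> card P = q * card B)"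
    and x: "x \<in> P" and y: "y \<in> P"
  shows "comm x y \<in> K"
proof -
  have sB: "subgroup B G" unfolding B by (rule central_mod_subgroup[OF P K])
  have BP: "B \<subseteq> P" unfolding B by blast
  from i show ?thesis
  proof
    assume "card P = card B"
    then have "B = P" using sub_eqI[OF sB P BP] by simp
    then show ?thesis using x y unfolding B by blast
  next
    assume "\<exists>q. prime q \<and> card P = q * card B"
    then obtain q where q: "prime q" "card P = q * card B" by blast
    show ?thesis
    proof (rule commutators_from_prime_index[OF P K sB BP q(2,1) _ x y])
      fix a h assume a: "a \<in> B" and h: "h \<in> P"
      have "comm a h = inv (comm h a)" using comm_swap subgroup.mem_carrier[OF P] a h BP by blast
      moreover have "comm h a \<in> K" using a h unfolding B by blast
      ultimately show "comm a h \<in> K" using K(1) by (simp add: subgroup.m_inv_closed)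
    qed
  qed
qed

lemma card_powers: "prime p \<Longrightarrow> card ((\<lambda>k. p ^ k) ` {1..n::nat}) = n" for p :: nat
proof -
  assume "prime p"
  then have "inj_on (\<lambda>k. p ^ k) {1..n}" using prime_power_inj by (intro inj_onI) blast
  then show ?thesis by (simp add: card_image)
qed

text \<open>\<open>P\<close> normalizes each of its maximal subgroups, so the length of their single
  orbit divides \<open>s\<close>; it exceeds \<open>p\<close>, so it is not 1.\<close>

lemma maxes_one_class:
  assumes P: "P \<lhd> G" "card P = p ^ Suc n" "prime p" "n > 0" and o: "order G = s * card P" and s: "prime s"
    and nc: "\<not> cyc P" and u: "\<And>U V. U \<in> maxes p P \<Longrightarrow> V \<in> maxes p P \<Longrightarrow> \<exists>g\<in>carrier G. cj g ` U = V"
  shows "card (maxes p P) = s"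
proof -
  have sP: "subgroup P G" using P(1) normal_imp_subgroup by blast
  have gt: "card (maxes p P) > p" by (rule card_maxes_gt[OF sP P(2,3) nc])
  then obtain U where U: "U \<in> maxes p P" by fastforce
  note mU = maxes_nsn[OF sP P(2,3,4) U]
  have "maxes p P = (\<lambda>g. cj g ` U) ` carrier G"
    using u[OF U] maxes_cj[OF P(1) _ U] by blast
  then have "card (maxes p P) * card (carrier G \<inter> nzr U) = order G"
    using card_conjugates[OF subgroup.subset[OF mU(2)] subgroup_self] by (simp add: order_def)
  moreover have "carrier G \<inter> nzr U = nzr U" using nzr_subset by blast
  moreover obtain k where "card (nzr U) = card P * k"
    using sub_dvd[OF sP nzr_subgroup[OF subgroup.subset[OF mU(2)]] mU(5)] by auto
  ultimately have "(card (maxes p P) * k) * card P = s * card P" using o by (simp add: mult_ac)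
  then have "card (maxes p P) * k = s" using card_pos[OF sP] by simp
  then have "card (maxes p P) dvd s" by (metis dvd_triv_left)
  moreover have "card (maxes p P) \<noteq> 1" using gt P(3) prime_gt_1_nat[of p] by linarith
  ultimately show ?thesis using s prime_nat_iff by blast
qed

lemma normal_abelian_data:
  assumes P: "P \<lhd> G"
  shows "derived G P \<lhd> G" "P \<inter> cent P \<lhd> G" "derived G P \<subseteq> P"
proof -
  have sP: "subgroup P G" and nP: "nzr P = carrier G" using P normal_iff_nzr by auto
  have Pc: "P \<subseteq> carrier G" using subgroup.subset[OF sP] .
  show "derived G P \<lhd> G" unfolding normal_iff_nzr
    using derived_is_subgroup[OF Pc] nzr_derived[OF Pc] nP nzr_subset by blast
  show "P \<inter> cent P \<lhd> G" unfolding normal_iff_nzr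
    using Int_subgroup[OF sP cent_subgroup[OF Pc]] nzr_Int[OF sP cent_subgroup[OF Pc]] nzr_cent[OF Pc] nP nzr_subset by blast
  show "derived G P \<subseteq> P" by (rule derived_incl[OF subset_refl sP])
qed

lemma derived_trivial_abelian:
  assumes "P \<subseteq> carrier G" "derived G P \<subseteq> {\<one>}" shows "P \<subseteq> cent P"
proof -
  have "comm x y = \<one>" if "x \<in> P" "y \<in> P" for x y
    using derived_subset_iff[OF triv_subgroup assms(1)] assms(2) that by blast
  then show ?thesis unfolding cent_def using assms(1) comm_one_iff by blast
qed

text \<open>Each of the orders \<open>p\<close>, \<open>p\<^sup>2\<close>, \<open>p\<^sup>3\<close>, \<open>p\<^sup>4\<close> belongs to exactly one class. The number \<open>s\<close> of maximal subgroups of \<open>P\<close>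
  exceeds \<open>p\<close>, so no normal subgroup has order \<open>p\<close>; hence \<open>Z(P)\<close> and \<open>P'\<close> both have order \<open>p\<^sup>2\<close> and coincide.
  A noncentral \<open>x\<close> with centralizer of index \<open>p\<close> then gives \<open>P' \<subseteq> [P, x]\<close>, a group of order \<open>p\<close>.\<close>

lemma no_normal_p4:
  assumes D: "D_count G \<le> 4" and P: "P \<lhd> G" "card P = p ^ 4" "prime p" and na: "\<not> P \<subseteq> cent P"
    and s: "prime s" "s \<noteq> p" "order G = s * card P" and O: "\<And>k. 0 < k \<Longrightarrow> k \<le> 4 \<Longrightarrow> p ^ k \<in> nsn_orders"
  shows False
proof -
  have sP: "subgroup P G" and nP: "nzr P = carrier G" using P(1) normal_iff_nzr by auto
  have Pc: "P \<subseteq> carrier G" using subgroup.subset[OF sP] .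
  have p1: "p > 1" using P(3) prime_gt_1_nat by blast
  have P4: "card P = p ^ Suc 3" using P(2) by simp
  let ?S = "(\<lambda>k. p ^ k) ` {1..4::nat}"
  have S: "finite ?S" "?S \<subseteq> nsn_orders" "card ?S \<ge> D_count G"
    using O card_powers[OF P(3), of 4] D by auto
  note uniq = nsn_conj_unique[OF S]
  have uniqn: "A = B" if ab: "A \<lhd> G" "nsn A" "nsn B" "card A = card B" for A B
  proof -
    obtain g where "g \<in> carrier G" "cj g ` A = B" using uniq[OF ab(2,3,4)] by blast
    then show ?thesis using ab(1) unfolding normal_iff_nzr nzr_def by blast
  qed
  have nc: "\<not> cyc P" using cyc_abelian[OF sP] na by blast
  have "card (maxes p P) = s"
    by (rule maxes_one_class[OF P(1) P4 P(3) _ s(3,1) nc])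
       (use uniq maxes_nsn[OF sP P4 P(3)] in auto)
  then have cM: "card (maxes p P) = s" "s > p" using card_maxes_gt[OF sP P4 P(3) nc] by auto
  obtain Q where Q: "subgroup Q G" "card Q = s ^ 1"
    using subgroup_of_prime_power_exists[OF subgroup_self s(1), of 1] s(3) by (auto simp: order_def)
  \<comment> \<open>\<open>s\<close> is not a power of \<open>p\<close>, hence not among the four
    orders.\<close>
  have sn: "nzr Q = Q"
  proof (rule ccontr)
    assume n: "nzr Q \<noteq> Q"
    have "Q \<noteq> {\<one>}" using Q(2) s(1) by auto
    then have "s ^ 1 \<in> nsn_orders" using nsnI[OF Q(1) _ n] nsn_orderI Q(2) by metis
    then have "s ^ 1 \<in> ?S" using nsn_orders_eq[OF S] by simp
    then show False using prime_power_ne[OF s(1) P(3) s(2), of 1] by auto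
  qed
  \<comment> \<open>\<open>Q\<close> would act on \<open>Y\<close> fixing only the identity, so
    \<open>s\<close> would divide \<open>p - 1\<close>, although \<open>s > p\<close>.\<close>
  have np: False if Y: "Y \<lhd> G" "card Y = p" for Y
  proof -
    have sY: "subgroup Y G" "nzr Y = carrier G" using Y(1) normal_iff_nzr by auto
    have "\<not> s dvd card Y" using Y(2) s P(3) primes_dvd_imp_eq by metis
    then have "s dvd p - 1"
      using self_normalizing_prime_dvd[OF Q(1) _ s(1) sn sY(1)] Q sY(2) Y(2) subgroup.subset[OF Q(1)] by simp
    then show False using cM(2) p1 by (auto dest!: dvd_imp_le)
  qed
  let ?Z = "P \<inter> cent P" and ?D = "derived G P"
  note nn = normal_abelian_data[OF P(1)]
  have sZ: "subgroup ?Z G" and sD: "subgroup ?D G" using nn(1,2) normal_imp_subgroup by auto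
  have cD: "card ?D = p ^ 2"
  proof -
    have "card (maxes p P) > 1" using cM p1 by linarith
    then obtain U where U: "U \<in> maxes p P" by fastforce
    note mU = maxes_nsn[OF sP P4 P(3) _ U]
    obtain i where i: "i \<le> 3" "card ?D = p ^ i"
      using card_prime_power_sub[OF mU(2,4) P(3) sD derived_subset_normal_maximal[OF sP P4 P(3) U]] by auto
    have "i \<noteq> 0" using i derived_trivial_abelian[OF Pc] na card_eq_one[OF sD] by auto
    moreover have "i \<noteq> 1" using i np[OF nn(1)] by auto
    \<comment> \<open>A derived subgroup of order \<open>p^3\<close> would coincide with every
      maximal subgroup, but there are several.\<close>
    moreover have "i \<noteq> 3"
    proof
      assume i3: "i = 3"
      have "W = ?D" if W: "W \<in> maxes p P" for W
        using sub_eqI[OF sD _ derived_subset_normal_maximal[OF sP P4 P(3) W]] maxes_nsn(2,4)[OF sP P4 P(3) _ W] i i3 by simp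
      then have "maxes p P \<subseteq> {?D}" by blast
      then have "card (maxes p P) \<le> 1" using card_mono[of "{?D}"] by fastforce
      then show False using cM p1 by linarith
    qed
    ultimately have "i = 2" using i(1) by linarith
    then show ?thesis using i by simp
  qed
  have cZ: "card ?Z = p ^ 2"
  proof -
    obtain i where i: "i \<le> 4" "card ?Z = p ^ i" using card_prime_power_sub[OF sP P(2,3) sZ] by auto
    obtain x where x: "x \<in> P" "x \<noteq> \<one>" "\<forall>g\<in>P. cj g x = x"
      using p_group_fixes_nontrivial[OF sP P(2,3) sP _ nzr_ge[OF sP]] P(2) by auto
    have "g \<otimes> x = x \<otimes> g" if "g \<in> P" for g using x(3,1) cj_eq_iff Pc that by blast
    then have "x \<in> ?Z" using x Pc unfolding cent_def by auto
    then have "i \<noteq> 0" using i x card_eq_one[OF sZ] by (metis power_0 singletonD)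
    moreover have "i \<noteq> 1" using i np[OF nn(2)] by auto
    moreover have "i \<noteq> 4" using sub_eqI[OF sZ sP] i P(2) na by auto
    moreover have "i \<noteq> 3"
    proof
      assume "i = 3"
      then have "card P = p * card ?Z" using i P(2) by (simp add: numeral_eq_Suc)
      then have "P \<subseteq> cent P" using abelian_from_prime_index[OF sP sZ _ _ P(3)] by blast
      then show False using na by blast
    qed
    ultimately have "i = 2" using i(1) by linarith
    then show ?thesis using i by simp
  qed
  have d2: "p ^ Suc 2 dvd order G" 
  proof -
    have "p ^ Suc 2 dvd card P" unfolding P(2) by (rule le_imp_power_dvd) simp
    then show ?thesis unfolding s(3) by (rule dvd_mult)
  qed
  have ZD: "?Z = ?D"
    using uniqn[OF nn(2) nsn_p[OF sZ cZ P(3) _ d2] nsn_p[OF sD cD P(3) _ d2]] cZ cD by simp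
  obtain x where x: "x \<in> P" "x \<notin> ?Z" using na by blast
  have xc: "x \<in> carrier G" using x Pc by blast
  have inZ: "comm a b \<in> ?Z" if "a \<in> P" "b \<in> P" for a b
    using derived_subset_iff[OF sZ Pc] ZD that by blast
  let ?K = "comm x ` P"
  let ?C = "P \<inter> cent {x}"
  have KZ: "?K \<subseteq> ?Z" using inZ x(1) by blast
  have K: "subgroup ?K G" "card ?K * card ?C = card P"
    using comm_image_central[OF sP xc] inZ[OF x(1)] by auto
  have sC: "subgroup ?C G" using Int_subgroup[OF sP cent_subgroup[of "{x}"]] xc by simp
  \<comment> \<open>The centralizer of \<open>x\<close> contains \<open>?Z\<close> and the
    noncentral \<open>x\<close> itself, so its order lies strictly between \<open>p^2\<close> and
    \<open>p^4\<close>.\<close>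
  have cK: "card ?K = p"
  proof -
    obtain c where c: "c \<le> 4" "card ?C = p ^ c" using card_prime_power_sub[OF sP P(2,3) sC] by auto
    have "?Z \<subseteq> ?C" using cent_mono[of "{x}" P] x(1) by blast
    moreover have "x \<in> ?C" using x(1) xc unfolding cent_def by simp
    ultimately have "card ?Z < card ?C" using psubset_card_mono[OF sub_finite[OF sC], of ?Z] x(2) by blast
    then have "c > 2" using c cZ p1 by simp
    moreover have "c \<noteq> 4"
    proof
      assume "c = 4"
      then have "?C = P" using sub_eqI[OF sC sP] c P(2) by auto
      then have "P \<subseteq> cent {x}" by blast
      then have "x \<in> cent P" using cent_sym[of P "{x}"] xc by blast
      then show False using x by blast
    qed
    ultimately have "c = 3" using c by linarith
    then have "card ?K * p ^ 3 = p * p ^ 3" using K(2) c P(2) by (simp add: numeral_eq_Suc)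
    then show ?thesis using p1 by simp
  qed
  have nK: "P \<subseteq> nzr ?K"
  proof
    fix g assume g: "g \<in> P"
    show "g \<in> nzr ?K"
    proof (rule nzrI[OF K(1)])
      show "g \<in> carrier G" using g Pc by blast
      fix k assume k: "k \<in> ?K"
      then have "k \<in> cent P" "k \<in> carrier G" using KZ Pc by blast+
      then have "cj g k = k" using cj_eq_iff g Pc centD by (metis subsetD)
      then show "cj g k \<in> ?K" using k by simp
    qed
  qed
  \<comment> \<open>The elements central modulo \<open>?K\<close>. Both \<open>?Z\<close> and
    \<open>x\<close> belong to it, so its index is at most \<open>p\<close>, and \<open>P\<close> is
    abelian modulo \<open>?K\<close>.\<close>
  define B where "B = {g \<in> P. \<forall>h\<in>P. comm h g \<in> ?K}"
  have sB: "subgroup B G" unfolding B_def by (rule central_mod_subgroup[OF sP K(1) nK])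
  have "?Z \<subseteq> B"
  proof
    fix z assume z: "z \<in> ?Z"
    have "comm h z = \<one>" if "h \<in> P" for h using comm_one_iff[of h z] centD[of z P h] z that Pc by auto
    then show "z \<in> B" unfolding B_def using z subgroup.one_closed[OF K(1)] by simp
  qed
  moreover have "x \<in> B"
  proof -
    have "comm h x \<in> ?K" if "h \<in> P" for h
      using comm_swap[OF xc, of h] that Pc subgroup.m_inv_closed[OF K(1)] by auto
    then show ?thesis unfolding B_def using x by blast
  qed
  ultimately have lt: "card ?Z < card B" using psubset_card_mono[OF sub_finite[OF sB], of ?Z] x(2) by blast
  obtain b where b: "b \<le> 4" "card B = p ^ b" using card_prime_power_sub[OF sP P(2,3) sB] unfolding B_def by auto
  have "b > 2" using lt b cZ p1 by simp
  then have "b = 4 \<or> b = 3" using b by linarith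
  then have i: "card P = card B \<or> (\<exists>q. prime q \<and> card P = q * card B)"
  proof
    assume "b = 3"
    then have "card P = p * card B" using b P(2) by (simp add: numeral_eq_Suc)
    then show ?thesis using P(3) by blast
  qed (use b P(2) in simp)
  have "?D \<subseteq> ?K"
    using commutators_from_central_mod[OF sP K(1) nK B_def i] derived_subset_iff[OF K(1) Pc] by blast
  then have "p ^ 2 \<le> p" using card_mono[OF sub_finite[OF K(1)]] cK cD by metis
  then show False using p1 by (simp add: power2_eq_square)
qed

text \<open>If a subgroup \<open>Q\<close> of order \<open>s\<close> is not self-normalizing, the
  orders \<open>s\<close>, \<open>p\<close>, \<open>p^2\<close>, \<open>p^3\<close> have one class
  each; the \<open>p + 1\<close> maximal subgroups then form one orbit, so \<open>s = p + 1\<close>.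
  If it is self-normalizing, \<open>s\<close> divides \<open>p - 1\<close>, and too few classes of
  order \<open>p^2\<close> remain unless \<open>s = 2\<close>; but then an involution inverts
  \<open>P\<close>, which is nonabelian.\<close>

lemma normal_p3_iso_SL23:
  assumes D: "D_count G \<le> 4" and P: "P \<lhd> G" "card P = p ^ 3" "prime p" and na: "\<not> P \<subseteq> cent P"
    and s: "prime s" "s \<noteq> p" "order G = s * card P" and O: "\<And>k. 0 < k \<Longrightarrow> k \<le> 3 \<Longrightarrow> p ^ k \<in> nsn_orders"
  shows "G \<cong> SL23"
proof -
  have sP: "subgroup P G" and nP: "nzr P = carrier G" using P(1) normal_iff_nzr by auto
  have Pc: "P \<subseteq> carrier G" using subgroup.subset[OF sP] .
  have p1: "p > 1" using P(3) prime_gt_1_nat by blast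
  have P3: "card P = p ^ Suc 2" using P(2) by simp
  have nc: "\<not> cyc P" using cyc_abelian[OF sP] na by blast
  note pc = nonabelian_p_cubed[OF sP P(2,3) na]
  have sdP: "\<not> s dvd card P" using P s prime_dvd_power_nat primes_dvd_imp_eq by metis
  obtain Q where Q: "subgroup Q G" "card Q = s ^ 1"
    using subgroup_of_prime_power_exists[OF subgroup_self s(1), of 1] s(3) by (auto simp: order_def)
  have Q1: "card Q = s" "Q \<noteq> {\<one>}" using Q(2) s(1) by auto
  note mx = maxes_nsn[OF sP P3 P(3)]
  show ?thesis
  proof (cases "nzr Q = Q")
    case False
    have sO: "s \<in> nsn_orders" using nsnI[OF Q(1) Q1(2) False] nsn_orderI Q1(1) by metis
    let ?S = "insert s ((\<lambda>k. p ^ k) ` {1..3::nat})"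
    have "s \<notin> (\<lambda>k. p ^ k) ` {1..3::nat}" using prime_power_ne[OF s(1) P(3) s(2), of 1] by auto
    then have "card ?S = 4" using card_powers[OF P(3), of 3] by simp
    then have S: "finite ?S" "?S \<subseteq> nsn_orders" "card ?S \<ge> D_count G" using O sO D by auto
    note uniq = nsn_conj_unique[OF S]
    have u: "\<exists>g\<in>carrier G. cj g ` U = V" if "U \<in> maxes p P" "V \<in> maxes p P" for U V
      using uniq mx(1,4) that by simp
    have "card (maxes p P) = s" by (rule maxes_one_class[OF P(1) P3 P(3) _ s(3,1) nc u]) simp_all
    then have "s = p + 1" using pc(4) by simp
    then have "p = 2" "s = 3" using primes_consecutive[OF P(3)] s(1) by auto
    then show ?thesis using iso_SL23[OF _ P(1) _ na] u s(3) P(2) by simp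
  next
    case True
    have fx: "x = \<one>" if "x \<in> P" "\<And>g. g \<in> Q \<Longrightarrow> cj g x = x" for x
      by (rule self_normalizing_fixes_nothing[OF Q(1) Q1(1) s(1) True sP sdP that])
    let ?Z = "P \<inter> cent P"
    have nZ: "?Z \<lhd> G" by (rule normal_abelian_data(2)[OF P(1)])
    then have sZ: "subgroup ?Z G" "nzr ?Z = carrier G" using normal_iff_nzr by auto
    have "\<not> s dvd card ?Z" using pc(1) s P(3) primes_dvd_imp_eq by metis
    then have sp: "s dvd p - 1"
      using self_normalizing_prime_dvd[OF Q(1) Q1(1) s(1) True sZ(1)] sZ(2) pc(1) subgroup.subset[OF Q(1)] by simp
    have "{p ^ 1, p ^ 3} \<subseteq> nsn_orders" using O[of 1] O[of 3] by simp
    moreover have "p ^ 2 \<notin> {p ^ 1, p ^ 3}"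
      using prime_power_inj[OF P(3), of 2 1] prime_power_inj[OF P(3), of 2 3] by auto
    moreover have "p ^ 1 \<noteq> p ^ 3" using prime_power_inj[OF P(3), of 1 3] by auto
    then have "card {p ^ 1, p ^ 3} = 2" by simp
    ultimately have n2: "ncls (p ^ 2) \<le> 2" using ncls_bound[of "{p ^ 1, p ^ 3}" "p ^ 2"] D by simp
    let ?F = "{U \<in> maxes p P. Q \<subseteq> nzr U}"
    have "s dvd card (maxes p P - ?F)"
      by (rule prime_dvd_moved_sets[OF Q s(1)])
         (use subgroup.subset[OF mx(2)] maxes_cj[OF P(1)] subgroup.mem_carrier[OF Q(1)] in auto)
    moreover have fm: "finite (maxes p P)" by (rule finite_maxes[OF sP])
    ultimately have sd: "s dvd (p + 1) - card ?F" using pc(4) by (subst (asm) card_Diff_subset) auto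
    have Fn: "nzr U = carrier G" if U: "U \<in> ?F" for U
    proof -
      have u: "U \<in> maxes p P" "Q \<subseteq> nzr U" using U by auto
      have sN: "subgroup (nzr U) G" using nzr_subgroup[OF subgroup.subset[OF mx(2)[OF _ u(1)]]] by simp
      have "s dvd card (nzr U)" using sub_dvd[OF Q(1) sN u(2)] Q1 by simp
      moreover have "card P dvd card (nzr U)" using sub_dvd[OF sP sN mx(5)[OF _ u(1)]] by simp
      moreover have "coprime s (card P)" using sdP s(1) prime_imp_coprime by blast
      ultimately have "order G dvd card (nzr U)" using s(3) by (simp add: divides_mult)
      then have "card (nzr U) = card (carrier G)" using order_dvd[OF sN] by (simp add: order_def dvd_antisym)
      then show ?thesis using sub_eqI[OF sN subgroup_self nzr_subset] by blast
    qed
    have cls: "subgroup_conj_class G U = {U}" if "U \<in> ?F" for U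
      using Fn[OF that] one_closed unfolding conj_class_eq nzr_def by blast
    let ?W = "subgroup_conj_class G ` {H. nsn H \<and> card H = p ^ 2}"
    have fW: "finite ?W" using finite_nsn_card by blast
    have maxW: "subgroup_conj_class G U \<in> ?W" if "U \<in> maxes p P" for U using mx(1,4)[OF _ that] by auto
    have FW: "subgroup_conj_class G ` ?F \<subseteq> ?W" using maxW by blast
    have "inj_on (subgroup_conj_class G) ?F"
    proof (rule inj_onI)
      fix U V assume "U \<in> ?F" "V \<in> ?F" "subgroup_conj_class G U = subgroup_conj_class G V"
      then have "{U} = {V}" using cls[of U] cls[of V] by simp
      then show "U = V" by simp
    qed
    then have cF: "card (subgroup_conj_class G ` ?F) = card ?F" by (rule card_image)
    have cW: "card ?W \<le> 2" using n2 unfolding ncls_def .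
    have F2: "card ?F \<le> 2" using card_mono[OF fW FW] cF cW by simp
    \<comment> \<open>Two members would use up both classes, so that all \<open>p + 1 > 2\<close>
      maximal subgroups would be in \<open>?F\<close>. One member would make \<open>s\<close> divide
      \<open>p\<close>. With none, \<open>s\<close> divides both \<open>p + 1\<close> and
      \<open>p - 1\<close>.\<close>
    have "card ?F \<noteq> 2"
    proof
      assume e: "card ?F = 2"
      then have all: "subgroup_conj_class G ` ?F = ?W" using card_seteq[OF fW FW] cF cW by simp
      have "U \<in> ?F" if U: "U \<in> maxes p P" for U
      proof -
        have "subgroup_conj_class G U \<in> subgroup_conj_class G ` ?F" unfolding all by (rule maxW[OF U])
        then obtain V where V: "subgroup_conj_class G U = subgroup_conj_class G V" "V \<in> ?F" by (rule imageE)
        have "U \<in> subgroup_conj_class G V"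
          using self_in_conj_class[OF subgroup.subset[OF mx(2)[OF _ U]]] V(1) by simp
        then have "U = V" unfolding cls[OF V(2)] by simp
        then show ?thesis using V(2) by simp
      qed
      then have "?F = maxes p P" by blast
      then show False using e pc(4) p1 by simp
    qed
    moreover have "card ?F \<noteq> 1"
    proof
      assume "card ?F = 1"
      then have "s dvd p" using sd by simp
      then show False using s P(3) primes_dvd_imp_eq by blast
    qed
    ultimately have "card ?F = 0" using F2 by linarith
    then have "s dvd p + 1" using sd by simp
    then have "s dvd (p + 1) - (p - 1)" using sp by (rule dvd_diff_nat)
    then have "s dvd 2" using p1 by simp
    then have s2: "s = 2" using s(1) primes_dvd_imp_eq two_is_prime_nat by blast
    obtain t where t: "t \<in> Q" "t \<noteq> \<one>" using Q1(2) subgroup.one_closed[OF Q(1)] by blast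
    have "card {\<one>, t} = card Q" using t(2) Q1(1) s2 by simp
    then have Qt: "Q = {\<one>, t}"
      using card_subset_eq[OF sub_finite[OF Q(1)], of "{\<one>, t}"] t subgroup.one_closed[OF Q(1)] by blast
    have tc: "t \<in> carrier G" using t subgroup.mem_carrier[OF Q(1)] by blast
    have "t \<otimes> t \<in> Q" using subgroup.m_closed[OF Q(1)] t by blast
    then have tt: "t \<otimes> t = \<one>" using Qt t(2) tc by auto
    have "P \<subseteq> cent P"
    proof (rule fpf_involution_abelian[OF sP _ tt])
      show "t \<in> nzr P" using nP tc by simp
      fix x assume x: "x \<in> P" "cj t x = x"
      have "cj g x = x" if "g \<in> Q" for g using that Qt x Pc by auto
      then show "x = \<one>" by (rule fx[OF x(1)])
    qed
    then show ?thesis using na by blast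
  qed
qed

text \<open>Here the maximal subgroups are normal, so each of the more than \<open>p\<close> of them is a class of its own.\<close>

lemma no_normal_p_index_p:
  assumes D: "D_count G \<le> 4" and P: "order G = p ^ Suc n" "prime p" "n \<ge> 3" and na: "\<not> carrier G \<subseteq> cent (carrier G)"
  shows False
proof -
  have c: "card (carrier G) = p ^ Suc n" using P(1) by (simp add: order_def)
  have nc: "\<not> cyc (carrier G)" using cyc_abelian[OF subgroup_self] na by blast
  let ?M = "maxes p (carrier G)"
  note mx = maxes_nsn[OF subgroup_self c P(2)]
  have n0: "n > 0" using P(3) by simp
  have cls: "subgroup_conj_class G U = {U}" if U: "U \<in> ?M" for U
    using mx(5)[OF n0 U] one_closed unfolding conj_class_eq nzr_def by blast
  have "inj_on (subgroup_conj_class G) ?M"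
  proof (rule inj_onI)
    fix U V assume "U \<in> ?M" "V \<in> ?M" "subgroup_conj_class G U = subgroup_conj_class G V"
    then have "{U} = {V}" using cls[of U] cls[of V] by simp
    then show "U = V" by simp
  qed
  then have cM: "card (subgroup_conj_class G ` ?M) = card ?M" by (rule card_image)
  have "subgroup_conj_class G ` ?M \<subseteq> subgroup_conj_class G ` {H. nsn H \<and> card H = p ^ n}"
    using mx(1,4)[OF n0] by blast
  from card_mono[OF finite_imageI[OF finite_nsn_card] this]
  have "card ?M \<le> ncls (p ^ n)" unfolding ncls_def cM .
  moreover have "card ?M > p" by (rule card_maxes_gt[OF subgroup_self c P(2) nc])
  moreover have "p \<ge> 2" using P(2) prime_ge_2_nat by blast
  \<comment> \<open>The orders \<open>p\<close> and \<open>p^2\<close> take two of the four classes,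
    which leaves two for the more than \<open>p \<ge> 2\<close> maximal subgroups;
    \<open>n \<ge> 3\<close> keeps the three orders distinct.\<close>
  moreover have "ncls (p ^ n) + card {p ^ 1, p ^ 2} \<le> D_count G"
  proof (rule ncls_bound)
    have "p ^ k \<in> nsn_orders" if "k > 0" "k < n" for k
      using nsn_orders_p[OF P(2) that(1)] that(2) P(1) by (simp add: le_imp_power_dvd del: power_Suc)
    from this[of 1] this[of 2] show "{p ^ 1, p ^ 2} \<subseteq> nsn_orders" using P(3) by simp
    show "p ^ n \<notin> {p ^ 1, p ^ 2}" using prime_power_inj[OF P(2), of n 1] prime_power_inj[OF P(2), of n 2] P(3) by auto
  qed simp
  moreover have "p ^ 1 \<noteq> p ^ 2" using prime_power_inj[OF P(2), of 1 2] by auto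
  then have "card {p ^ 1, p ^ 2} = 2" by simp
  ultimately show False using D by linarith
qed

lemma no_five_orders: "D_count G \<le> 4 \<Longrightarrow> S \<subseteq> nsn_orders \<Longrightarrow> card S = 5 \<Longrightarrow> False"
  using card_mono[OF finite_nsn_orders, of S] nsn_orders_le_D_count by simp

text \<open>For \<open>p \<noteq> t\<close> the commutator map with a fixed element is a
  homomorphism from a \<open>p\<close>-group into a \<open>t\<close>-group, so Sylow
  \<open>p\<close>-subgroups are central. The abelian Sylow \<open>t\<close>-subgroup is then
  centralized by every Sylow subgroup, and is central too.\<close>

lemma abelian_of_central_derived:
  assumes M: "subgroup M G" and V: "derived G M \<subseteq> cent M" "card (derived G M) = t ^ k" "prime t"
    and ab: "\<And>p Y. prime p \<Longrightarrow> sylow_in p M Y \<Longrightarrow> Y \<subseteq> cent Y"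
  shows "M \<subseteq> cent M"
proof -
  have Mc: "M \<subseteq> carrier G" using subgroup.subset[OF M] .
  have sV: "subgroup (derived G M) G" by (rule derived_is_subgroup[OF Mc])
  have inV: "comm x y \<in> derived G M" if "x \<in> M" "y \<in> M" for x y
    using derived_subset_iff[OF sV Mc] that by blast
  have other: "Y \<subseteq> cent M" if p: "prime p" "p \<noteq> t" and Y: "sylow_in p M Y" for p Y
  proof
    fix y assume y: "y \<in> Y"
    have sY: "subgroup Y G" "Y \<subseteq> M" "card Y = p ^ multiplicity p (card M)" using Y unfolding sylow_in_def by auto
    have "m \<otimes> y = y \<otimes> m" if m: "m \<in> M" for m
    proof -
      have mc: "m \<in> carrier G" using m Mc by blast
      have "comm m g \<in> cent Y" if "g \<in> Y" for g
        using inV[OF m] sY(2) V(1) cent_mono[OF sY(2)] that by blast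
      note im = comm_image_central[OF sY(1) mc this]
      have KV: "comm m ` Y \<subseteq> derived G M" using inV[OF m] sY(2) by blast
      have "card (comm m ` Y) dvd card Y" using im(2) by (metis dvd_triv_left)
      moreover have "card (comm m ` Y) dvd t ^ k" using sub_dvd[OF im(1) sV KV] V(2) by simp
      moreover have "coprime (card Y) (t ^ k)" unfolding sY(3) using primes_coprime[OF p(1) V(3) p(2)] by simp
      ultimately have "card (comm m ` Y) = 1" using coprime_common_divisor_nat by blast
      then have "comm m y = \<one>" using card_eq_one[OF im(1)] y by blast
      then show ?thesis using comm_one_iff[OF mc] y sY(2) Mc by blast
    qed
    then show "y \<in> cent M" unfolding cent_def using y sY(2) Mc by auto
  qed
  obtain T where T: "sylow_in t M T" using sylow_in_exists[OF M V(3)] by blast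
  have sT: "subgroup T G" "T \<subseteq> M" using T unfolding sylow_in_def by auto
  have sylT: "\<exists>Y. sylow_in p M Y \<and> Y \<subseteq> M \<inter> cent C" if p: "prime p" and C: "C \<subseteq> M" "T \<subseteq> cent C" for p C
  proof (cases "p = t")
    case True then show ?thesis using T sT C by blast
  next
    case False
    obtain Y where "sylow_in p M Y" using sylow_in_exists[OF M p] by blast
    then show ?thesis using other[OF p False] cent_mono[OF C(1)] unfolding sylow_in_def by blast
  qed
  have "M \<inter> cent T = M"
    by (rule eq_of_contains_sylows[OF M Int_subgroup[OF M cent_subgroup[OF subgroup.subset[OF sT(1)]]]])
       (use sylT[OF _ sT(2) ab[OF V(3) T]] in auto)
  then have "T \<subseteq> cent M" using cent_sym[of M T] subgroup.subset[OF sT(1)] by blast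
  then have "M \<inter> cent M = M"
    by (intro eq_of_contains_sylows[OF M Int_subgroup[OF M cent_subgroup[OF Mc]]])
       (use sylT[OF _ subset_refl] in auto)
  then show ?thesis by blast
qed

lemma dvd_prime_times_prime:
  fixes d q s :: nat
  assumes "prime q" "prime s" "d dvd q * s"
  shows "d = 1 \<or> d = q \<or> d = s \<or> d = q * s"
proof -
  obtain a b where "d = a * b" "a dvd q" "b dvd s" using division_decomp[OF assms(3)] by blast
  then show ?thesis using assms(1,2) prime_nat_iff by (metis mult_1 mult_1_right)
qed

text \<open>The four orders in \<open>O\<close> use up all classes, one for each. If \<open>s = q\<close>, then \<open>G/V\<close> is abelian, against \<open>M = G'\<close>. If \<open>s = t\<close>,
  then \<open>V\<close> is the only maximal subgroup of a Sylow \<open>t\<close>-subgroup \<open>T\<close>, so \<open>T\<close> is cyclic, hence normal, and has a fifth order.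
  Otherwise \<open>G\<close> permutes the \<open>t + 1\<close> subgroups of order \<open>t\<close> in \<open>V\<close> transitively, so \<open>t + 1\<close> divides \<open>q s\<close>. The main
  case is \<open>s = 2\<close>, where an involution inverts \<open>V\<close>; it is then central modulo \<open>V\<close>, and \<open>G/V\<close> is abelian again.\<close>

lemma no_metabelian_by_cyclic:
  assumes D: "D_count G \<le> 4" and M: "M \<lhd> G" "M = derived G (carrier G)" and s: "prime s" "order G = s * card M"
    and c: "card M = t ^ 2 * q" "prime t" "prime q" "t \<noteq> q"
    and V: "V \<lhd> G" "V \<subseteq> M" "card V = t ^ 2" and nc: "\<not> cyc V" and VM: "\<not> V \<subseteq> cent M"
    and O: "{t, t ^ 2, q, card M} \<subseteq> nsn_orders"
  shows False
proof -
  have sM: "subgroup M G" "nzr M = carrier G" using M(1) normal_iff_nzr by auto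
  have sV: "subgroup V G" "nzr V = carrier G" using V(1) normal_iff_nzr by auto
  have Vc: "V \<subseteq> carrier G" and Mc: "M \<subseteq> carrier G" using subgroup.subset sV(1) sM(1) by blast+
  have t1: "t > 1" and q1: "q > 1" using c prime_gt_1_nat by blast+
  have ne: "t \<noteq> t ^ 2" "t ^ 2 \<noteq> q" "t ^ 2 \<noteq> card M" "t \<noteq> card M" "q \<noteq> card M"
  proof -
    show "t \<noteq> t ^ 2" using t1 by (simp add: power2_eq_square)
    show "t ^ 2 \<noteq> q" using prime_power_ne[OF c(2,3,4), of 2 1] by simp
    show "t ^ 2 \<noteq> card M" using c(1) q1 t1 by simp
    show "t \<noteq> card M" using c(1) q1 t1 by (auto simp: power2_eq_square)
    show "q \<noteq> card M" using c(1) q1 t1 by (auto simp: power2_eq_square)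
  qed
  let ?S = "{t, t ^ 2, q, card M}"
  have "card ?S = 4" using ne c(4) by auto
  then have S: "finite ?S" "?S \<subseteq> nsn_orders" "card ?S \<ge> D_count G" using O D by auto
  note uniq = nsn_conj_unique[OF S]
  have eqO: "nsn_orders = ?S" by (rule nsn_orders_eq[OF S])
  have Vab: "V \<subseteq> cent V" by (rule abelian_order_le_p_squared[OF sV(1) V(3) c(2)]) simp
  have noab: "\<not> (\<forall>x\<in>carrier G. \<forall>y\<in>carrier G. comm x y \<in> V)"
  proof
    assume "\<forall>x\<in>carrier G. \<forall>y\<in>carrier G. comm x y \<in> V"
    then have "M \<subseteq> V" unfolding M(2) using derived_subset_iff[OF sV(1) subset_refl] by blast
    then have "M = V" using V(2) by blast
    then show False using V(3) ne(3) by simp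
  qed
  \<comment> \<open>\<open>V\<close> is abelian, of prime index \<open>q\<close> in
    \<open>M\<close>, and not central in \<open>M\<close>.\<close>
  have CV: "M \<inter> cent V = V"
  proof -
    have sC: "subgroup (M \<inter> cent V) G" using Int_subgroup[OF sM(1) cent_subgroup[OF Vc]] .
    have i: "V \<subseteq> M \<inter> cent V" using V(2) Vab by blast
    obtain k where k: "card (M \<inter> cent V) = t ^ 2 * k" using sub_dvd[OF sV(1) sC i] V(3) by auto
    have "card (M \<inter> cent V) dvd card M" using sub_dvd[OF sC sM(1)] by blast
    then have "k dvd q" using k c(1) t1 by simp
    moreover have "k \<noteq> q"
    proof
      assume "k = q"
      then have "M \<inter> cent V = M" using sub_eqI[OF sC sM(1)] k c(1) by auto
      then have "V \<subseteq> cent M" using cent_sym[of M V] Vc by blast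
      then show False using VM by blast
    qed
    ultimately have "k = 1" using c(3) prime_nat_iff by blast
    then show ?thesis using sub_eqI[OF sV(1) sC i] k V(3) by simp
  qed
  have oG: "order G = t ^ 2 * (q * s)" using s(2) c(1) by (simp add: mult_ac)
  have sqt: "t ^ Suc 1 dvd order G" using oG by (simp add: power2_eq_square)
  have o3: "order (G Mod V) = q * s"
    using fact_order[OF V(1)] V(3) oG t1 by (simp add: mult.commute)
  have nV: "nsn V" using nsn_normal[OF V(1)] V(2,3) c(1) ne card_eq_one[OF sV(1)] t1 sub_eqI M
    by (metis Mc one_less_power less_irrefl subset_antisym zero_less_numeral)
  consider "s = q" | "s = t" | "s \<noteq> q" "s \<noteq> t" by blast
  then show False
  proof cases
    case 1
    interpret Q: fin_group "G Mod V" by (rule fact_fin_group[OF V(1)])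
    have "carrier (G Mod V) \<subseteq> Q.cent (carrier (G Mod V))"
      using Q.abelian_order_le_p_squared[OF Q.subgroup_self _ c(3), of 2] o3 1 by (simp add: order_def power2_eq_square)
    then show False using fact_comm[OF V(1)] noab by blast
  next
    case 2
    have o: "order G = t ^ 3 * q" using oG 2 by (simp add: power3_eq_cube power2_eq_square)
    have "\<not> t dvd q" using c primes_dvd_imp_eq by blast
    then have mt: "multiplicity t (order G) = 3" using multiplicity_prime_power_times[OF c(2)] o by simp
    obtain T where T: "sylow_in t (carrier G) T" "V \<subseteq> T"
      using sylow_in_over[OF subgroup_self c(2) sV(1) Vc V(3)] by blast
    have sT: "subgroup T G" "card T = t ^ Suc 2" using T mt unfolding sylow_in_def order_def by auto
    have "W = V" if W: "W \<in> maxes t T" for W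
    proof -
      have w: "nsn W" "card W = t ^ 2" using maxes_nsn[OF sT c(2) _ W] by auto
      obtain g where "g \<in> carrier G" "cj g ` V = W" using uniq[OF nV w(1)] w(2) V(3) by auto
      then show ?thesis using sV(2) unfolding nzr_def by blast
    qed
    then have "maxes t T \<subseteq> {V}" by blast
    then have "card (maxes t T) \<le> 1" using card_mono[of "{V}"] by fastforce
    then have "cyc T" using card_maxes_gt[OF sT c(2)] t1 by fastforce
    then have "T \<subseteq> cent T" by (rule cyc_abelian[OF sT(1)])
    then have TC: "T \<subseteq> cent V" using cent_mono[OF T(2)] by blast
    have sC: "subgroup (cent V) G" by (rule cent_subgroup[OF Vc])
    obtain k where k: "card (cent V) = t ^ 3 * k" using sub_dvd[OF sT(1) sC TC] sT(2) by auto
    have "t ^ 3 * k dvd t ^ 3 * q" using order_dvd[OF sC] k o by simp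
    then have "k dvd q" using t1 by simp
    moreover have "k \<noteq> q"
    proof
      assume "k = q"
      then have "cent V = carrier G" using sub_eqI[OF sC subgroup_self subgroup.subset[OF sC]] k o by (simp add: order_def)
      then have "M \<inter> cent V = M" using Mc by blast
      then show False using CV V(3) ne(3) by simp
    qed
    ultimately have "k = 1" using c(3) prime_nat_iff by blast
    \<comment> \<open>As the centralizer of the normal subgroup \<open>V\<close>, \<open>T\<close>
      is normal, and its order \<open>t^3\<close> is not among the four.\<close>
    then have "cent V = T" using sub_eqI[OF sT(1) sC TC] k sT(2) by simp
    then have "nzr T = carrier G" using nzr_cent[OF Vc] sV(2) nzr_subset by blast
    then have nT: "T \<lhd> G" using sT(1) normal_iff_nzr by blast
    have "T \<noteq> carrier G" using sT(2) o q1 t1 by (auto simp: order_def)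
    moreover have "T \<noteq> {\<one>}" using sT t1 by (metis card_eq_one[OF sT(1)] one_less_power less_irrefl zero_less_Suc)
    ultimately have "t ^ Suc 2 \<in> ?S" using nsn_orderI[OF nsn_normal[OF nT]] eqO sT(2) by simp
    moreover have "t ^ Suc 2 \<noteq> t ^ 1" "t ^ Suc 2 \<noteq> t ^ 2" using prime_power_inj[OF c(2), of "Suc 2"] by fastforce+
    moreover have "t ^ Suc 2 \<noteq> q ^ 1" by (rule prime_power_ne[OF c(2,3,4)]) simp
    moreover have "t ^ Suc 2 \<noteq> card M"
    proof
      assume "t ^ Suc 2 = card M"
      then have "t ^ 2 * t = t ^ 2 * q" unfolding c(1) power_Suc2 .
      then have "t = q" using t1 by simp
      then show False using c(4) by simp
    qed
    ultimately show False by simp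
  next
    case 3
    obtain Q where Q: "subgroup Q G" "card Q = s ^ 1"
      using subgroup_of_prime_power_exists[OF subgroup_self s(1), of 1] s(2) by (auto simp: order_def)
    have Q1: "card Q = s" "Q \<noteq> {\<one>}" using Q(2) s(1) by auto
    have sn: "nzr Q = Q"
    proof (rule ccontr)
      assume "nzr Q \<noteq> Q"
      then have "s \<in> ?S" using nsnI[OF Q(1) Q1(2)] nsn_orderI Q1(1) eqO by blast
      moreover have "\<not> prime (t ^ 2)" by (simp add: prime_power_iff)
      moreover have "s \<noteq> card M"
      proof
        assume "s = card M"
        then have "t dvd s" using c(1) by (simp add: power2_eq_square)
        then show False using primes_dvd_imp_eq[OF c(2) s(1)] 3(2) by simp
      qed
      ultimately show False using 3 s(1) by auto
    qed
    have sdt: "\<not> s dvd t" using s(1) c(2) 3(2) primes_dvd_imp_eq by blast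
    have sdV: "\<not> s dvd card V" unfolding V(3) using sdt s(1) prime_dvd_power_nat by blast
    have svV: "s dvd t ^ 2 - 1"
      using self_normalizing_prime_dvd[OF Q(1) Q1(1) s(1) sn sV(1) sdV] sV(2) V(3) subgroup.subset[OF Q(1)] by simp
    let ?L = "maxes t V"
    have V2: "card V = t ^ Suc 1" using V(3) by (simp add: power2_eq_square)
    have L: "subgroup U G" "U \<subseteq> V" "card U = t" if "U \<in> ?L" for U
      using that maxes_iff[OF c(2) V2] by auto
    \<comment> \<open>The maximal subgroups of \<open>V\<close> have order \<open>t\<close>, meet
      trivially, and cover \<open>V\<close> because it is not cyclic:
      \<open>t^2 - 1 = (t + 1) (t - 1)\<close>.\<close>
    have cL: "card ?L = t + 1"
    proof -
      have u: "\<Union>?L - {\<one>} = V - {\<one>}" using element_in_maximal[OF sV(1) V2 c(2) nc] L(2) by blast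
      have "card (\<Union>?L - {\<one>}) = card ?L * (t - 1)"
      proof (rule card_TI_family[OF finite_maxes[OF sV(1)]])
        show "subgroup H G \<and> card H = t" if "H \<in> ?L" for H using L that by blast
        show "H \<inter> K = {\<one>}" if "H \<in> ?L" "K \<in> ?L" "H \<noteq> K" for H K
          using prime_order_Int[OF L(1)[OF that(1)] L(1)[OF that(2)] L(3)[OF that(1)] L(3)[OF that(2)] c(2) that(3)] .
      qed
      then have "card ?L * (t - 1) = t ^ 2 - 1"
        unfolding u using V(3) subgroup.one_closed[OF sV(1)] by (simp add: card_Diff_singleton)
      moreover have "t ^ 2 - 1 = (t + 1) * (t - 1)" by (simp add: power2_eq_square algebra_simps)
      ultimately show ?thesis using t1 by (metis mult_cancel2 less_irrefl zero_less_diff)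
    qed
    obtain X0 where X0: "X0 \<in> ?L" using cL by fastforce
    have nL: "nsn U" if "U \<in> ?L" for U using nsn_p[OF L(1)[OF that] _ c(2) _ sqt] L(3)[OF that] by simp
    have "?L = (\<lambda>g. cj g ` X0) ` carrier G"
    proof
      show "(\<lambda>g. cj g ` X0) ` carrier G \<subseteq> ?L" using maxes_cj[OF V(1) _ X0] by blast
      show "?L \<subseteq> (\<lambda>g. cj g ` X0) ` carrier G"
      proof
        fix U assume U: "U \<in> ?L"
        obtain g where "g \<in> carrier G" "cj g ` X0 = U" using uniq[OF nL[OF X0] nL[OF U]] L(3)[OF U] L(3)[OF X0] by auto
        then show "U \<in> (\<lambda>g. cj g ` X0) ` carrier G" by blast
      qed
    qed
    then have oc: "card ?L * card (carrier G \<inter> nzr X0) = order G"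
      using card_conjugates[OF subgroup.subset[OF L(1)[OF X0]] subgroup_self] by (simp add: order_def)
    have sN: "subgroup (nzr X0) G" by (rule nzr_subgroup[OF subgroup.subset[OF L(1)[OF X0]]])
    have "V \<subseteq> nzr X0" using Vab cent_mono[OF L(2)[OF X0]] cent_le_nzr[OF L(1)[OF X0]] by blast
    then obtain w where w: "card (nzr X0) = t ^ 2 * w" using sub_dvd[OF sV(1) sN] V(3) by auto
    have "carrier G \<inter> nzr X0 = nzr X0" using nzr_subset by blast
    with oc have "(t + 1) * (t ^ 2 * w) = t ^ 2 * (q * s)" unfolding cL oG by (simp only: w)
    then have "t ^ 2 * ((t + 1) * w) = t ^ 2 * (q * s)" by (simp only: mult.left_commute)
    then have "(t + 1) * w = q * s" using t1 by simp
    then have "t + 1 dvd q * s" by (metis dvd_triv_left)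
    then have "t + 1 = 1 \<or> t + 1 = q \<or> t + 1 = s \<or> t + 1 = q * s" by (rule dvd_prime_times_prime[OF c(3) s(1)])
    then consider "t + 1 = q" | "t + 1 = s" | "t + 1 = q * s" using t1 by linarith
    then show False
    proof cases
      case 1
      \<comment> \<open>Now \<open>s\<close> divides \<open>t^2 - 1 = 3\<close>, which contradicts
        \<open>s \<noteq> q\<close>.\<close>
      then have "t = 2" "q = 3" using primes_consecutive[OF c(2)] c(3) by auto
      then have "s dvd 3" using svV by simp
      then have "s = 3" using s(1) primes_dvd_imp_eq[of s 3] by simp
      then show False using 3(1) \<open>q = 3\<close> by simp
    next
      case 2
      then have t2: "t = 2" "s = 3" using primes_consecutive[OF c(2)] s(1) by auto
      obtain R where R: "subgroup R G" "R \<subseteq> M" "card R = q ^ 1"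
        using subgroup_of_prime_power_exists[OF sM(1) c(3), of 1] c(1) by auto
      \<comment> \<open>A Sylow \<open>q\<close>-subgroup of \<open>M\<close> moves 3 or 2 of the
        four elements of \<open>V\<close>, so \<open>q\<close> would be 3 or 2, that is
        \<open>s\<close> or \<open>t\<close>.\<close>
      let ?F = "{x \<in> V. \<forall>g\<in>R. cj g x = x}"
      have F: "?F = V \<inter> cent R"
        using Vc subgroup.subset[OF R(1)] cj_eq_iff unfolding cent_def by (auto simp: subset_iff)
      have sF: "subgroup ?F G" unfolding F using Int_subgroup[OF sV(1) cent_subgroup[OF subgroup.subset[OF R(1)]]] .
      have qd: "q dvd card (V - ?F)"
        by (rule prime_dvd_moved_points[OF R(1,3) c(3) Vc])
           (use R(2) Mc sV(2) nzrD in blast)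
      have "card ?F dvd 4" using sub_dvd[OF sF sV(1)] V(3) t2 by auto
      moreover have "card ?F \<le> 4" using calculation by (auto dest: dvd_imp_le)
      ultimately have "card ?F = 1 \<or> card ?F = 2 \<or> card ?F = 4"
      proof -
        assume a: "card ?F dvd 4" "card ?F \<le> 4"
        have "card ?F = 0 \<or> card ?F = 1 \<or> card ?F = 2 \<or> card ?F = 3 \<or> card ?F = 4" using a(2) by presburger
        then show ?thesis using a(1) by (elim disjE) auto
      qed
      moreover have "card (V - ?F) = 4 - card ?F" using card_Diff_subset[OF sub_finite[OF sF], of V] V(3) t2 by auto
      moreover have "card ?F \<noteq> 4"
      proof
        assume "card ?F = 4"
        then have "?F = V" using sub_eqI[OF sF sV(1)] V(3) t2 by auto
        then have "R \<subseteq> cent V" using F cent_sym[of V R] subgroup.subset[OF R(1)] by blast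
        then have "R \<subseteq> V" using CV R(2) by blast
        then have "q ^ 1 dvd t ^ 2" using sub_dvd[OF R(1) sV(1)] R(3) V(3) by simp
        then show False using c prime_dvd_power_nat primes_dvd_imp_eq by (metis power_one_right)
      qed
      ultimately have "q dvd 3 \<or> q dvd 2" using qd by auto
      then have "q = 3 \<or> q = 2" using c(3) primes_dvd_imp_eq[of q 3] primes_dvd_imp_eq[of q 2] by auto
      then show False using 3(1) t2 c(4) by auto
    next
      case 3
      \<comment> \<open>For \<open>t = 2\<close> a product of two primes would be 3. So
        \<open>t + 1 = q s\<close> is even, and one of \<open>q\<close>, \<open>s\<close> is
        2.\<close>
      have "t \<noteq> 2"
      proof
        assume "t = 2"
        then have "q * s = 3" using 3 by simp
        moreover have "2 * 2 \<le> q * s" using c(3) s(1) prime_ge_2_nat by (intro mult_le_mono) auto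
        ultimately show False by simp
      qed
      then have "odd t" using c(2) prime_odd_nat t1 by (metis prime_ge_2_nat le_neq_implies_less)
      then have "even (q * s)" using 3[symmetric] by simp
      then have "q = 2 \<or> s = 2" using c(3) s(1) by (metis even_mult_iff primes_dvd_imp_eq two_is_prime_nat)
      then show False
      proof
        assume q2: "q = 2"
        \<comment> \<open>\<open>V\<close> has index 2 in \<open>M\<close>, so \<open>M\<close> is
          central modulo \<open>V\<close>; as \<open>M\<close> has prime index, \<open>G\<close> is
          abelian modulo \<open>V\<close>.\<close>
        have idx: "a \<otimes> b \<in> V" if ab: "a \<in> M" "a \<notin> V" "b \<in> M" "b \<notin> V" for a b
        proof -
          have abc: "a \<in> carrier G" "b \<in> carrier G" using ab Mc by auto
          have "V #> inv b \<in> rcosets V" "V #> \<one> \<in> rcosets V" using rcosetsI[OF Vc] abc by auto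
          then have cc: "card (V #> inv b) = card V" using card_rcosets_equal[OF _ Vc] by simp
          have ib: "inv b \<notin> V" using ab(4) abc subgroup.m_inv_closed[OF sV(1)] by (metis inv_inv)
          have disj: "V \<inter> (V #> inv b) = {}"
          proof (rule ccontr)
            assume "V \<inter> (V #> inv b) \<noteq> {}"
            then obtain v where v: "v \<in> V" "v \<in> V #> inv b" by blast
            then obtain u where u: "u \<in> V" "v = u \<otimes> inv b" unfolding r_coset_def by auto
            then have "inv u \<otimes> v = inv b" using abc Vc by auto
            moreover have "inv u \<otimes> v \<in> V" using u(1) v(1) sV(1) by (simp add: subgroup.m_closed subgroup.m_inv_closed)
            ultimately show False using ib by simp
          qed
          have sub: "V \<union> (V #> inv b) \<subseteq> M"
            using V(2) ab(3) sM(1) unfolding r_coset_def by (auto simp: subgroup.m_closed subgroup.m_inv_closed subset_iff)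
          have fV: "finite (V #> inv b)" using finite_subset[OF _ sub_finite[OF sM(1)]] sub by blast
          have "card (V \<union> (V #> inv b)) = card M"
            using card_Un_disjoint[OF sub_finite[OF sV(1)] fV disj] cc V(3) c(1) q2 by simp
          then have "V \<union> (V #> inv b) = M" using sub sub_finite[OF sM(1)] by (intro card_subset_eq) auto
          then have "a \<in> V #> inv b" using ab by blast
          then obtain u where "u \<in> V" "a = u \<otimes> inv b" unfolding r_coset_def by auto
          then have "a \<otimes> b = u" using abc Vc by (auto simp: m_assoc)
          then show ?thesis using \<open>u \<in> V\<close> by simp
        qed
        have "comm a h \<in> V" if a: "a \<in> M" and h: "h \<in> carrier G" for a h
        proof (cases "a \<in> V")
          case True then show ?thesis using comm_in_normalized[OF sV(1)] sV(2) h by blast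
        next
          case False
          have ac: "a \<in> carrier G" using a Mc by blast
          have ia: "inv a \<in> M" "inv a \<notin> V"
            using a False ac subgroup.m_inv_closed[OF sM(1)] subgroup.m_inv_closed[OF sV(1)] by (auto, metis inv_inv)
          have "cj h (inv a) \<in> M" using nzrD[of h M] sM(2) h ia by blast
          moreover have "cj h (inv a) \<notin> V"
          proof
            assume "cj h (inv a) \<in> V"
            then have "cj (inv h) (cj h (inv a)) \<in> V" using nzrD[of "inv h" V] sV(2) h by blast
            then show False using ia h ac by simp
          qed
          ultimately have "a \<otimes> cj h (inv a) \<in> V" using idx[OF a False] by blast
          moreover have "comm a h = a \<otimes> cj h (inv a)" using ac h by (simp add: comm_def cj_def m_assoc)
          ultimately show ?thesis by simp
        qed
        then have "comm x y \<in> V" if "x \<in> carrier G" "y \<in> carrier G" for x y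
          using commutators_from_prime_index[OF subgroup_self sV(1) _ sM(1) Mc _ s(1) _ that] s(2) sV(2)
          by (simp add: order_def)
        then show False using noab by blast
      next
        assume s2: "s = 2"
        obtain g where g: "g \<in> Q" "g \<noteq> \<one>" using Q1(2) subgroup.one_closed[OF Q(1)] by blast
        have gc: "g \<in> carrier G" using g subgroup.mem_carrier[OF Q(1)] by blast
        have "card {\<one>, g} = card Q" using g(2) Q1(1) s2 by simp
        then have Qg: "Q = {\<one>, g}"
          using card_subset_eq[OF sub_finite[OF Q(1)], of "{\<one>, g}"] g subgroup.one_closed[OF Q(1)] by blast
        have "g \<otimes> g \<in> Q" using subgroup.m_closed[OF Q(1)] g by blast
        then have gg: "g \<otimes> g = \<one>" using Qg g(2) gc by auto
        have inv: "cj g v = inv v" if v: "v \<in> V" for v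
        proof (rule fpf_involution_inverts[OF sV(1) _ gg _ v])
          show "g \<in> nzr V" using sV(2) gc by simp
          fix x assume x: "x \<in> V" "cj g x = x"
          have "cj h x = x" if "h \<in> Q" for h using that Qg x Vc by auto
          then show "x = \<one>"
            by (rule self_normalizing_fixes_nothing[OF Q(1) Q1(1) s(1) sn sV(1) sdV x(1)])
        qed
        let ?B = "{a \<in> carrier G. \<forall>h\<in>carrier G. comm h a \<in> V}"
        have nVV: "carrier G \<subseteq> nzr V" using sV(2) by simp
        have sB: "subgroup ?B G" by (rule central_mod_subgroup[OF subgroup_self sV(1) nVV])
        have VB: "V \<subseteq> ?B" using comm_in_normalized(2)[OF sV(1)] sV(2) Vc by blast
        have gB: "g \<in> ?B"
        proof -
          \<comment> \<open>\<open>g\<close> and its conjugate by \<open>h\<close> both invert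
            \<open>V\<close>, so their product \<open>comm g h\<close> centralizes \<open>V\<close>
            and lies in \<open>M \<inter> cent V = V\<close>.\<close>
          have "comm g h \<in> V" if h: "h \<in> carrier G" for h
          proof -
            have cc: "comm g h \<in> carrier G" using gc h by simp
            have "cj (comm g h) v = v" if v: "v \<in> V" for v
            proof -
              have vc: "v \<in> carrier G" using v Vc by blast
              define u where "u = cj (inv h) v"
              have u: "u \<in> V" unfolding u_def using nzrD[of "inv h" V v] sV(2) h v by simp
              then have uc: "u \<in> carrier G" using Vc by blast
              have ig: "inv g = g" using gg gc by (simp add: inv_equality)
              have "comm g h = g \<otimes> (h \<otimes> (g \<otimes> inv h))" using gc h ig by (simp add: comm_def m_assoc)
              then have "cj (comm g h) v = cj g (cj h (cj g u))"
                unfolding u_def using cj_comp gc h vc by simp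
              also have "\<dots> = cj g (inv (cj h u))" using inv[OF u] cj_inv[OF h uc] by simp
              also have "cj h u = v" unfolding u_def using h vc by simp
              also have "cj g (inv v) = inv (inv v)" using inv[OF v] cj_inv[OF gc vc] by simp
              finally show ?thesis using vc by simp
            qed
            then have "comm g h \<in> cent V" using cent_iff_cj[OF Vc] cc by blast
            moreover have "comm g h \<in> M" unfolding M(2)
              using derived_subset_iff[OF derived_is_subgroup[OF subset_refl] subset_refl] gc h by blast
            ultimately show ?thesis using CV by blast
          qed
          then have "comm h g \<in> V" if "h \<in> carrier G" for h
            using comm_swap[OF gc that] subgroup.m_inv_closed[OF sV(1)] that by simp
          then show ?thesis using gc by blast
        qed
        obtain b where b: "card ?B = t ^ 2 * b" using sub_dvd[OF sV(1) sB VB] V(3) by auto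
        have "t ^ 2 * b dvd t ^ 2 * (q * s)" using order_dvd[OF sB] b oG by simp
        then have "b dvd q * s" using t1 by simp
        then have "b = 1 \<or> b = q \<or> b = s \<or> b = q * s" by (rule dvd_prime_times_prime[OF c(3) s(1)])
        \<comment> \<open>\<open>g\<close> lies in \<open>?B\<close> but not in \<open>V\<close>, so
          the index of \<open>?B\<close> is 1 or a prime and \<open>G\<close> is abelian modulo
          \<open>V\<close>.\<close>
        moreover have "b \<noteq> 1"
        proof
          assume "b = 1"
          then have "V = ?B" using sub_eqI[OF sV(1) sB VB] b V(3) by simp
          then have "g \<in> V" using gB by blast
          moreover have "coprime (card Q) (card V)" using Q1(1) sdV s(1) prime_imp_coprime by blast
          then have "Q \<inter> V = {\<one>}" by (rule coprime_Int[OF Q(1) sV(1)])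
          ultimately show False using g by blast
        qed
        ultimately have "card (carrier G) = card ?B \<or> (\<exists>q. prime q \<and> card (carrier G) = q * card ?B)"
          using b oG c(3) s(1) by (auto simp: order_def mult_ac)
        then have "comm x y \<in> V" if "x \<in> carrier G" "y \<in> carrier G" for x y
          using commutators_from_central_mod[OF subgroup_self sV(1) nVV refl _ that] by blast
        then show False using noab by blast
      qed
    qed
  qed
qed

text \<open>Five orders arise unless \<open>card M\<close> is cube-free and the proper nontrivial
  normal subgroups of \<open>G\<close> inside \<open>M\<close> have order \<open>r\<close> or
  \<open>r^2\<close>, \<open>r\<close> prime. This forces \<open>M\<close> to be the derived
  subgroup, its own derived subgroup to be noncyclic of order \<open>t^2\<close>, and
  \<open>card M = t^2 q\<close>.\<close>

lemma prime_index_derived_case: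
  assumes D: "D_count G \<le> 4" and sol: "solvable G" and d: "(derived G ^^ 2) (carrier G) \<noteq> {\<one>}"
    and M: "M \<lhd> G" "derived G (carrier G) \<subseteq> M" and s: "prime s" "order G = s * card M"
    and mixed: "\<And>r a. prime r \<Longrightarrow> card M \<noteq> r ^ a"
  shows False
proof -
  have sM: "subgroup M G" and nM: "nzr M = carrier G" using M(1) normal_iff_nzr by auto
  have Mc: "M \<subseteq> carrier G" using subgroup.subset[OF sM] .
  have m0: "card M > 0" by (rule card_pos[OF sM])
  have na: "\<not> M \<subseteq> cent M" by (rule derived_nonabelian[OF sM M(2) d])
  have M1: "M \<noteq> {\<one>}" using mixed[OF two_is_prime_nat, of 0] card_eq_one[OF sM] by auto
  have MG: "M \<noteq> carrier G"
  proof
    assume "M = carrier G"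
    then have "s * card M = card M" using s(2) unfolding order_def by metis
    then have "s = 1" using m0 by simp
    then show False using s by simp
  qed
  have mO: "card M \<in> nsn_orders" by (rule nsn_orderI[OF nsn_normal[OF M(1) M1 MG]])
  have O: "r ^ k \<in> nsn_orders" if "prime r" "k > 0" "r ^ k dvd card M" for r k
    by (rule nsn_orders_prime_index[OF M(1) s that])
  have O1: "r \<in> nsn_orders" if "prime r" "r dvd card M" for r using O[OF that(1), of 1] that(2) by simp
  have ppm: "r ^ k \<noteq> card M" if "prime r" for r k using mixed[OF that, of k] by simp
  have pm: "r \<noteq> card M" if "prime r" for r using mixed[OF that, of 1] by auto
  have other: "\<exists>q. prime q \<and> q dvd c \<and> q \<noteq> p" if "prime p" "c > 0" "\<And>a. c \<noteq> p ^ a" for p c :: nat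
    using power_of_only_prime_divisor[OF that(2,1)] that(3) by blast
  \<comment> \<open>\<open>p\<close>, \<open>p^2\<close>, \<open>p^3\<close>, a second prime and
    \<open>card M\<close> would be five orders. So the Sylow subgroups of \<open>M\<close> are
    abelian.\<close>
  have cube: "\<not> p ^ 3 dvd card M" if p: "prime p" for p
  proof
    assume c: "p ^ 3 dvd card M"
    obtain q where q: "prime q" "q dvd card M" "q \<noteq> p" using other[OF p m0] mixed[OF p] by blast
    have "p ^ k dvd card M" if "k \<le> 3" for k using c that by (meson dvd_trans le_imp_power_dvd)
    then have "p ^ k \<in> nsn_orders" if "0 < k" "k \<le> 3" for k using O[OF p that(1)] that(2) by blast
    from this[of 1] this[of 2] this[of 3]
    have "{p ^ 1, p ^ 2, p ^ 3, q, card M} \<subseteq> nsn_orders" using O1[OF q(1,2)] mO by simp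
    moreover have "card {p ^ 1, p ^ 2, p ^ 3, q, card M} = 5"
    proof -
      have e: "p ^ i = p ^ j \<longleftrightarrow> i = j" for i j using prime_power_inj[OF p] by blast
      have "p ^ 1 \<noteq> p ^ 2" "p ^ 1 \<noteq> p ^ 3" "p ^ 2 \<noteq> p ^ 3" unfolding e by simp_all
      moreover have "p ^ i \<noteq> q" if "i > 0" for i using prime_power_ne[OF p q(1) _ that, of 1] q(3) by auto
      from this[of 1] this[of 2] this[of 3] have "p \<noteq> q" "p ^ 2 \<noteq> q" "p ^ 3 \<noteq> q" by simp_all
      ultimately show ?thesis using ppm[OF p, of 2] ppm[OF p, of 3] pm[OF p] pm[OF q(1)] by simp
    qed
    ultimately show False using no_five_orders[OF D] by blast
  qed
  have sylab: "Y \<subseteq> cent Y" if p: "prime p" and Y: "sylow_in p M Y" for p Y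
  proof -
    have y: "subgroup Y G" "card Y = p ^ multiplicity p (card M)" using Y unfolding sylow_in_def by auto
    have "\<not> multiplicity p (card M) \<ge> 3"
    proof
      assume "multiplicity p (card M) \<ge> 3"
      then have "p ^ 3 dvd card M" by (rule multiplicity_dvd')
      then show False using cube[OF p] by blast
    qed
    then show ?thesis using abelian_order_le_p_squared[OF y p] by simp
  qed
  have proper: "\<exists>r k. prime r \<and> k \<le> 2 \<and> card Y = r ^ k" if Y: "Y \<lhd> G" "Y \<subseteq> M" "Y \<noteq> M" "Y \<noteq> {\<one>}" for Y
  proof (rule ccontr)
    assume c: "\<not> ?thesis"
    have sY: "subgroup Y G" using Y(1) normal_imp_subgroup by blast
    have Y0: "card Y > 0" by (rule card_pos[OF sY])
    have dY: "card Y dvd card M" by (rule sub_dvd[OF sY sM Y(2)])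
    have np: "card Y \<noteq> r ^ k" if r: "prime r" for r k
    proof
      assume e: "card Y = r ^ k"
      then have "\<not> k \<le> 2" using c r by blast
      then have "r ^ 3 dvd r ^ k" by (intro le_imp_power_dvd) simp
      then show False using cube[OF r] dY e dvd_trans by metis
    qed
    have "card Y \<noteq> 1" using np[OF two_is_prime_nat, of 0] by simp
    then obtain p where p: "prime p" "p dvd card Y" using prime_factor_nat by blast
    obtain q where q: "prime q" "q dvd card Y" "q \<noteq> p" using other[OF p(1) Y0 np[OF p(1)]] by blast
    obtain k where k: "card M = card Y * k" using dY by auto
    have "k \<noteq> 1" using k Y(3) sub_eqI[OF sY sM Y(2)] by auto
    then obtain l where l: "prime l" "l dvd k" using prime_factor_nat by blast
    \<comment> \<open>A fifth order besides \<open>p\<close>, \<open>q\<close>,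
      \<open>card Y\<close>, \<open>card M\<close>, taken from a prime \<open>l\<close> of the index
      of \<open>Y\<close> in \<open>M\<close>. If \<open>l\<close> is \<open>p\<close> or
      \<open>q\<close> it also divides \<open>card Y\<close>, so its square divides
      \<open>card M\<close>.\<close>
    define e where "e = (if l = p \<or> l = q then l ^ 2 else l ^ 1)"
    have eO: "e \<in> nsn_orders"
    proof (cases "l = p \<or> l = q")
      case True
      then have "l * l dvd card M" using p q l unfolding k by (auto intro: mult_dvd_mono)
      then show ?thesis unfolding e_def using True O[OF l(1), of 2] by (simp add: power2_eq_square)
    next
      case False
      have "l dvd card M" using l(2) unfolding k by simp
      then show ?thesis unfolding e_def using False O1[OF l(1)] by simp
    qed
    have epq: "e \<noteq> p" "e \<noteq> q"
    proof -
      have "\<not> prime (l ^ 2)" by (simp add: prime_power_iff)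
      then have "l = p \<or> l = q \<Longrightarrow> e \<noteq> p \<and> e \<noteq> q" unfolding e_def using p(1) q(1) by auto
      moreover have "\<not> (l = p \<or> l = q) \<Longrightarrow> e \<noteq> p \<and> e \<noteq> q" unfolding e_def by auto
      ultimately show "e \<noteq> p" "e \<noteq> q" by blast+
    qed
    have epw: "\<exists>j. e = l ^ j" 
      by (cases "l = p \<or> l = q") (auto simp only: e_def if_True if_False)
    have YG: "Y \<noteq> carrier G" using Y(2) MG Mc by blast
    have "card Y \<in> nsn_orders" by (rule nsn_orderI[OF nsn_normal[OF Y(1,4) YG]])
    then have "{p, q, e, card Y, card M} \<subseteq> nsn_orders"
      using eO mO O1[OF p(1)] O1[OF q(1)] p(2) q(2) dY dvd_trans by blast
    moreover have "card {p, q, e, card Y, card M} = 5"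
    proof -
      have "card Y \<noteq> card M" using k \<open>k \<noteq> 1\<close> Y0 by simp
      moreover have "e \<noteq> card Y" "e \<noteq> card M" using epw np[OF l(1)] mixed[OF l(1)] by metis+
      moreover have "p \<noteq> card Y" "q \<noteq> card Y" using np[OF p(1), of 1] np[OF q(1), of 1] by auto
      ultimately show ?thesis using pm[OF p(1)] pm[OF q(1)] q(3) epq by simp
    qed
    ultimately show False using no_five_orders[OF D] by blast
  qed
  let ?D = "derived G (carrier G)"
  have sD: "subgroup ?D G" by (rule derived_is_subgroup[OF subset_refl])
  have nD: "?D \<lhd> G" by (rule normal_if_contains_derived[OF sD subset_refl])
  \<comment> \<open>A derived subgroup properly inside \<open>M\<close> would have order at most the
    square of a prime and so be abelian.\<close>
  have MD: "M = ?D"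
  proof (rule ccontr)
    assume ne: "M \<noteq> ?D"
    have abD: "\<not> ?D \<subseteq> cent ?D" by (rule derived_nonabelian[OF sD subset_refl d])
    have "?D \<noteq> {\<one>}"
    proof
      assume "?D = {\<one>}"
      then show False using abD unfolding cent_def by auto
    qed
    then obtain r k where "prime r" "k \<le> 2" "card ?D = r ^ k" using proper[OF nD M(2)] ne by blast
    then show False using abelian_order_le_p_squared[OF sD] abD by blast
  qed
  let ?V = "derived G M"
  note nn = normal_abelian_data[OF M(1)]
  have sV: "subgroup ?V G" using nn(1) normal_imp_subgroup by blast
  have V1: "?V \<noteq> {\<one>}" using d unfolding MD by (simp add: numeral_2_eq_2)
  have VM: "?V \<noteq> M" by (rule solvable_derived_ne[OF sol sM M1])
  obtain t k where t: "prime t" "k \<le> 2" "card ?V = t ^ k" using proper[OF nn(1,3) VM V1] by blast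
  \<comment> \<open>A central \<open>?V\<close> would make \<open>M\<close> abelian, since its Sylow
    subgroups are. A cyclic \<open>?V\<close> would be centralized by the derived subgroup of
    \<open>G\<close>, which is \<open>M\<close>, and so be central.\<close>
  have nc: "\<not> ?V \<subseteq> cent M"
  proof
    assume "?V \<subseteq> cent M"
    then have "M \<subseteq> cent M" by (rule abelian_of_central_derived[OF sM _ t(3,1)]) (rule sylab)
    then show False using na by blast
  qed
  have Vc: "?V \<subseteq> carrier G" using subgroup.subset[OF sV] .
  have ncyc: "\<not> cyc ?V"
  proof
    assume "cyc ?V"
    then have "M \<subseteq> cent ?V" using derived_centralizes_cyc[OF nn(1)] MD by simp
    then show False using cent_sym[of M ?V] Vc nc by blast
  qed
  have "k \<noteq> 0" using t V1 card_eq_one[OF sV] by auto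
  moreover have "k \<noteq> 1" using t ncyc prime_order_cyc[OF sV] by auto
  ultimately have cV: "card ?V = t ^ 2" using t by (metis One_nat_def le_SucE le_zero_eq numeral_2_eq_2)
  obtain n where n: "card M = t ^ 2 * n" using sub_dvd[OF sV sM nn(3)] cV by auto
  have t1: "t > 1" using t(1) prime_gt_1_nat by blast
  have n0: "n > 0" using n m0 by (metis mult_0_right neq0_conv)
  have tn: "\<not> t dvd n"
  proof
    assume "t dvd n"
    then have "t ^ 2 * t dvd card M" unfolding n by simp
    then show False using cube[OF t(1)] by (simp add: power3_eq_cube power2_eq_square)
  qed
  obtain q where q: "prime q" "q dvd card M" "q \<noteq> t" using other[OF t(1) m0 mixed[OF t(1)]] by blast
  have td: "t dvd card M" "t ^ 2 dvd card M" unfolding n by (simp_all add: power2_eq_square)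
  have sub: "{t, t ^ 2, q, card M} \<subseteq> nsn_orders" using O[OF t(1), of 2] O1[OF t(1)] O1[OF q(1,2)] mO td by simp
  have t2p: "\<not> prime (t ^ 2)" by (simp add: prime_power_iff)
  have c4: "card {t, t ^ 2, q, card M} = 4"
    using t2p t(1) q(1,3) pm[OF t(1)] pm[OF q(1)] ppm[OF t(1), of 2] by (auto simp: card_insert_if)
  have eq: "nsn_orders = {t, t ^ 2, q, card M}"
    using nsn_orders_eq[OF _ sub] c4 D by simp
  have "n = q ^ multiplicity q n"
  proof (rule power_of_only_prime_divisor[OF n0 q(1)])
    fix r assume r: "prime r" "r dvd n"
    have "r dvd card M" using r(2) unfolding n by simp
    then have "r \<in> {t, t ^ 2, q, card M}" using O1[OF r(1)] eq by simp
    moreover have "r \<noteq> t" using r(2) tn by blast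
    ultimately show "r = q" using t2p r(1) pm[OF r(1)] by auto
  qed
  then obtain e where e: "n = q ^ e" by blast
  have "e \<noteq> 0" using n e mixed[OF t(1), of 2] by auto
  moreover have "\<not> e \<ge> 2"
  proof
    assume "e \<ge> 2"
    then have "q ^ 2 dvd n" unfolding e by (rule le_imp_power_dvd)
    then have "q ^ 2 dvd card M" unfolding n by simp
    then have "q ^ 2 \<in> {t, t ^ 2, q, card M}" using O[OF q(1), of 2] eq by simp
    moreover have "\<not> prime (q ^ 2)" by (simp add: prime_power_iff)
    then have "q ^ 2 \<noteq> t" "q ^ 2 \<noteq> q" using t(1) q(1) by metis+
    moreover have "q ^ 2 \<noteq> t ^ 2" using prime_power_ne[OF q(1) t(1) q(3), of 2] by simp
    ultimately show False using ppm[OF q(1), of 2] by blast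
  qed
  ultimately have "e = 1" by linarith
  then have cM: "card M = t ^ 2 * q" using n e by simp
  show False
    by (rule no_metabelian_by_cyclic[OF D M(1) MD s cM t(1) q(1) q(3)[symmetric] nn(1,3) cV ncyc nc sub])
qed

text \<open>A nonabelian \<open>M\<close> of order \<open>r^a\<close> has \<open>a \<ge> 3\<close>,
  and \<open>a \<ge> 5\<close> gives five orders. If the index \<open>s\<close> equals
  \<open>r\<close>, the whole group is an \<open>r\<close>-group.\<close>

theorem solvable_nonmetabelian_iso_SL23:
  assumes D: "D_count G \<le> 4" and sol: "solvable G" and d: "(derived G ^^ 2) (carrier G) \<noteq> {\<one>}"
  shows "G \<cong> SL23"
proof -
  have "carrier G \<noteq> {\<one>}"
  proof
    assume e: "carrier G = {\<one>}"
    have "\<one> \<in> (derived G ^^ 2) (carrier G)" "(derived G ^^ 2) (carrier G) \<subseteq> carrier G"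
      using exp_of_derived_is_subgroup[OF subgroup_self, of 2] subgroup.one_closed subgroup.subset by blast+
    then show False using d e by blast
  qed
  then have "derived G (carrier G) \<noteq> carrier G" by (rule solvable_derived_ne[OF sol subgroup_self])
  then obtain M s where M: "M \<lhd> G" "derived G (carrier G) \<subseteq> M" "prime s" "order G = s * card M"
    by (rule normal_prime_index_exists)
  have sM: "subgroup M G" using M(1) normal_imp_subgroup by blast
  have na: "\<not> M \<subseteq> cent M" by (rule derived_nonabelian[OF sM M(2) d])
  obtain r a where r: "prime r" "card M = r ^ a"
    using prime_index_derived_case[OF D sol d M] by blast
  have a3: "a \<ge> 3" using abelian_order_le_p_squared[OF sM r(2,1)] na by fastforce
  have O: "r ^ k \<in> nsn_orders" if "0 < k" "k \<le> a" for k
    using nsn_orders_prime_index[OF M(1,3,4) r(1) that(1)] r(2) that(2) by (simp add: le_imp_power_dvd)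
  have "a \<le> 4"
  proof (rule ccontr)
    assume "\<not> a \<le> 4"
    then have "(\<lambda>k. r ^ k) ` {1..5::nat} \<subseteq> nsn_orders" using O by auto
    then show False using no_five_orders[OF D] card_powers[OF r(1), of 5] by blast
  qed
  then consider "s = r" | "s \<noteq> r" "a = 3" | "s \<noteq> r" "a = 4" using a3 by linarith
  then show ?thesis
  proof cases
    case 1
    have "\<not> carrier G \<subseteq> cent (carrier G)" using na cent_mono[of M "carrier G"] subgroup.subset[OF sM] by blast
    then show ?thesis using no_normal_p_index_p[OF D _ r(1) a3] M(4) r(2) 1 by simp
  next
    case 2
    then show ?thesis using normal_p3_iso_SL23[OF D M(1) _ r(1) na M(3) _ M(4)] r(2) O by simp
  next
    case 3
    then show ?thesis using no_normal_p4[OF D M(1) _ r(1) na M(3) _ M(4)] r(2) O by simp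
  qed
qed

end

theorem mainTheorem19:
  fixes G (structure)
  assumes "group G" and "finite (carrier G)"
    and "D_count G = 4"
    and "\<not> (G \<cong> alt_group 5)"
  shows "solvable G \<and> ((derived G ^^ 2) (carrier G) = {\<one>\<^bsub>G\<^esub>} \<or> G \<cong> SL23)"
proof -
  interpret fin_group G
    using assms(1,2) by (simp add: fin_group_def fin_group_axioms_def)
  have D: "D_count G \<le> 4" using assms(3) by simp
  then have "card nsn_orders \<le> 4" using nsn_orders_le_D_count by (rule le_trans[rotated])
  then have "solvable G" using nonsolvable_iso_alt_group_5 assms(4) by blast
  then show ?thesis using solvable_nonmetabelian_iso_SL23[OF D] by blast
qed
end
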